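(* Let $g\colon L^2\to\mathbb{S}^{n+2}$, with $L^2$ simply-connected, be a substantial pseudoholomorphic surface. Then $F_g\circ S_{-\theta}$ is congruent to $F_\theta$ (i.e. they differ by an isometry of $\mathbb{S}^{n+2}$) for any $\theta\in\mathbb{S}^1=[0,\pi)$.
   Context: Surfaces $L^2$ are connected and oriented, with complex structure $J$; $n\ge3$ and $\mathbb{S}^{n+2}\subset\mathbb{R}^{n+3}$ is the unit sphere. A surface is substantial if its image is not contained in a proper totally geodesic subsphere. For a substantial minimal surface $g$ the normal bundle splits on an open dense subset as $N_gL=N_1^g\oplus\dots\oplus N_m^g$, $m=[(n+1)/2]$, where $N_s^g$ is spanned by the values of the $(s+1)$-th fundamental form $\alpha_g^{s+1}$; here $\alpha_g^2=\alpha_g$ is the second fundamental form and $\alpha_g^{s+1}(X_1,\dots,X_{s+1})$ is the component of $\nabla^\perp_{X_{s+1}}\cdots\nabla^\perp_{X_3}\alpha_g(X_2,X_1)$ orthogonal to $N_1^g\oplus\dots\oplus N_{s-1}^g$. All $N_s^g$ have rank two, except that the last one has rank one if $n$ is odd. The ellipse of curvature of order $s$ at $p$ is $\{\alpha_g^{s+1}(X,\dots,X): X\in T_pL,\|X\|=1\}$. A substantial minimal surface in even codimension ($n$ even) is pseudoholomorphic if the ellipses of curvature of all orders at all points are circles; the bundles $N_s^g$ then extend smoothly to plane bundles over $L^2$, denoted in the same way. Each $N_s^g$ is oriented by $(\alpha_g^{s+1}(X,\dots,X),\alpha_g^{s+1}(JX,X,\dots,X))$, $X\neq0$. Associated family: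 with $J_\theta=\cos\theta I+\sin\theta J$, for each $\theta$ there is an isometric minimal immersion $g_\theta\colon L^2\to\mathbb{S}^{n+2}$ and a parallel vector bundle isometry $\phi_\theta\colon N_gL\to N_{g_\theta}L$, mapping each $N_s^g$ onto $N_s^{g_\theta}$, such that $\alpha_{g_\theta}(X,Y)=\phi_\theta\alpha_g(J_\theta X,Y)$. Let $\Lambda_g$ be the orthogonal complement of $N_1^g$ in $N_gL$. Let $N_2^g(p)\subset\Lambda_g(p)$ at each point be the span of the $\Lambda_g$-components of $\nabla^\perp_X\xi$, with $X\in T_pL$ and $\xi$ a section of $N_1^g$, and let $\Lambda_g^*(p)=\{v\in\Lambda_g(p): v\perp N_2^g(p)\}$, $S_G=\{0\}\times\{(p,v): v\in\Lambda_g^*(p)\smallsetminus\{0\}\}$. Define $M^n=\{(s,p,v)\in(\mathbb{R}\times\Lambda_g)\smallsetminus S_G: s^2+\|v\|^2=1\}$ with the metric induced by $F_g(s,p,v)=s\,g(p)+v$, and set $$F_\theta(s,p,v)=s\,g_\theta(p)+\phi_\theta v .$$ The rotation of angle $\theta$ that preserves orientation in each $N_s^g$, $s\ge2$, gives a bundle map of $\Lambda_g=N_2^g\oplus\dots\oplus N_m^g$, and hence (fixing $s$ and $p$) induces an intrinsic isometry $S_\theta$ of $M^n$. *)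

theory Defs
  imports "HOL-Analysis.Analysis"
begin

section \<open>Smooth oriented surfaces\<close>

primrec Ck_on :: "nat \<Rightarrow> (real^2 \<Rightarrow> 'b::real_normed_vector) \<Rightarrow> (real^2) set \<Rightarrow> bool" where
  "Ck_on 0 f U \<longleftrightarrow> continuous_on U f"
| "Ck_on (Suc k) f U \<longleftrightarrow> f differentiable_on U \<and>
     (\<forall>a. Ck_on k (\<lambda>u. frechet_derivative f (at u) a) U)"

text \<open>Only used for open sets \<open>U\<close>.\<close>
definition smooth_on :: "(real^2 \<Rightarrow> 'b::real_normed_vector) \<Rightarrow> (real^2) set \<Rightarrow> bool" where
  "smooth_on f U \<longleftrightarrow> (\<forall>k. Ck_on k f U)"

text \<open>A chart is a pair of its domain and its coordinate map.\<close>
type_synonym 'l chart = "'l set \<times> ('l \<Rightarrow> real^2)"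

definition in_chart :: "'l chart \<Rightarrow> ('l \<Rightarrow> 'b) \<Rightarrow> real^2 \<Rightarrow> 'b" where
  "in_chart c f = f \<circ> inv_into (fst c) (snd c)"

text \<open>The surface is the whole type \<open>'l\<close>; Hausdorff and second countable come from the type
  classes. The orientation is the one for which every chart of \<open>A\<close> is positive.\<close>
definition oriented_surface ::
  "('l::{t2_space,second_countable_topology}) chart set \<Rightarrow> bool" where
  "oriented_surface A \<longleftrightarrow>
     connected (UNIV :: 'l set) \<and> (\<Union>c\<in>A. fst c) = UNIV \<and>
     (\<forall>(U, x)\<in>A. open U \<and> open (x ` U) \<and> homeomorphism U (x ` U) x (inv_into U x)) \<and>
     (\<forall>(U, x)\<in>A. \<forall>(V, y)\<in>A.
        smooth_on (in_chart (U, x) y) (x ` (U \<inter> V)) \<and>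
        (\<forall>u\<in>x ` (U \<inter> V). 0 < det (jacobian (in_chart (U, x) y) (at u))))"

definition smooth_map ::
  "('l::topological_space) chart set \<Rightarrow> 'l set \<Rightarrow> ('l \<Rightarrow> 'b::real_normed_vector) \<Rightarrow> bool" where
  "smooth_map A W f \<longleftrightarrow> (\<forall>c\<in>A. smooth_on (in_chart c f) (snd c ` (W \<inter> fst c)))"

text \<open>A tangent vector at \<open>p\<close> is given by its coordinate vector in a chart around \<open>p\<close>;
  \<open>dmap c f p X\<close> is the derivative of \<open>f\<close> at \<open>p\<close> in the direction with coordinates \<open>X\<close>.\<close>
definition dmap ::
  "'l chart \<Rightarrow> ('l \<Rightarrow> 'b::real_normed_vector) \<Rightarrow> 'l \<Rightarrow> real^2 \<Rightarrow> 'b" where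
  "dmap c f p X = frechet_derivative (in_chart c f) (at (snd c p)) X"


section \<open>Surfaces in the unit sphere\<close>

definition oproj :: "'a::euclidean_space set \<Rightarrow> 'a \<Rightarrow> 'a" where
  "oproj V v = (THE w. w \<in> V \<and> (\<forall>u\<in>V. (v - w) \<bullet> u = 0))"

definition sphere_immersion ::
  "('l::topological_space) chart set \<Rightarrow> ('l \<Rightarrow> 'a::euclidean_space) \<Rightarrow> bool" where
  "sphere_immersion A g \<longleftrightarrow> smooth_map A UNIV g \<and> range g \<subseteq> sphere 0 1 \<and>
     (\<forall>c\<in>A. \<forall>p\<in>fst c. inj (dmap c g p))"

definition tangent_plane :: "'l chart set \<Rightarrow> ('l \<Rightarrow> 'a::euclidean_space) \<Rightarrow> 'l \<Rightarrow> 'a set" where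
  "tangent_plane A g p = (\<Union>c\<in>{c\<in>A. p \<in> fst c}. range (dmap c g p))"

text \<open>The fibre of the normal bundle of \<open>g\<close> as a surface in the sphere, hence also orthogonal to
  the position vector.\<close>
definition normal_space :: "'l chart set \<Rightarrow> ('l \<Rightarrow> 'a::euclidean_space) \<Rightarrow> 'l \<Rightarrow> 'a set" where
  "normal_space A g p = {v. v \<bullet> g p = 0 \<and> (\<forall>t\<in>tangent_plane A g p. v \<bullet> t = 0)}"

definition normal_conn ::
  "'l chart set \<Rightarrow> 'l chart \<Rightarrow> ('l \<Rightarrow> 'a::euclidean_space) \<Rightarrow> real^2 \<Rightarrow> ('l \<Rightarrow> 'a) \<Rightarrow> 'l \<Rightarrow> 'a" where
  "normal_conn A c g X \<xi> p = oproj (normal_space A g p) (dmap c \<xi> p X)"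

text \<open>The complex structure of the surface in chart coordinates: the rotation by \<open>\<pi>/2\<close> for the
  metric induced by \<open>g\<close> and the orientation.\<close>
definition cstruct :: "'l chart \<Rightarrow> ('l \<Rightarrow> 'a::euclidean_space) \<Rightarrow> 'l \<Rightarrow> real^2 \<Rightarrow> real^2" where
  "cstruct c g p X = (THE Y. dmap c g p X \<bullet> dmap c g p Y = 0 \<and>
     norm (dmap c g p Y) = norm (dmap c g p X) \<and>
     (X \<noteq> 0 \<longrightarrow> 0 < det (vector [X, Y] :: real^2^2)))"

text \<open>\<open>iter_ff A c g [X\<^sub>r, \<dots>, X\<^sub>3, X\<^sub>2, X\<^sub>1]\<close> is
  \<open>\<nabla>\<^sup>\<bottom>\<^bsub>X\<^sub>r\<^esub> \<dots> \<nabla>\<^sup>\<bottom>\<^bsub>X\<^sub>3\<^esub> \<alpha>(X\<^sub>2, X\<^sub>1)\<close>, the vectors being extended by constant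
  coordinates. Here \<open>\<alpha>(X\<^sub>2, X\<^sub>1)\<close> is the normal part of the derivative in direction
  \<open>X\<^sub>2\<close> of the vector field \<open>dg(X\<^sub>1)\<close>.\<close>
fun iter_ff ::
  "'l chart set \<Rightarrow> 'l chart \<Rightarrow> ('l \<Rightarrow> 'a::euclidean_space) \<Rightarrow> (real^2) list \<Rightarrow> 'l \<Rightarrow> 'a" where
  "iter_ff A c g [] = g"
| "iter_ff A c g [X] = (\<lambda>p. dmap c g p X)"
| "iter_ff A c g (X # Y # Xs) = normal_conn A c g X (iter_ff A c g (Y # Xs))"

definition second_ff ::
  "'l chart set \<Rightarrow> 'l chart \<Rightarrow> ('l \<Rightarrow> 'a::euclidean_space) \<Rightarrow> 'l \<Rightarrow> real^2 \<Rightarrow> real^2 \<Rightarrow> 'a" where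
  "second_ff A c g p X Y = iter_ff A c g [X, Y] p"

text \<open>\<open>Nsum A c g s p\<close> is \<open>N\<^sub>1 \<oplus> \<dots> \<oplus> N\<^sub>s\<close> at \<open>p\<close>, where
  \<open>N\<^sub>s = curv_space A c g s p\<close> is the span of the values of the \<open>(s+1)\<close>-th fundamental form at
  that very point. All this makes sense at every point, but ranks may drop at
  exceptional points.\<close>
primrec Nsum ::
  "'l chart set \<Rightarrow> 'l chart \<Rightarrow> ('l \<Rightarrow> 'a::euclidean_space) \<Rightarrow> nat \<Rightarrow> 'l \<Rightarrow> 'a set" where
  "Nsum A c g 0 p = {0}"
| "Nsum A c g (Suc s) p = span (Nsum A c g s p \<union>
     {iter_ff A c g (rev Xs) p - oproj (Nsum A c g s p) (iter_ff A c g (rev Xs) p) |Xs.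
        length Xs = s + 2})"

text \<open>The fundamental form of order \<open>r = length Xs \<ge> 2\<close>,
  with arguments \<open>Xs = [X\<^sub>1, \<dots>, X\<^sub>r]\<close>.\<close>
definition fund_form ::
  "'l chart set \<Rightarrow> 'l chart \<Rightarrow> ('l \<Rightarrow> 'a::euclidean_space) \<Rightarrow> 'l \<Rightarrow> (real^2) list \<Rightarrow> 'a" where
  "fund_form A c g p Xs = iter_ff A c g (rev Xs) p -
     oproj (Nsum A c g (length Xs - 2) p) (iter_ff A c g (rev Xs) p)"

definition curv_space ::
  "'l chart set \<Rightarrow> 'l chart \<Rightarrow> ('l \<Rightarrow> 'a::euclidean_space) \<Rightarrow> nat \<Rightarrow> 'l \<Rightarrow> 'a set" where
  "curv_space A c g s p = span {fund_form A c g p Xs |Xs. length Xs = s + 1}"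

lemma Nsum_Suc: "Nsum A c g (Suc s) p = span (Nsum A c g s p \<union> curv_space A c g (Suc s) p)"
proof -
  have *: "fund_form A c g p Xs = iter_ff A c g (rev Xs) p -
      oproj (Nsum A c g s p) (iter_ff A c g (rev Xs) p)" if "length Xs = s + 2" for Xs
    using that by (simp only: fund_form_def diff_add_inverse2)
  have "{iter_ff A c g (rev Xs) p - oproj (Nsum A c g s p) (iter_ff A c g (rev Xs) p) |Xs.
           length Xs = s + 2} = {fund_form A c g p Xs |Xs. length Xs = s + 2}"
    using * by metis
  moreover have "span (Nsum A c g s p \<union> span C) = span (Nsum A c g s p \<union> C)" for C
    by (simp add: span_Un span_span)
  ultimately show ?thesis
    by (simp only: Nsum.simps curv_space_def) simp
qed

definition curv_ellipse ::
  "'l chart set \<Rightarrow> 'l chart \<Rightarrow> ('l \<Rightarrow> 'a::euclidean_space) \<Rightarrow> nat \<Rightarrow> 'l \<Rightarrow> 'a set" where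
  "curv_ellipse A c g s p =
     {fund_form A c g p (replicate (s + 1) X) |X. norm (dmap c g p X) = 1}"

text \<open>Radius zero is allowed: at exceptional points a curvature ellipse may be a single point.\<close>
definition is_circle :: "'a::euclidean_space set \<Rightarrow> bool" where
  "is_circle C \<longleftrightarrow> (\<exists>z u v. \<exists>r\<ge>0. norm u = 1 \<and> norm v = 1 \<and> u \<bullet> v = 0 \<and>
     C = {z + (r * cos t) *\<^sub>R u + (r * sin t) *\<^sub>R v |t. t \<in> (UNIV :: real set)})"

definition minimal_surface ::
  "('l::topological_space) chart set \<Rightarrow> ('l \<Rightarrow> 'a::euclidean_space) \<Rightarrow> bool" where
  "minimal_surface A g \<longleftrightarrow> sphere_immersion A g \<and>
     (\<forall>c\<in>A. \<forall>p\<in>fst c. \<forall>X Y. norm (dmap c g p X) = 1 \<longrightarrow> norm (dmap c g p Y) = 1 \<longrightarrow>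
        dmap c g p X \<bullet> dmap c g p Y = 0 \<longrightarrow>
        second_ff A c g p X X + second_ff A c g p Y Y = 0)"

text \<open>Totally geodesic subspheres are the intersections of the sphere with linear subspaces.\<close>
definition substantial :: "('l \<Rightarrow> 'a::euclidean_space) \<Rightarrow> bool" where
  "substantial g \<longleftrightarrow> \<not> (\<exists>V. subspace V \<and> V \<noteq> UNIV \<and> range g \<subseteq> V)"

definition pseudoholomorphic ::
  "('l::topological_space) chart set \<Rightarrow> nat \<Rightarrow> ('l \<Rightarrow> 'a::euclidean_space) \<Rightarrow> bool" where
  "pseudoholomorphic A n g \<longleftrightarrow> even n \<and> minimal_surface A g \<and> substantial g \<and>
     (\<forall>c\<in>A. \<forall>p\<in>fst c. \<forall>s\<in>{1..(n + 1) div 2}. is_circle (curv_ellipse A c g s p))"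


section \<open>The normal bundle splitting and its orientation\<close>

text \<open>\<open>pos p v w\<close> says that \<open>(v, w)\<close> is a positively oriented basis of \<open>V p\<close>. The
  determinant compares \<open>(v, w)\<close> with the local frame \<open>(e, f)\<close>.\<close>
definition oriented_plane_bundle ::
  "('l::topological_space) chart set \<Rightarrow> ('l \<Rightarrow> 'a::euclidean_space set) \<Rightarrow>
     ('l \<Rightarrow> 'a \<Rightarrow> 'a \<Rightarrow> bool) \<Rightarrow> bool" where
  "oriented_plane_bundle A V pos \<longleftrightarrow>
     (\<forall>p. \<exists>U e f. open U \<and> p \<in> U \<and> smooth_map A U e \<and> smooth_map A U f \<and>
        (\<forall>q\<in>U. V q = span {e q, f q} \<and> dim (V q) = 2 \<and>
           (\<forall>v w. pos q v w \<longleftrightarrow> v \<in> V q \<and> w \<in> V q \<and>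
              0 < (v \<bullet> e q) * (w \<bullet> f q) - (v \<bullet> f q) * (w \<bullet> e q))))"

text \<open>\<open>N s\<close> is the smooth plane bundle over the whole surface, with orientation \<open>pos s\<close>,
  that coincides on an open dense set with the span of the values of the \<open>(s+1)\<close>-th fundamental
  form, oriented by \<open>(\<alpha>(X,\<dots>,X), \<alpha>(JX,X,\<dots>,X))\<close>. By continuity both are
  uniquely determined by \<open>g\<close>.\<close>
definition oriented_splitting ::
  "('l::topological_space) chart set \<Rightarrow> nat \<Rightarrow> ('l \<Rightarrow> 'a::euclidean_space) \<Rightarrow>
     (nat \<Rightarrow> 'l \<Rightarrow> 'a set) \<Rightarrow> (nat \<Rightarrow> 'l \<Rightarrow> 'a \<Rightarrow> 'a \<Rightarrow> bool) \<Rightarrow> bool" where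
  "oriented_splitting A m g N pos \<longleftrightarrow>
     (\<forall>s\<in>{1..m}. oriented_plane_bundle A (N s) (pos s)) \<and>
     (\<exists>W. open W \<and> closure W = UNIV \<and>
        (\<forall>c\<in>A. \<forall>p\<in>W \<inter> fst c.
           normal_space A g p = span (\<Union>s\<in>{1..m}. N s p) \<and>
           (\<forall>s\<in>{1..m}. N s p = curv_space A c g s p \<and>
              (\<forall>X. X \<noteq> 0 \<longrightarrow> pos s p (fund_form A c g p (replicate (s + 1) X))
                 (fund_form A c g p (cstruct c g p X # replicate s X))))))"


section \<open>The associated family\<close>

definition J_rot ::
  "'l chart \<Rightarrow> ('l \<Rightarrow> 'a::euclidean_space) \<Rightarrow> real \<Rightarrow> 'l \<Rightarrow> real^2 \<Rightarrow> real^2" where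
  "J_rot c g \<theta> p X = cos \<theta> *\<^sub>R X + sin \<theta> *\<^sub>R cstruct c g p X"

definition isometric ::
  "'l chart set \<Rightarrow> ('l \<Rightarrow> 'a::euclidean_space) \<Rightarrow> ('l \<Rightarrow> 'a) \<Rightarrow> bool" where
  "isometric A g h \<longleftrightarrow> (\<forall>c\<in>A. \<forall>p\<in>fst c. \<forall>X Y.
     dmap c h p X \<bullet> dmap c h p Y = dmap c g p X \<bullet> dmap c g p Y)"

text \<open>\<open>\<phi> p\<close> matters only on the fibre \<open>normal_space A g p\<close>.\<close>
definition parallel_bundle_isometry ::
  "('l::topological_space) chart set \<Rightarrow> ('l \<Rightarrow> 'a::euclidean_space) \<Rightarrow> ('l \<Rightarrow> 'a) \<Rightarrow>
     ('l \<Rightarrow> 'a \<Rightarrow> 'a) \<Rightarrow> bool" where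
  "parallel_bundle_isometry A g h \<phi> \<longleftrightarrow>
     (\<forall>p. \<phi> p ` normal_space A g p = normal_space A h p \<and>
        (\<forall>v\<in>normal_space A g p. \<forall>w\<in>normal_space A g p. \<forall>r.
           \<phi> p (v + w) = \<phi> p v + \<phi> p w \<and> \<phi> p (r *\<^sub>R v) = r *\<^sub>R \<phi> p v \<and>
           \<phi> p v \<bullet> \<phi> p w = v \<bullet> w)) \<and>
     (\<forall>U \<xi>. open U \<longrightarrow> smooth_map A U \<xi> \<longrightarrow> (\<forall>q\<in>U. \<xi> q \<in> normal_space A g q) \<longrightarrow>
        smooth_map A U (\<lambda>q. \<phi> q (\<xi> q)) \<and>
        (\<forall>c\<in>A. \<forall>p\<in>U \<inter> fst c. \<forall>X.
           normal_conn A c h X (\<lambda>q. \<phi> q (\<xi> q)) p = \<phi> p (normal_conn A c g X \<xi> p)))"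

text \<open>\<open>h\<close> and \<open>\<phi>\<close> are the member of parameter \<open>\<theta>\<close> of the associated family of
  \<open>g\<close> and the corresponding isometry of normal bundles.\<close>
definition associated_member ::
  "('l::topological_space) chart set \<Rightarrow> nat \<Rightarrow> ('l \<Rightarrow> 'a::euclidean_space) \<Rightarrow> real \<Rightarrow>
     ('l \<Rightarrow> 'a) \<Rightarrow> ('l \<Rightarrow> 'a \<Rightarrow> 'a) \<Rightarrow> bool" where
  "associated_member A m g \<theta> h \<phi> \<longleftrightarrow>
     minimal_surface A h \<and> isometric A g h \<and> parallel_bundle_isometry A g h \<phi> \<and>
     (\<forall>c\<in>A. \<forall>p\<in>fst c.
        (\<forall>s\<in>{1..m}. \<phi> p ` curv_space A c g s p = curv_space A c h s p) \<and>
        (\<forall>X Y. second_ff A c h p X Y = \<phi> p (second_ff A c g p (J_rot c g \<theta> p X) Y)))"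


section \<open>The hypersurface family\<close>

text \<open>\<open>N1\<close> stands for the (extended) bundle \<open>N\<^sub>1\<close> of \<open>g\<close>.\<close>
definition Lam :: "'l chart set \<Rightarrow> ('l \<Rightarrow> 'a::euclidean_space) \<Rightarrow> ('l \<Rightarrow> 'a set) \<Rightarrow> 'l \<Rightarrow> 'a set" where
  "Lam A g N1 p = {v\<in>normal_space A g p. \<forall>w\<in>N1 p. v \<bullet> w = 0}"

text \<open>The pointwise span; it may be smaller than the fibre of the
  extended plane bundle \<open>N\<^sub>2\<close> at exceptional points.\<close>
definition N2_span ::
  "('l::topological_space) chart set \<Rightarrow> ('l \<Rightarrow> 'a::euclidean_space) \<Rightarrow> ('l \<Rightarrow> 'a set) \<Rightarrow> 'l \<Rightarrow> 'a set" where
  "N2_span A g N1 p = span {oproj (Lam A g N1 p) (normal_conn A c g X \<xi> p) |c X \<xi> U.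
     c \<in> A \<and> p \<in> fst c \<and> open U \<and> p \<in> U \<and> smooth_map A U \<xi> \<and> (\<forall>q\<in>U. \<xi> q \<in> N1 q)}"

definition Lam_star ::
  "('l::topological_space) chart set \<Rightarrow> ('l \<Rightarrow> 'a::euclidean_space) \<Rightarrow> ('l \<Rightarrow> 'a set) \<Rightarrow> 'l \<Rightarrow> 'a set" where
  "Lam_star A g N1 p = {v\<in>Lam A g N1 p. \<forall>w\<in>N2_span A g N1 p. v \<bullet> w = 0}"

definition S_sing ::
  "('l::topological_space) chart set \<Rightarrow> ('l \<Rightarrow> 'a::euclidean_space) \<Rightarrow> ('l \<Rightarrow> 'a set) \<Rightarrow>
     (real \<times> 'l \<times> 'a) set" where
  "S_sing A g N1 = {0} \<times> {(p, v). v \<in> Lam_star A g N1 p - {0}}"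

definition M_set ::
  "('l::topological_space) chart set \<Rightarrow> ('l \<Rightarrow> 'a::euclidean_space) \<Rightarrow> ('l \<Rightarrow> 'a set) \<Rightarrow>
     (real \<times> 'l \<times> 'a) set" where
  "M_set A g N1 = {(s, p, v). v \<in> Lam A g N1 p \<and> (s, p, v) \<notin> S_sing A g N1 \<and>
     s\<^sup>2 + (norm v)\<^sup>2 = 1}"

definition F_map :: "('l \<Rightarrow> 'a::euclidean_space) \<Rightarrow> real \<times> 'l \<times> 'a \<Rightarrow> 'a" where
  "F_map g = (\<lambda>(s, p, v). s *\<^sub>R g p + v)"

definition F_assoc ::
  "('l \<Rightarrow> 'a::euclidean_space) \<Rightarrow> ('l \<Rightarrow> 'a \<Rightarrow> 'a) \<Rightarrow> real \<times> 'l \<times> 'a \<Rightarrow> 'a" where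
  "F_assoc h \<phi> = (\<lambda>(s, p, v). s *\<^sub>R h p + \<phi> p v)"

definition quarter_turn :: "'a::euclidean_space set \<Rightarrow> ('a \<Rightarrow> 'a \<Rightarrow> bool) \<Rightarrow> 'a \<Rightarrow> 'a" where
  "quarter_turn V pos v =
     (THE w. w \<in> V \<and> v \<bullet> w = 0 \<and> norm w = norm v \<and> (v \<noteq> 0 \<longrightarrow> pos v w))"

definition Lam_rot ::
  "(nat \<Rightarrow> 'l \<Rightarrow> 'a::euclidean_space set) \<Rightarrow> (nat \<Rightarrow> 'l \<Rightarrow> 'a \<Rightarrow> 'a \<Rightarrow> bool) \<Rightarrow> nat \<Rightarrow>
     real \<Rightarrow> 'l \<Rightarrow> 'a \<Rightarrow> 'a" where
  "Lam_rot N pos m \<theta> p v = (\<Sum>s=2..m. let w = oproj (N s p) v in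
     cos \<theta> *\<^sub>R w + sin \<theta> *\<^sub>R quarter_turn (N s p) (pos s p) w)"

definition S_rot ::
  "(nat \<Rightarrow> 'l \<Rightarrow> 'a::euclidean_space set) \<Rightarrow> (nat \<Rightarrow> 'l \<Rightarrow> 'a \<Rightarrow> 'a \<Rightarrow> bool) \<Rightarrow> nat \<Rightarrow>
     real \<Rightarrow> real \<times> 'l \<times> 'a \<Rightarrow> real \<times> 'l \<times> 'a" where
  "S_rot N pos m \<theta> = (\<lambda>(s, p, v). (s, p, Lam_rot N pos m \<theta> p v))"

text \<open>The isometries of the unit sphere are the restrictions of the orthogonal transformations of
  the ambient space.\<close>
definition congruent_on ::
  "'b set \<Rightarrow> ('b \<Rightarrow> 'a::euclidean_space) \<Rightarrow> ('b \<Rightarrow> 'a) \<Rightarrow> bool" where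
  "congruent_on M F G \<longleftrightarrow> (\<exists>T. orthogonal_transformation T \<and> (\<forall>x\<in>M. G x = T (F x)))"

end

theory Submission
  imports Defs
begin

text \<open>For each point \<open>p\<close> let \<open>T p\<close> be the linear map of the ambient space with
    \<open>g p \<mapsto> h p\<close>, \<open>dg X \<mapsto> dh X\<close>, and \<open>v \<mapsto> \<phi> (R v)\<close> for normal vectors \<open>v\<close>,
  where \<open>R\<close> rotates every plane \<open>N s\<close>, including \<open>N 1\<close>, by \<open>\<theta>\<close>. It is orthogonal. If it does not
  depend on \<open>p\<close>, the theorem follows at once: the common value \<open>T\<close> sends \<open>s g p + R\<^sup>-\<^sup>1 v\<close> to
  \<open>s h p + \<phi> v\<close> for every \<open>v\<close> in the fibre of \<open>\<Lambda>\<close>.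

  To see that \<open>T p\<close> is constant, take a local orthonormal frame of position, tangent and normal
  vectors of \<open>g\<close> and its image under \<open>T\<close>, a frame along \<open>h\<close>. Two orthonormal frames with the same
  connection forms differ by a constant transformation (\<open>equal_connection_forms_rigid\<close>), so the
  connection forms have to be compared.

  \<^item> The tangential forms agree because \<open>h\<close> is isometric to \<open>g\<close> (\<open>koszul\<close>).

  \<^item> The forms between tangent and normal vectors agree because the first ellipse of curvature is a
  circle: rotating one argument of the second fundamental form of \<open>g\<close> by \<open>\<theta>\<close> rotates its value by
  \<open>\<theta>\<close> (\<open>second_order_turn\<close>). So the second fundamental form of \<open>h\<close> is the \<open>T\<close>-image of the one of
  \<open>g\<close>.

  \<^item> As \<open>\<phi>\<close> is parallel, the normal forms agree if \<open>R\<close> is parallel, that is, if the quarter turn of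
  the planes \<open>N s\<close> commutes with the normal connection (\<open>connection_turn\<close>). Inside one oriented
  plane bundle this is automatic. Derivatives of sections of \<open>N s\<close> have no component in \<open>N t\<close> for
  \<open>t > s + 1\<close>. The component in \<open>N (s + 1)\<close> is given by the fundamental form of order \<open>s + 2\<close>, and
  since the ellipses of orders \<open>s\<close> and \<open>s + 1\<close> are circles, applying the complex structure to one
  argument turns the values of both forms by a right angle (\<open>quarter_turn_forms\<close>).

  The circles give this last fact because the higher fundamental forms are symmetric and traceless.
  Both properties are visible in arbitrary coordinates: modulo terms of lower order the iterated
  normal derivatives are the iterated partial derivatives of \<open>g\<close>. Partial derivatives commute, and
  minimality is a relation between second derivatives modulo first order terms that can be
  differentiated (\<open>trace_drops_order\<close>).

  All this uses that \<open>N s\<close> is spanned by the values of a fundamental form, which holds only on an open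
  dense set, and that set may be disconnected. The frames, however, are smooth everywhere. So the
  derivative of \<open>T\<close> is continuous and vanishes on a dense set, hence everywhere, and the surface is
  connected.\<close>

section \<open>Orthogonal projections\<close>

lemma oproj_unique:
  fixes V :: "'a::euclidean_space set"
  assumes "subspace V" "w \<in> V" "\<And>u. u \<in> V \<Longrightarrow> (v - w) \<bullet> u = 0"
  shows "oproj V v = w"
  unfolding oproj_def
proof (rule the_equality)
  show "w \<in> V \<and> (\<forall>u\<in>V. (v - w) \<bullet> u = 0)" using assms by auto
next
  fix w' assume w': "w' \<in> V \<and> (\<forall>u\<in>V. (v - w') \<bullet> u = 0)"
  have "w - w' \<in> V" using assms(1,2) w' by (simp add: subspace_diff)
  then have "(v - w) \<bullet> (w - w') = 0" "(v - w') \<bullet> (w - w') = 0" using assms(3) w' by auto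
  then have "(w - w') \<bullet> (w - w') = 0" by (simp add: inner_diff_left)
  then show "w' = w" by simp
qed

lemma oproj:
  fixes V :: "'a::euclidean_space set"
  assumes "subspace V"
  shows oproj_in: "oproj V v \<in> V"
    and oproj_orth: "\<And>u. u \<in> V \<Longrightarrow> (v - oproj V v) \<bullet> u = 0"
proof -
  obtain y z where yz: "y \<in> span V" "\<And>w. w \<in> span V \<Longrightarrow> orthogonal z w" "v = y + z"
    using orthogonal_subspace_decomp_exists[of V v] by blast
  have sp: "span V = V" using assms by simp
  have "oproj V v = y" using assms yz unfolding sp orthogonal_def by (intro oproj_unique) auto
  then show "oproj V v \<in> V" "\<And>u. u \<in> V \<Longrightarrow> (v - oproj V v) \<bullet> u = 0"
    using yz unfolding sp orthogonal_def by auto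
qed

lemma inner_span_zero:
  fixes w :: "'a::real_inner"
  assumes "x \<in> span S" "\<And>y. y \<in> S \<Longrightarrow> y \<bullet> w = 0"
  shows "x \<bullet> w = 0"
  using assms(1) by (induction rule: span_induct_alt) (simp_all add: inner_add_left assms(2))

lemma span_pair_coords:
  fixes e f :: "'a::real_inner"
  assumes "e \<bullet> e = 1" "f \<bullet> f = 1" "e \<bullet> f = 0" "x \<in> span {e, f}"
  shows "x = (x \<bullet> e) *\<^sub>R e + (x \<bullet> f) *\<^sub>R f"
proof -
  obtain a b where x: "x = a *\<^sub>R e + b *\<^sub>R f"
    using assms(4) by (auto simp: span_insert eq_diff_eq span_empty algebra_simps)
  have fe: "f \<bullet> e = 0" using assms(3) by (simp add: inner_commute)
  show ?thesis unfolding x using assms(1-3) fe by (simp add: inner_add_left)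
qed

lemma oproj_span_pair:
  fixes e f :: "'a::euclidean_space"
  assumes "e \<bullet> e = 1" "f \<bullet> f = 1" "e \<bullet> f = 0"
  shows "oproj (span {e, f}) v = (v \<bullet> e) *\<^sub>R e + (v \<bullet> f) *\<^sub>R f"
proof (rule oproj_unique)
  show "(v \<bullet> e) *\<^sub>R e + (v \<bullet> f) *\<^sub>R f \<in> span {e, f}"
    by (intro span_add span_scale span_base; simp)
  have fe: "f \<bullet> e = 0" using assms(3) by (simp add: inner_commute)
  fix u assume "u \<in> span {e, f}"
  then have "u \<bullet> (v - ((v \<bullet> e) *\<^sub>R e + (v \<bullet> f) *\<^sub>R f)) = 0"
    by (rule inner_span_zero)
      (use assms fe in \<open>auto simp: inner_diff_right inner_add_right inner_commute[of _ v]\<close>)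
  then show "(v - ((v \<bullet> e) *\<^sub>R e + (v \<bullet> f) *\<^sub>R f)) \<bullet> u = 0" by (simp add: inner_commute)
qed simp


section \<open>Calculus of smooth maps on the plane\<close>

text \<open>The same operation as \<open>dmap\<close>, with the map in coordinates and in the argument order suited to
  iteration.\<close>
definition dd :: "real^2 \<Rightarrow> (real^2 \<Rightarrow> 'b::real_normed_vector) \<Rightarrow> real^2 \<Rightarrow> 'b" where
  "dd X f u = frechet_derivative f (at u) X"

lemma dmap_eq_dd: "dmap c f p X = dd X (in_chart c f) (snd c p)"
  by (simp add: dmap_def dd_def)

lemma dd_eqI: "(f has_derivative D) (at u) \<Longrightarrow> dd X f u = D X"
  unfolding dd_def using frechet_derivative_at[of f D u] by simp

lemma has_derivative_dd:
  "f differentiable (at u) \<Longrightarrow> (f has_derivative (\<lambda>X. dd X f u)) (at u)"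
  unfolding dd_def by (simp add: frechet_derivative_works)

lemma dd_cong:
  assumes "open V" "u \<in> V" "\<And>v. v \<in> V \<Longrightarrow> f v = g v"
  shows "dd X f u = dd X g u"
proof -
  have "(f has_derivative D) (at u) \<longleftrightarrow> (g has_derivative D) (at u)" for D
  proof
    assume f: "(f has_derivative D) (at u)"
    show "(g has_derivative D) (at u)"
      by (rule has_derivative_transform_within_open[OF f assms])
  next
    assume g: "(g has_derivative D) (at u)"
    show "(f has_derivative D) (at u)"
      by (rule has_derivative_transform_within_open[OF g assms(1,2)]) (simp add: assms(3))
  qed
  then show ?thesis unfolding dd_def frechet_derivative_def by simp
qed

lemma linear_dd: "f differentiable (at u) \<Longrightarrow> linear (\<lambda>X. dd X f u)"
  unfolding dd_def by (rule linear_frechet_derivative)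

lemma dd_add_arg: "f differentiable (at u) \<Longrightarrow> dd (X + Y) f u = dd X f u + dd Y f u"
  using linear_dd[of f u] by (rule linear_add)

lemma dd_scale_arg: "f differentiable (at u) \<Longrightarrow> dd (r *\<^sub>R X) f u = r *\<^sub>R dd X f u"
  using linear_dd[of f u] by (rule linear_scale)

lemma dd_bilinear:
  assumes "bounded_bilinear B" "f differentiable (at u)" "g differentiable (at u)"
  shows "dd X (\<lambda>v. B (f v) (g v)) u = B (f u) (dd X g u) + B (dd X f u) (g u)"
  using dd_eqI[OF bounded_bilinear.FDERIV[OF assms(1) has_derivative_dd[OF assms(2)]
    has_derivative_dd[OF assms(3)]]] .

lemma dd_inner:
  assumes "f differentiable (at u)" "g differentiable (at u)"
  shows "dd X (\<lambda>v. f v \<bullet> g v) u = f u \<bullet> dd X g u + dd X f u \<bullet> g u"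
  using dd_bilinear[OF bounded_bilinear_inner assms] .

lemma dd_scaleR:
  assumes "f differentiable (at u)" "g differentiable (at u)"
  shows "dd X (\<lambda>v. f v *\<^sub>R g v) u = f u *\<^sub>R dd X g u + dd X f u *\<^sub>R g u"
  using dd_bilinear[OF bounded_bilinear_scaleR assms] .

lemma dd_add:
  assumes "f differentiable (at u)" "g differentiable (at u)"
  shows "dd X (\<lambda>v. f v + g v) u = dd X f u + dd X g u"
  using dd_eqI[OF has_derivative_add[OF has_derivative_dd[OF assms(1)] has_derivative_dd[OF assms(2)]]] .

lemma dd_diff:
  assumes "f differentiable (at u)" "g differentiable (at u)"
  shows "dd X (\<lambda>v. f v - g v) u = dd X f u - dd X g u"
  using dd_eqI[OF has_derivative_diff[OF has_derivative_dd[OF assms(1)] has_derivative_dd[OF assms(2)]]] .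

lemma dd_const: "dd X (\<lambda>v. a) u = 0"
  by (simp add: dd_def)

text \<open>Differentiability class by differentiability class, closure under an operation follows by
  induction because the derivative of the operation is built from the operation itself, products
  and the derivatives of the arguments.\<close>

lemma differentiable_at_Ck: "Ck_on (Suc k) f V \<Longrightarrow> open V \<Longrightarrow> u \<in> V \<Longrightarrow> f differentiable (at u)"
  by (simp add: differentiable_on_def) (metis at_within_open)

lemma Ck_on_Suc:
  "open V \<Longrightarrow> Ck_on (Suc k) f V \<longleftrightarrow> (\<forall>u\<in>V. f differentiable (at u)) \<and> (\<forall>X. Ck_on k (dd X f) V)"
  using at_within_open[of _ V] by (simp add: differentiable_on_def dd_def[abs_def])

lemma Ck_on_cong:
  assumes "open V"
  shows "(\<And>v. v \<in> V \<Longrightarrow> f v = g v) \<Longrightarrow> Ck_on k f V \<Longrightarrow> Ck_on k g V"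
proof (induction k arbitrary: f g)
  case 0
  then show ?case by (simp cong: continuous_on_cong)
next
  case (Suc k)
  have "g differentiable (at u)" if "u \<in> V" for u
    using differentiable_at_Ck[OF Suc.prems(2) assms that] assms that Suc.prems(1)
    by (auto simp: differentiable_def intro: has_derivative_transform_within_open)
  moreover have "Ck_on k (dd X g) V" for X
  proof (rule Suc.IH)
    show "Ck_on k (dd X f) V" using Suc.prems(2) Ck_on_Suc[OF assms] by blast
    show "\<And>v. v \<in> V \<Longrightarrow> dd X f v = dd X g v" using dd_cong[OF assms] Suc.prems(1) by blast
  qed
  ultimately show ?case using Ck_on_Suc[OF assms] by blast
qed

lemma Ck_on_lower: "open V \<Longrightarrow> Ck_on (Suc k) f V \<Longrightarrow> Ck_on k f V"
proof (induction k arbitrary: f)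
  case 0
  then show ?case
    by (simp add: differentiable_imp_continuous_on)
next
  case (Suc k)
  have "Ck_on (Suc k) (dd X f) V" for X
    using Suc.prems Ck_on_Suc by blast
  with Suc show ?case by (metis Ck_on_Suc)
qed

lemma Ck_on_const: "open V \<Longrightarrow> Ck_on k (\<lambda>u. a) V"
proof (induction k arbitrary: a)
  case (Suc k)
  have "dd X (\<lambda>u. a) = (\<lambda>u. 0)" for X by (simp add: dd_const fun_eq_iff)
  with Suc show ?case by (simp add: Ck_on_Suc del: Ck_on.simps(2))
qed simp

lemma Ck_on_add: "open V \<Longrightarrow> Ck_on k f V \<Longrightarrow> Ck_on k g V \<Longrightarrow> Ck_on k (\<lambda>u. f u + g u) V"
proof (induction k arbitrary: f g)
  case 0
  then show ?case by (simp add: continuous_on_add)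
next
  case (Suc k)
  have d: "f differentiable (at u)" "g differentiable (at u)" if "u \<in> V" for u
    using differentiable_at_Ck that Suc.prems by blast+
  have "Ck_on k (dd X (\<lambda>u. f u + g u)) V" for X
  proof (rule Ck_on_cong[OF \<open>open V\<close>])
    show "Ck_on k (\<lambda>u. dd X f u + dd X g u) V"
      using Suc.IH[OF \<open>open V\<close>, of "dd X f" "dd X g"] Suc.prems Ck_on_Suc[OF \<open>open V\<close>] by blast
  qed (simp add: dd_add d)
  then show ?case using Ck_on_Suc[OF \<open>open V\<close>] differentiable_add[OF d] by blast
qed

lemma Ck_on_bilinear:
  assumes B: "bounded_bilinear B" and V: "open V"
  shows "Ck_on k f V \<Longrightarrow> Ck_on k g V \<Longrightarrow> Ck_on k (\<lambda>u. B (f u) (g u)) V"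
proof (induction k arbitrary: f g)
  case 0
  then show ?case by (simp add: bounded_bilinear.continuous_on[OF B])
next
  case (Suc k)
  have d: "f differentiable (at u)" "g differentiable (at u)" if "u \<in> V" for u
    using differentiable_at_Ck that Suc.prems V by blast+
  have dB: "(\<lambda>v. B (f v) (g v)) differentiable (at u)" if "u \<in> V" for u
    using bounded_bilinear.FDERIV[OF B has_derivative_dd[OF d(1)] has_derivative_dd[OF d(2)]] that
    by (auto simp: differentiable_def)
  have "Ck_on k (dd X (\<lambda>u. B (f u) (g u))) V" for X
  proof (rule Ck_on_cong[OF V])
    show "Ck_on k (\<lambda>u. B (f u) (dd X g u) + B (dd X f u) (g u)) V"
    proof (rule Ck_on_add[OF V])
      have dX: "Ck_on k (dd X f) V" "Ck_on k (dd X g) V" using Suc.prems Ck_on_Suc[OF V] by blast+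
      show "Ck_on k (\<lambda>u. B (f u) (dd X g u)) V"
        by (rule Suc.IH[OF Ck_on_lower[OF V Suc.prems(1)] dX(2)])
      show "Ck_on k (\<lambda>u. B (dd X f u) (g u)) V"
        by (rule Suc.IH[OF dX(1) Ck_on_lower[OF V Suc.prems(2)]])
    qed
  qed (simp add: dd_bilinear[OF B] d)
  then show ?case using Ck_on_Suc[OF V] dB by blast
qed

lemma Ck_on_inverse:
  fixes f :: "real^2 \<Rightarrow> real"
  assumes V: "open V" and nz: "\<And>u. u \<in> V \<Longrightarrow> f u \<noteq> 0"
  shows "Ck_on k f V \<Longrightarrow> Ck_on k (\<lambda>u. inverse (f u)) V"
proof (induction k)
  case 0
  then show ?case using nz by (simp add: continuous_on_inverse)
next
  case (Suc k)
  have d: "((\<lambda>u. inverse (f u)) has_derivative (\<lambda>X. - (inverse (f u) * dd X f u * inverse (f u)))) (at u)"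
    if "u \<in> V" for u
    by (rule Deriv.has_derivative_inverse[OF nz[OF that]
        has_derivative_dd[OF differentiable_at_Ck[OF Suc.prems V that]]])
  have "Ck_on k (dd X (\<lambda>u. inverse (f u))) V" for X
  proof (rule Ck_on_cong[OF V])
    have "Ck_on k (\<lambda>u. inverse (f u)) V" using Suc Ck_on_lower[OF V] by blast
    moreover have "Ck_on k (dd X f) V" using Suc.prems Ck_on_Suc[OF V] by blast
    ultimately show "Ck_on k (\<lambda>u. (-1) * (inverse (f u) * dd X f u * inverse (f u))) V"
      by (intro Ck_on_bilinear[OF bounded_bilinear_mult V] Ck_on_const V)
    show "\<And>u. u \<in> V \<Longrightarrow> - 1 * (inverse (f u) * dd X f u * inverse (f u)) = dd X (\<lambda>u. inverse (f u)) u"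
      using dd_eqI[OF d] by simp
  qed
  then show ?case using d Ck_on_Suc[OF V] unfolding differentiable_def by blast
qed

lemma Ck_on_sqrt:
  fixes f :: "real^2 \<Rightarrow> real"
  assumes V: "open V" and pos: "\<And>u. u \<in> V \<Longrightarrow> f u > 0"
  shows "Ck_on k f V \<Longrightarrow> Ck_on k (\<lambda>u. sqrt (f u)) V"
proof (induction k)
  case 0
  then show ?case by (simp add: continuous_on_real_sqrt)
next
  case (Suc k)
  have d: "((\<lambda>u. sqrt (f u)) has_derivative (\<lambda>X. dd X f u * (inverse (sqrt (f u)) / 2))) (at u)"
    if "u \<in> V" for u
    using has_derivative_real_sqrt[OF pos[OF that] has_derivative_dd[OF differentiable_at_Ck[OF Suc.prems V that]]]
    by (simp add: field_simps)
  have "Ck_on k (dd X (\<lambda>u. sqrt (f u))) V" for X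
  proof (rule Ck_on_cong[OF V])
    have "Ck_on k (\<lambda>u. sqrt (f u)) V" using Suc Ck_on_lower[OF V] by blast
    then have "Ck_on k (\<lambda>u. inverse (sqrt (f u))) V"
      using pos by (intro Ck_on_inverse[OF V]) force+
    moreover have "Ck_on k (dd X f) V" using Suc.prems Ck_on_Suc[OF V] by blast
    ultimately show "Ck_on k (\<lambda>u. (1/2) * (dd X f u * inverse (sqrt (f u)))) V"
      by (intro Ck_on_bilinear[OF bounded_bilinear_mult V] Ck_on_const V)
    show "\<And>u. u \<in> V \<Longrightarrow> (1/2) * (dd X f u * inverse (sqrt (f u))) = dd X (\<lambda>u. sqrt (f u)) u"
      using dd_eqI[OF d] by simp
  qed
  then show ?case using d Ck_on_Suc[OF V] unfolding differentiable_def by blast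
qed

lemma smooth_on_differentiable: "smooth_on f V \<Longrightarrow> open V \<Longrightarrow> u \<in> V \<Longrightarrow> f differentiable (at u)"
  using differentiable_at_Ck[of 0 f V u] by (simp add: smooth_on_def del: Ck_on.simps)

lemma smooth_on_continuous: "smooth_on f V \<Longrightarrow> continuous_on V f"
  using Ck_on.simps(1)[of f V] by (simp add: smooth_on_def del: Ck_on.simps)

lemma smooth_on_dd: "smooth_on f V \<Longrightarrow> open V \<Longrightarrow> smooth_on (dd X f) V"
  using Ck_on_Suc[of V _ f] by (simp add: smooth_on_def del: Ck_on.simps)

lemma smooth_on_cong: "smooth_on f V \<Longrightarrow> open V \<Longrightarrow> (\<And>v. v \<in> V \<Longrightarrow> f v = g v) \<Longrightarrow> smooth_on g V"
  unfolding smooth_on_def using Ck_on_cong[of V f g] by simp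

lemma smooth_on_const: "open V \<Longrightarrow> smooth_on (\<lambda>u. a) V"
  by (simp add: smooth_on_def Ck_on_const del: Ck_on.simps)

lemma smooth_on_add:
  "smooth_on f V \<Longrightarrow> smooth_on g V \<Longrightarrow> open V \<Longrightarrow> smooth_on (\<lambda>u. f u + g u) V"
  by (simp add: smooth_on_def Ck_on_add del: Ck_on.simps)

lemma smooth_on_inner:
  "smooth_on f V \<Longrightarrow> smooth_on g V \<Longrightarrow> open V \<Longrightarrow> smooth_on (\<lambda>u. f u \<bullet> g u) V"
  by (simp add: smooth_on_def Ck_on_bilinear[OF bounded_bilinear_inner] del: Ck_on.simps)

lemma smooth_on_scaleR:
  "smooth_on f V \<Longrightarrow> smooth_on g V \<Longrightarrow> open V \<Longrightarrow> smooth_on (\<lambda>u. f u *\<^sub>R g u) V"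
  by (simp add: smooth_on_def Ck_on_bilinear[OF bounded_bilinear_scaleR] del: Ck_on.simps)

lemma smooth_on_mult:
  fixes f g :: "real^2 \<Rightarrow> real"
  shows "smooth_on f V \<Longrightarrow> smooth_on g V \<Longrightarrow> open V \<Longrightarrow> smooth_on (\<lambda>u. f u * g u) V"
  using smooth_on_scaleR[of f V g] by simp

lemma smooth_on_minus: "smooth_on f V \<Longrightarrow> open V \<Longrightarrow> smooth_on (\<lambda>u. - f u) V"
  using smooth_on_scaleR[of "\<lambda>u. - 1" V f] by (simp add: smooth_on_const)

lemma smooth_on_diff:
  "smooth_on f V \<Longrightarrow> smooth_on g V \<Longrightarrow> open V \<Longrightarrow> smooth_on (\<lambda>u. f u - g u) V"
  using smooth_on_add[of f V "\<lambda>u. - g u"] smooth_on_minus by auto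

lemma smooth_on_inverse:
  fixes f :: "real^2 \<Rightarrow> real"
  shows "smooth_on f V \<Longrightarrow> open V \<Longrightarrow> (\<And>u. u \<in> V \<Longrightarrow> f u \<noteq> 0) \<Longrightarrow> smooth_on (\<lambda>u. inverse (f u)) V"
  by (simp add: smooth_on_def Ck_on_inverse del: Ck_on.simps)

lemma smooth_on_sqrt:
  fixes f :: "real^2 \<Rightarrow> real"
  shows "smooth_on f V \<Longrightarrow> open V \<Longrightarrow> (\<And>u. u \<in> V \<Longrightarrow> f u > 0) \<Longrightarrow> smooth_on (\<lambda>u. sqrt (f u)) V"
  by (simp add: smooth_on_def Ck_on_sqrt del: Ck_on.simps)

lemma Ck_on_subset: "open V' \<Longrightarrow> V' \<subseteq> V \<Longrightarrow> Ck_on k f V \<Longrightarrow> Ck_on k f V'"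
proof (induction k arbitrary: f)
  case 0
  then show ?case using continuous_on_subset[of V f V'] by simp
next
  case (Suc k)
  then show ?case using differentiable_on_subset[of f V V'] by simp
qed

lemma smooth_on_subset: "smooth_on f V \<Longrightarrow> open V' \<Longrightarrow> V' \<subseteq> V \<Longrightarrow> smooth_on f V'"
  unfolding smooth_on_def using Ck_on_subset[of V' V _ f] by blast

section \<open>Iterated directional derivatives\<close>

text \<open>Two applications of the mean value theorem express the second difference of \<open>f\<close> as a value
  of the mixed derivative.\<close>

lemma mixed_difference_mvt:
  fixes f :: "real^2 \<Rightarrow> real"
  assumes V: "open V" and f: "smooth_on f V" and t: "t > 0"
    and box: "\<And>a b. a \<in> {0..t} \<Longrightarrow> b \<in> {0..t} \<Longrightarrow> u + a *\<^sub>R X + b *\<^sub>R Y \<in> V"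
  obtains a b where "a \<in> {0..t}" "b \<in> {0..t}"
    "f (u + t *\<^sub>R X + t *\<^sub>R Y) - f (u + t *\<^sub>R X) - f (u + t *\<^sub>R Y) + f u
       = t * (t * dd Y (dd X f) (u + a *\<^sub>R X + b *\<^sub>R Y))"
proof -
  have der: "((\<lambda>a. F (w + a *\<^sub>R Z)) has_derivative (\<lambda>r. r * dd Z F (w + a *\<^sub>R Z))) (at a)"
    if "smooth_on F V" "w + a *\<^sub>R Z \<in> V" for F :: "real^2 \<Rightarrow> real" and w Z a
  proof -
    have l: "((\<lambda>a. w + a *\<^sub>R Z) has_derivative (\<lambda>r. r *\<^sub>R Z)) (at a)"
      by (auto intro!: derivative_eq_intros)
    have df: "F differentiable (at (w + a *\<^sub>R Z))" using smooth_on_differentiable[OF that(1) V that(2)] .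
    show ?thesis
      using diff_chain_at[OF l has_derivative_dd[OF df]] by (simp add: o_def dd_scale_arg[OF df])
  qed
  define p where "p a = f (u + t *\<^sub>R Y + a *\<^sub>R X) - f (u + a *\<^sub>R X)" for a
  have dp: "(p has_derivative (\<lambda>r. r * dd X f (u + t *\<^sub>R Y + a *\<^sub>R X) - r * dd X f (u + a *\<^sub>R X))) (at a)"
    if "a \<in> {0..t}" for a
    unfolding p_def[abs_def] using that t box[of a t] box[of a 0]
    by (intro has_derivative_diff der f) (auto simp: add_ac)
  have cp: "continuous_on {0..t} p"
    by (rule has_derivative_continuous_on, rule has_derivative_at_withinI, erule dp)
  obtain a where a: "0 < a" "a < t" and
    pa: "p t - p 0 = (\<lambda>r. r * dd X f (u + t *\<^sub>R Y + a *\<^sub>R X) - r * dd X f (u + a *\<^sub>R X)) (t - 0)"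
  proof (rule mvt[OF t cp])
    fix z assume "0 < z" "z < t"
    then show "(p has_derivative
        (\<lambda>z r. r * dd X f (u + t *\<^sub>R Y + z *\<^sub>R X) - r * dd X f (u + z *\<^sub>R X)) z) (at z)"
      using dp[of z] by simp
  qed
  define q where "q b = dd X f (u + a *\<^sub>R X + b *\<^sub>R Y)" for b
  have dq: "(q has_derivative (\<lambda>r. r * dd Y (dd X f) (u + a *\<^sub>R X + b *\<^sub>R Y))) (at b)"
    if "b \<in> {0..t}" for b
    unfolding q_def[abs_def] using that t box[of a b] a
    by (intro der smooth_on_dd f V) auto
  have cq: "continuous_on {0..t} q"
    by (rule has_derivative_continuous_on, rule has_derivative_at_withinI, erule dq)
  obtain b where b: "0 < b" "b < t" and
    qb: "q t - q 0 = (\<lambda>r. r * dd Y (dd X f) (u + a *\<^sub>R X + b *\<^sub>R Y)) (t - 0)"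
  proof (rule mvt[OF t cq])
    fix z assume "0 < z" "z < t"
    then show "(q has_derivative
        (\<lambda>z r. r * dd Y (dd X f) (u + a *\<^sub>R X + z *\<^sub>R Y)) z) (at z)"
      using dq[of z] by simp
  qed
  show ?thesis
  proof (rule that)
    show "a \<in> {0..t}" "b \<in> {0..t}" using a b by auto
    show "f (u + t *\<^sub>R X + t *\<^sub>R Y) - f (u + t *\<^sub>R X) - f (u + t *\<^sub>R Y) + f u
       = t * (t * dd Y (dd X f) (u + a *\<^sub>R X + b *\<^sub>R Y))"
      using pa qb unfolding p_def q_def
      by (simp add: add_ac right_diff_distrib[symmetric])
  qed
qed

text \<open>The second difference is symmetric in \<open>X\<close> and \<open>Y\<close>, and divided by \<open>t\<^sup>2\<close> it is a value of either mixed
  derivative near \<open>u\<close>; both are continuous.\<close>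
lemma dd_commute_real:
  fixes f :: "real^2 \<Rightarrow> real"
  assumes V: "open V" and u: "u \<in> V" and f: "smooth_on f V"
  shows "dd X (dd Y f) u = dd Y (dd X f) u"
proof (rule ccontr)
  assume ne: "\<not> ?thesis"
  define \<epsilon> where "\<epsilon> = \<bar>dd X (dd Y f) u - dd Y (dd X f) u\<bar> / 2"
  have \<epsilon>: "\<epsilon> > 0" using ne by (simp add: \<epsilon>_def)
  have c: "isCont (dd Z (dd Z' f)) u" for Z Z'
    using smooth_on_continuous[OF smooth_on_dd[OF smooth_on_dd[OF f V] V]] V u
    by (simp add: continuous_on_eq_continuous_at)
  obtain d1 where d1: "d1 > 0" "\<And>v. dist v u < d1 \<Longrightarrow> dist (dd X (dd Y f) v) (dd X (dd Y f) u) < \<epsilon>"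
    using c[of X Y] \<epsilon> unfolding continuous_at_eps_delta by blast
  obtain d2 where d2: "d2 > 0" "\<And>v. dist v u < d2 \<Longrightarrow> dist (dd Y (dd X f) v) (dd Y (dd X f) u) < \<epsilon>"
    using c[of Y X] \<epsilon> unfolding continuous_at_eps_delta by blast
  obtain d3 where d3: "d3 > 0" "ball u d3 \<subseteq> V" using V u open_contains_ball by blast
  define d where "d = min d1 (min d2 d3)"
  \<comment> \<open>small enough for the whole parallelogram with sides \<open>t X\<close> and \<open>t Y\<close> to lie in the \<open>d\<close>-ball\<close>
  define t where "t = d / (2 * (norm X + norm Y + 1))"
  have d: "d > 0" using d1 d2 d3 by (simp add: d_def)
  have pos: "norm X + norm Y + 1 > 0" by (simp add: add_nonneg_pos)
  have half: "d / (2 * S) * S = d / 2" if "S > 0" for S :: real using that by simp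
  have t: "t > 0" using d pos by (simp add: t_def)
  have near: "dist (u + a *\<^sub>R X + b *\<^sub>R Y) u < d" if "a \<in> {0..t}" "b \<in> {0..t}" for a b
  proof -
    have "dist (u + a *\<^sub>R X + b *\<^sub>R Y) u = norm (a *\<^sub>R X + b *\<^sub>R Y)" by (simp add: dist_norm)
    also have "\<dots> \<le> \<bar>a\<bar> * norm X + \<bar>b\<bar> * norm Y" by (metis norm_triangle_ineq norm_scaleR)
    also have "\<dots> \<le> t * norm X + t * norm Y" using that by (intro add_mono mult_right_mono) auto
    also have "\<dots> \<le> t * (norm X + norm Y + 1)" using t by (simp add: algebra_simps)
    also have "\<dots> = d / 2" using pos unfolding t_def by (intro half)
    also have "\<dots> < d" using d by simp
    finally show ?thesis .
  qed
  have inV: "u + a *\<^sub>R X + b *\<^sub>R Y \<in> V" if "a \<in> {0..t}" "b \<in> {0..t}" for a b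
    using near[OF that] d3 by (auto simp: d_def dist_commute)
  obtain a b where ab: "a \<in> {0..t}" "b \<in> {0..t}" and
    1: "f (u + t *\<^sub>R X + t *\<^sub>R Y) - f (u + t *\<^sub>R X) - f (u + t *\<^sub>R Y) + f u
       = t * (t * dd Y (dd X f) (u + a *\<^sub>R X + b *\<^sub>R Y))"
    by (rule mixed_difference_mvt[OF V f t inV])
  have inV': "u + a *\<^sub>R Y + b *\<^sub>R X \<in> V" if "a \<in> {0..t}" "b \<in> {0..t}" for a b
    using inV[OF that(2,1)] by (simp add: add_ac)
  obtain a' b' where ab': "a' \<in> {0..t}" "b' \<in> {0..t}" and
    2: "f (u + t *\<^sub>R Y + t *\<^sub>R X) - f (u + t *\<^sub>R Y) - f (u + t *\<^sub>R X) + f u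
       = t * (t * dd X (dd Y f) (u + a' *\<^sub>R Y + b' *\<^sub>R X))"
    by (rule mixed_difference_mvt[OF V f t inV'])
  have c: "u + t *\<^sub>R Y + t *\<^sub>R X = u + t *\<^sub>R X + t *\<^sub>R Y"
    "u + a' *\<^sub>R Y + b' *\<^sub>R X = u + b' *\<^sub>R X + a' *\<^sub>R Y" by simp_all
  have "t * (t * dd Y (dd X f) (u + a *\<^sub>R X + b *\<^sub>R Y)) = t * (t * dd X (dd Y f) (u + b' *\<^sub>R X + a' *\<^sub>R Y))"
    using 1 2 unfolding c by linarith
  then have eq: "dd Y (dd X f) (u + a *\<^sub>R X + b *\<^sub>R Y) = dd X (dd Y f) (u + b' *\<^sub>R X + a' *\<^sub>R Y)"
    using t by simp
  have "dist (dd Y (dd X f) (u + a *\<^sub>R X + b *\<^sub>R Y)) (dd Y (dd X f) u) < \<epsilon>"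
    using near[OF ab] by (intro d2) (simp add: d_def)
  moreover have "dist (dd X (dd Y f) (u + b' *\<^sub>R X + a' *\<^sub>R Y)) (dd X (dd Y f) u) < \<epsilon>"
    using near[OF ab'(2,1)] by (intro d1) (simp add: d_def)
  moreover have False if "\<bar>z - p\<bar> < \<bar>q - p\<bar> / 2" "\<bar>z - q\<bar> < \<bar>q - p\<bar> / 2" for z p q :: real
    using that by (auto simp: abs_if split: if_splits)
  ultimately show False unfolding \<epsilon>_def dist_real_def eq by blast
qed

lemma dd_inner_const:
  "f differentiable (at u) \<Longrightarrow> dd X (\<lambda>v. f v \<bullet> w) u = dd X f u \<bullet> w"
  using dd_inner[of f u "\<lambda>v. w" X] by (simp add: dd_const)

text \<open>Tested against constant vectors, the vector-valued case reduces to the real one.\<close>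
lemma dd_commute:
  fixes f :: "real^2 \<Rightarrow> 'a::euclidean_space"
  assumes V: "open V" and u: "u \<in> V" and f: "smooth_on f V"
  shows "dd X (dd Y f) u = dd Y (dd X f) u"
proof -
  have *: "dd X (dd Y f) u \<bullet> w = dd X (dd Y (\<lambda>v. f v \<bullet> w)) u" for w X Y
  proof -
    have "dd X (dd Y f) u \<bullet> w = dd X (\<lambda>v. dd Y f v \<bullet> w) u"
      by (rule dd_inner_const[symmetric, OF smooth_on_differentiable[OF smooth_on_dd[OF f V] V u]])
    also have "\<dots> = dd X (dd Y (\<lambda>v. f v \<bullet> w)) u"
    proof (rule dd_cong[OF V u])
      fix v assume "v \<in> V"
      then show "dd Y f v \<bullet> w = dd Y (\<lambda>v. f v \<bullet> w) v"
        by (rule dd_inner_const[symmetric, OF smooth_on_differentiable[OF f V]])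
    qed
    finally show ?thesis .
  qed
  have "smooth_on (\<lambda>v. f v \<bullet> w) V" for w using f V by (intro smooth_on_inner smooth_on_const)
  then have "dd X (dd Y f) u \<bullet> w = dd Y (dd X f) u \<bullet> w" for w
    unfolding * by (rule dd_commute_real[OF V u])
  then show ?thesis using vector_eq_rdot[of "dd X (dd Y f) u" "dd Y (dd X f) u"] by blast
qed

text \<open>The head of the list is the direction of the last differentiation, as in \<open>iter_ff\<close>.\<close>
primrec dl :: "(real^2) list \<Rightarrow> (real^2 \<Rightarrow> 'b::real_normed_vector) \<Rightarrow> real^2 \<Rightarrow> 'b" where
  "dl [] f = f"
| "dl (X # Xs) f = dd X (dl Xs f)"

lemma smooth_on_dl: "smooth_on f V \<Longrightarrow> open V \<Longrightarrow> smooth_on (dl Xs f) V"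
  by (induction Xs) (auto intro: smooth_on_dd)

lemma dl_move_to_front:
  fixes f :: "real^2 \<Rightarrow> 'a::euclidean_space"
  assumes V: "open V" and f: "smooth_on f V"
  shows "u \<in> V \<Longrightarrow> dl (Xs @ X # Ys) f u = dl (X # Xs @ Ys) f u"
proof (induction Xs arbitrary: u)
  case (Cons Z Xs)
  have "dl ((Z # Xs) @ X # Ys) f u = dd Z (dd X (dl (Xs @ Ys) f)) u"
    using dd_cong[OF V Cons.prems Cons.IH] by simp
  also have "\<dots> = dd X (dd Z (dl (Xs @ Ys) f)) u"
    by (rule dd_commute[OF V Cons.prems smooth_on_dl[OF f V]])
  finally show ?case by simp
qed simp

lemma dl_mset:
  fixes f :: "real^2 \<Rightarrow> 'a::euclidean_space"
  assumes V: "open V" and f: "smooth_on f V"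
  shows "mset Xs = mset Ys \<Longrightarrow> u \<in> V \<Longrightarrow> dl Xs f u = dl Ys f u"
proof (induction Xs arbitrary: Ys u)
  case (Cons X Xs)
  then have "X \<in> set Ys" by (metis list.set_intros(1) mset_eq_setD)
  then obtain A B where Ys: "Ys = A @ X # B" by (meson split_list)
  then have "mset Xs = mset (A @ B)" using Cons.prems by simp
  then have "dl (X # Xs) f u = dl (X # A @ B) f u"
    using dd_cong[OF V Cons.prems(2) Cons.IH] by simp
  then show ?case using dl_move_to_front[OF V f Cons.prems(2)] Ys by metis
qed simp

section \<open>Gram--Schmidt for pairs of vectors\<close>

definition indep2 :: "'a::real_vector \<Rightarrow> 'a \<Rightarrow> bool" where
  "indep2 a b \<longleftrightarrow> (\<forall>x y. x *\<^sub>R a + y *\<^sub>R b = 0 \<longrightarrow> x = 0 \<and> y = 0)"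

text \<open>The coefficients depend on the Gram matrix only, so that isometric immersions have
  corresponding orthonormal frames.\<close>
definition gs1 :: "'a::real_inner \<Rightarrow> 'a \<Rightarrow> 'a" where
  "gs1 a b = inverse (sqrt (a \<bullet> a)) *\<^sub>R a"

definition gs_norm :: "real \<Rightarrow> real \<Rightarrow> real \<Rightarrow> real" where
  "gs_norm A B C = inverse (sqrt (C - B * B * inverse A))"

definition gs2 :: "'a::real_inner \<Rightarrow> 'a \<Rightarrow> 'a" where
  "gs2 a b = gs_norm (a \<bullet> a) (a \<bullet> b) (b \<bullet> b) *\<^sub>R (b - ((a \<bullet> b) * inverse (a \<bullet> a)) *\<^sub>R a)"

lemma indep2_gram:
  fixes a b :: "'a::real_inner"
  assumes "indep2 a b"
  shows "0 < a \<bullet> a" "0 < b \<bullet> b - (a \<bullet> b) * (a \<bullet> b) * inverse (a \<bullet> a)"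
proof -
  have "a \<noteq> 0" using assms[unfolded indep2_def, rule_format, of 1 0] by auto
  then show A: "0 < a \<bullet> a" by simp
  define w where "w = b - ((a \<bullet> b) * inverse (a \<bullet> a)) *\<^sub>R a"
  have "w \<noteq> 0"
    using assms[unfolded indep2_def, rule_format, of "- ((a \<bullet> b) * inverse (a \<bullet> a))" 1]
    by (auto simp: w_def)
  then have "0 < w \<bullet> w" by simp
  also have "w \<bullet> w = b \<bullet> b - (a \<bullet> b) * (a \<bullet> b) * inverse (a \<bullet> a)"
    using A unfolding w_def
    by (simp add: inner_diff_left inner_diff_right inner_commute[of b a] field_simps)
  finally show "0 < b \<bullet> b - (a \<bullet> b) * (a \<bullet> b) * inverse (a \<bullet> a)" .
qed

lemma gs_orthonormal:
  fixes a b :: "'a::real_inner"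
  assumes "indep2 a b"
  shows "gs1 a b \<bullet> gs1 a b = 1" "gs2 a b \<bullet> gs2 a b = 1" "gs1 a b \<bullet> gs2 a b = 0"
    "gs2 a b \<bullet> gs1 a b = 0"
proof -
  note A = indep2_gram(1)[OF assms] and C = indep2_gram(2)[OF assms]
  have r: "inverse (sqrt r) * (inverse (sqrt r) * r) = 1" if "r > 0" for r
    using that by (simp add: field_simps)
  show "gs1 a b \<bullet> gs1 a b = 1" unfolding gs1_def using r[OF A] by simp
  define w where "w = b - ((a \<bullet> b) * inverse (a \<bullet> a)) *\<^sub>R a"
  have ww: "w \<bullet> w = b \<bullet> b - (a \<bullet> b) * (a \<bullet> b) * inverse (a \<bullet> a)"
    using A unfolding w_def
    by (simp add: inner_diff_left inner_diff_right inner_commute[of b a] field_simps)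
  show "gs2 a b \<bullet> gs2 a b = 1"
    unfolding gs2_def gs_norm_def w_def[symmetric] ww[symmetric]
    using r[of "w \<bullet> w"] C[folded ww] by simp
  have "a \<bullet> w = 0" using A unfolding w_def by (simp add: inner_diff_right)
  then show "gs1 a b \<bullet> gs2 a b = 0"
    unfolding gs1_def gs2_def w_def[symmetric] by simp
  then show "gs2 a b \<bullet> gs1 a b = 0" by (simp add: inner_commute)
qed

lemma gs_recover:
  fixes a b :: "'a::real_inner"
  assumes "indep2 a b"
  shows "a = sqrt (a \<bullet> a) *\<^sub>R gs1 a b"
    "b = (a \<bullet> b * inverse (sqrt (a \<bullet> a))) *\<^sub>R gs1 a b
        + inverse (gs_norm (a \<bullet> a) (a \<bullet> b) (b \<bullet> b)) *\<^sub>R gs2 a b"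
    "gs_norm (a \<bullet> a) (a \<bullet> b) (b \<bullet> b) > 0"
proof -
  note A = indep2_gram(1)[OF assms] and C = indep2_gram(2)[OF assms]
  show a: "a = sqrt (a \<bullet> a) *\<^sub>R gs1 a b" using A by (simp add: gs1_def)
  show n: "gs_norm (a \<bullet> a) (a \<bullet> b) (b \<bullet> b) > 0" using C by (simp add: gs_norm_def)
  have "inverse (gs_norm (a \<bullet> a) (a \<bullet> b) (b \<bullet> b)) *\<^sub>R gs2 a b = b - ((a \<bullet> b) * inverse (a \<bullet> a)) *\<^sub>R a"
    using n unfolding gs2_def by simp
  moreover have "(a \<bullet> b * inverse (sqrt (a \<bullet> a))) *\<^sub>R gs1 a b = ((a \<bullet> b) * inverse (a \<bullet> a)) *\<^sub>R a"
  proof -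
    have "inverse (sqrt (a \<bullet> a)) * inverse (sqrt (a \<bullet> a)) = inverse (a \<bullet> a)"
      using A by (metis inverse_mult_distrib less_imp_le real_sqrt_mult_self abs_of_nonneg)
    then show ?thesis unfolding gs1_def by (simp add: mult.assoc)
  qed
  ultimately show "b = (a \<bullet> b * inverse (sqrt (a \<bullet> a))) *\<^sub>R gs1 a b
        + inverse (gs_norm (a \<bullet> a) (a \<bullet> b) (b \<bullet> b)) *\<^sub>R gs2 a b"
    by simp
qed

lemma gs_span:
  fixes a b :: "'a::real_inner"
  assumes "indep2 a b"
  shows "span {gs1 a b, gs2 a b} = span {a, b}"
proof
  have "gs1 a b \<in> span {a, b}" unfolding gs1_def by (intro span_scale span_base) simp
  moreover have "gs2 a b \<in> span {a, b}"
    unfolding gs2_def by (intro span_scale span_diff span_base) auto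
  ultimately show "span {gs1 a b, gs2 a b} \<subseteq> span {a, b}"
    by (intro span_minimal) auto
  have "a \<in> span {gs1 a b, gs2 a b}"
    by (subst gs_recover(1)[OF assms]) (intro span_scale span_base, simp)
  moreover have "b \<in> span {gs1 a b, gs2 a b}"
    by (subst gs_recover(2)[OF assms]) (intro span_add span_scale span_base; simp)
  ultimately show "span {a, b} \<subseteq> span {gs1 a b, gs2 a b}"
    by (intro span_minimal) auto
qed

text \<open>The change of basis is triangular with positive diagonal, so its determinant is positive. This is
  why orthonormalization keeps the orientation.\<close>
lemma gs_area:
  fixes a b v w :: "'a::real_inner"
  assumes "indep2 a b"
  shows "0 < (v \<bullet> a) * (w \<bullet> b) - (v \<bullet> b) * (w \<bullet> a) \<longleftrightarrow>
    0 < (v \<bullet> gs1 a b) * (w \<bullet> gs2 a b) - (v \<bullet> gs2 a b) * (w \<bullet> gs1 a b)"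
proof -
  note R = gs_recover[OF assms] and A = indep2_gram(1)[OF assms]
  define \<alpha> where "\<alpha> = sqrt (a \<bullet> a)"
  define \<beta> where "\<beta> = a \<bullet> b * inverse (sqrt (a \<bullet> a))"
  define \<gamma> where "\<gamma> = inverse (gs_norm (a \<bullet> a) (a \<bullet> b) (b \<bullet> b))"
  have p: "\<alpha> * \<gamma> > 0" using R(3) A by (simp add: \<alpha>_def \<gamma>_def)
  have a: "x \<bullet> a = \<alpha> * (x \<bullet> gs1 a b)" for x
    unfolding \<alpha>_def by (subst R(1)) simp
  have b: "x \<bullet> b = \<beta> * (x \<bullet> gs1 a b) + \<gamma> * (x \<bullet> gs2 a b)" for x
    unfolding \<beta>_def \<gamma>_def by (subst R(2)) (simp add: inner_add_right)
  have "(v \<bullet> a) * (w \<bullet> b) - (v \<bullet> b) * (w \<bullet> a) =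
    (\<alpha> * \<gamma>) * ((v \<bullet> gs1 a b) * (w \<bullet> gs2 a b) - (v \<bullet> gs2 a b) * (w \<bullet> gs1 a b))"
    unfolding a b by (simp add: algebra_simps)
  then show ?thesis using p zero_less_mult_pos[of "\<alpha> * \<gamma>"] mult_pos_pos[of "\<alpha> * \<gamma>"] by metis
qed

lemma smooth_on_gs:
  assumes "open V" "smooth_on a V" "smooth_on b V" "\<And>u. u \<in> V \<Longrightarrow> indep2 (a u) (b u)"
  shows "smooth_on (\<lambda>u. inverse (sqrt (a u \<bullet> a u))) V"
    "smooth_on (\<lambda>u. gs_norm (a u \<bullet> a u) (a u \<bullet> b u) (b u \<bullet> b u)) V"
    "smooth_on (\<lambda>u. a u \<bullet> b u * inverse (a u \<bullet> a u)) V"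
    "smooth_on (\<lambda>u. gs1 (a u) (b u)) V" "smooth_on (\<lambda>u. gs2 (a u) (b u)) V"
proof -
  note A = indep2_gram(1)[OF assms(4)] and C = indep2_gram(2)[OF assms(4)]
  have aa: "smooth_on (\<lambda>u. a u \<bullet> a u) V" and ab: "smooth_on (\<lambda>u. a u \<bullet> b u) V"
    and bb: "smooth_on (\<lambda>u. b u \<bullet> b u) V"
    by (intro smooth_on_inner assms)+
  have iaa: "smooth_on (\<lambda>u. inverse (a u \<bullet> a u)) V"
    using A by (intro smooth_on_inverse[OF aa assms(1)]) force
  have "smooth_on (\<lambda>u. sqrt (a u \<bullet> a u)) V" by (intro smooth_on_sqrt[OF aa assms(1)] A)
  then show 1: "smooth_on (\<lambda>u. inverse (sqrt (a u \<bullet> a u))) V"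
    using A by (intro smooth_on_inverse[OF _ assms(1)]) force+
  have "smooth_on (\<lambda>u. b u \<bullet> b u - (a u \<bullet> b u) * (a u \<bullet> b u) * inverse (a u \<bullet> a u)) V"
    by (intro smooth_on_diff smooth_on_mult bb ab iaa assms(1))
  then have "smooth_on (\<lambda>u. sqrt (b u \<bullet> b u - (a u \<bullet> b u) * (a u \<bullet> b u) * inverse (a u \<bullet> a u))) V"
    by (intro smooth_on_sqrt[OF _ assms(1)] C)
  then show 2: "smooth_on (\<lambda>u. gs_norm (a u \<bullet> a u) (a u \<bullet> b u) (b u \<bullet> b u)) V"
    unfolding gs_norm_def using C by (intro smooth_on_inverse[OF _ assms(1)]) force+
  show 3: "smooth_on (\<lambda>u. a u \<bullet> b u * inverse (a u \<bullet> a u)) V"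
    by (intro smooth_on_mult ab iaa assms(1))
  show "smooth_on (\<lambda>u. gs1 (a u) (b u)) V"
    unfolding gs1_def by (rule smooth_on_scaleR[OF 1 assms(2,1)])
  show "smooth_on (\<lambda>u. gs2 (a u) (b u)) V"
    unfolding gs2_def
    by (rule smooth_on_scaleR[OF 2 smooth_on_diff[OF assms(3) smooth_on_scaleR[OF 3 assms(2,1)] assms(1)] assms(1)])
qed


section \<open>Combinations of partial derivatives of bounded order\<close>

text \<open>The sections of the \<open>k\<close>-th osculating bundle of \<open>G\<close> that are visible as smooth combinations
  of partial derivatives. Carrying the coefficients along, instead of working with the pointwise
  spans, keeps all arguments valid where the rank of the spans drops.\<close>
inductive osc :: "(real^2) set \<Rightarrow> (real^2 \<Rightarrow> 'a::euclidean_space) \<Rightarrow> nat \<Rightarrow> (real^2 \<Rightarrow> 'a) \<Rightarrow> bool"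
  for V G k where
  osc_zero: "(\<And>u. u \<in> V \<Longrightarrow> F u = 0) \<Longrightarrow> osc V G k F"
| osc_step: "osc V G k F' \<Longrightarrow> length Xs \<le> k \<Longrightarrow> smooth_on a V \<Longrightarrow>
    (\<And>u. u \<in> V \<Longrightarrow> F u = F' u + a u *\<^sub>R dl Xs G u) \<Longrightarrow> osc V G k F"

lemma osc_cong: "osc V G k F \<Longrightarrow> (\<And>u. u \<in> V \<Longrightarrow> F u = F' u) \<Longrightarrow> osc V G k F'"
proof (induction rule: osc.induct)
  case (osc_zero F)
  then show ?case by (intro osc.osc_zero) simp
next
  case (osc_step F0 Xs a F)
  show ?case
    by (rule osc.osc_step[OF osc_step(1-3)]) (use osc_step in simp)
qed

lemma osc_mono: "osc V G k F \<Longrightarrow> k \<le> l \<Longrightarrow> osc V G l F"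
proof (induction rule: osc.induct)
  case (osc_zero F)
  then show ?case by (intro osc.osc_zero) simp
next
  case (osc_step F0 Xs a F)
  show ?case
    by (rule osc.osc_step[of V G l F0 Xs a]) (use osc_step in simp_all)
qed

lemma osc_add: "osc V G k F \<Longrightarrow> osc V G k F' \<Longrightarrow> osc V G k (\<lambda>u. F u + F' u)"
proof (induction rule: osc.induct)
  case (osc_zero F)
  then show ?case by (elim osc_cong) simp
next
  case (osc_step F0 Xs a F)
  show ?case
    by (rule osc.osc_step[of V G k "\<lambda>u. F0 u + F' u" Xs a]) (use osc_step in simp_all)
qed

lemma osc_scale:
  assumes "open V" "smooth_on b V"
  shows "osc V G k F \<Longrightarrow> osc V G k (\<lambda>u. b u *\<^sub>R F u)"
proof (induction rule: osc.induct)
  case (osc_zero F)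
  then show ?case by (intro osc.osc_zero) simp
next
  case (osc_step F0 Xs a F)
  show ?case
    by (rule osc.osc_step[of V G k "\<lambda>u. b u *\<^sub>R F0 u" Xs "\<lambda>u. b u * a u"])
       (use osc_step assms in \<open>simp_all add: smooth_on_mult scaleR_add_right\<close>)
qed

lemma osc_dl:
  assumes "open V" "length Xs \<le> k"
  shows "osc V G k (dl Xs G)"
  by (rule osc_step[OF osc_zero[of V "\<lambda>u. 0"] assms(2) smooth_on_const[OF assms(1), of 1]]) simp_all

lemma osc_minus: "open V \<Longrightarrow> osc V G k F \<Longrightarrow> osc V G k (\<lambda>u. - F u)"
  using osc_scale[of V "\<lambda>u. - 1"] smooth_on_const[of V "- 1 :: real"] by simp

lemma osc_diff:
  "open V \<Longrightarrow> osc V G k F \<Longrightarrow> osc V G k F' \<Longrightarrow> osc V G k (\<lambda>u. F u - F' u)"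
  using osc_add[of V G k F "\<lambda>u. - F' u"] osc_minus[of V G k F'] by simp

lemma osc_smooth:
  assumes "open V" "smooth_on G V"
  shows "osc V G k F \<Longrightarrow> smooth_on F V"
proof (induction rule: osc.induct)
  case (osc_zero F)
  then show ?case by (intro smooth_on_cong[OF smooth_on_const[of V 0]] assms) simp_all
next
  case (osc_step F0 Xs a F)
  have "smooth_on (\<lambda>u. F0 u + a u *\<^sub>R dl Xs G u) V"
    using osc_step assms by (intro smooth_on_add smooth_on_scaleR smooth_on_dl)
  then show ?case by (rule smooth_on_cong[OF _ assms(1)]) (simp add: osc_step)
qed

lemma osc_dd:
  assumes V: "open V" and G: "smooth_on G V"
  shows "osc V G k F \<Longrightarrow> osc V G (Suc k) (dd X F)"
proof (induction rule: osc.induct)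
  case (osc_zero F)
  have "dd X F u = 0" if "u \<in> V" for u
    using dd_cong[OF V that, of F "\<lambda>u. 0" X] osc_zero by (simp add: dd_const)
  then show ?case by (rule osc.osc_zero)
next
  case (osc_step F0 Xs a F)
  have s: "smooth_on F0 V" "smooth_on a V" "smooth_on (dl Xs G) V"
    using osc_smooth[OF V G osc_step(1)] osc_step(3) smooth_on_dl[OF G V] by auto
  have eq: "dd X F u = (dd X F0 u + dd X a u *\<^sub>R dl Xs G u) + a u *\<^sub>R dl (X # Xs) G u"
    if u: "u \<in> V" for u
  proof -
    note d = smooth_on_differentiable[OF _ V u]
    have "dd X F u = dd X (\<lambda>u. F0 u + a u *\<^sub>R dl Xs G u) u"
      by (rule dd_cong[OF V u]) (simp add: osc_step)
    also have "\<dots> = dd X F0 u + dd X (\<lambda>u. a u *\<^sub>R dl Xs G u) u"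
      by (rule dd_add[OF d[OF s(1)] d[OF smooth_on_scaleR[OF s(2,3) V]]])
    also have "dd X (\<lambda>u. a u *\<^sub>R dl Xs G u) u = a u *\<^sub>R dd X (dl Xs G) u + dd X a u *\<^sub>R dl Xs G u"
      by (rule dd_scaleR[OF d[OF s(2)] d[OF s(3)]])
    finally show ?thesis by simp
  qed
  have "osc V G (Suc k) (\<lambda>u. dd X F0 u + dd X a u *\<^sub>R dl Xs G u)"
    using osc_step smooth_on_dd[OF s(2) V]
    by (intro osc_add osc_scale osc_dl V) simp_all
  then show ?case
    by (rule osc.osc_step[OF _ _ s(2), where Xs = "X # Xs"]) (use osc_step eq in simp_all)
qed

lemma osc_dl_osc:
  assumes "open V" "smooth_on G V" "osc V G k F"
  shows "osc V G (k + length Xs) (dl Xs F)"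
  by (induction Xs) (use assms osc_dd in auto)

lemma osc_span:
  "osc V G k F \<Longrightarrow> u \<in> V \<Longrightarrow> F u \<in> span {dl Xs G u |Xs. length Xs \<le> k}"
proof (induction rule: osc.induct)
  case (osc_zero F)
  then show ?case by (simp add: span_zero)
next
  case (osc_step F0 Xs a F)
  have "dl Xs G u \<in> span {dl Xs G u |Xs. length Xs \<le> k}"
    using osc_step(2) by (intro span_base) blast
  then show ?case using osc_step by (simp add: span_add span_scale)
qed

lemma dl_add:
  assumes V: "open V" and f: "smooth_on f V" and g: "smooth_on g V"
  shows "u \<in> V \<Longrightarrow> dl Xs (\<lambda>v. f v + g v) u = dl Xs f u + dl Xs g u"
proof (induction Xs arbitrary: u)
  case (Cons X Xs)
  have "dd X (dl Xs (\<lambda>v. f v + g v)) u = dd X (\<lambda>v. dl Xs f v + dl Xs g v) u"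
    by (rule dd_cong[OF V Cons.prems Cons.IH])
  also have "\<dots> = dd X (dl Xs f) u + dd X (dl Xs g) u"
    by (rule dd_add[OF smooth_on_differentiable[OF smooth_on_dl[OF f V] V Cons.prems]
        smooth_on_differentiable[OF smooth_on_dl[OF g V] V Cons.prems]])
  finally show ?case by simp
qed simp

text \<open>Differentiating a smooth multiple of a derivative of order \<open>r\<close> only hits the coefficient up
  to derivatives of lower order.\<close>
lemma osc_dl_scaleR:
  assumes V: "open V" and G: "smooth_on G V" and a: "smooth_on a V"
  shows "osc V G (length Xs + length Ys - 1)
    (\<lambda>u. dl Xs (\<lambda>v. a v *\<^sub>R dl Ys G v) u - a u *\<^sub>R dl (Xs @ Ys) G u)"
proof (induction Xs)
  case Nil
  then show ?case by (intro osc_zero) simp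
next
  case (Cons X Xs)
  define D where "D u = dl Xs (\<lambda>v. a v *\<^sub>R dl Ys G v) u - a u *\<^sub>R dl (Xs @ Ys) G u" for u
  have D: "osc V G (length Xs + length Ys - 1) D" using Cons D_def[abs_def] by simp
  have s: "smooth_on D V" "smooth_on (dl (Xs @ Ys) G) V"
    using osc_smooth[OF V G D] smooth_on_dl[OF G V] by auto
  have eq: "dd X D u + dd X a u *\<^sub>R dl (Xs @ Ys) G u =
      dl (X # Xs) (\<lambda>v. a v *\<^sub>R dl Ys G v) u - a u *\<^sub>R dl ((X # Xs) @ Ys) G u" if u: "u \<in> V" for u
  proof -
    note d = smooth_on_differentiable[OF _ V u]
    have "dl (X # Xs) (\<lambda>v. a v *\<^sub>R dl Ys G v) u = dd X (\<lambda>v. D v + a v *\<^sub>R dl (Xs @ Ys) G v) u"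
      by (simp add: D_def)
    also have "\<dots> = dd X D u + dd X (\<lambda>v. a v *\<^sub>R dl (Xs @ Ys) G v) u"
      by (rule dd_add[OF d[OF s(1)] d[OF smooth_on_scaleR[OF a s(2) V]]])
    also have "dd X (\<lambda>v. a v *\<^sub>R dl (Xs @ Ys) G v) u =
        a u *\<^sub>R dd X (dl (Xs @ Ys) G) u + dd X a u *\<^sub>R dl (Xs @ Ys) G u"
      by (rule dd_scaleR[OF d[OF a] d[OF s(2)]])
    finally show ?thesis by simp
  qed
  have "osc V G (length (X # Xs) + length Ys - 1) (\<lambda>u. dd X D u + dd X a u *\<^sub>R dl (Xs @ Ys) G u)"
  proof (intro osc_add osc_scale V smooth_on_dd a)
    show "osc V G (length (X # Xs) + length Ys - 1) (dl (Xs @ Ys) G)"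
      by (rule osc_dl[OF V]) simp
    show "osc V G (length (X # Xs) + length Ys - 1) (dd X D)"
    proof (cases "Xs @ Ys")
      case Nil
      then have "D v = 0" for v by (simp add: D_def)
      then have "D = (\<lambda>v. 0)" by (simp add: fun_eq_iff)
      then show ?thesis by (intro osc_zero) (simp add: dd_const)
    next
      case (Cons Z Zs)
      then have "length (Xs @ Ys) > 0" by simp
      then have "Suc (length Xs + length Ys - 1) = length (X # Xs) + length Ys - 1" by simp
      then show ?thesis using osc_dd[OF V G D, of X] by simp
    qed
  qed
  then show ?case by (rule osc_cong) (rule eq)
qed

section \<open>Immersed patches in the unit sphere\<close>

abbreviation ax1 :: "real^2" where "ax1 \<equiv> axis 1 1"
abbreviation ax2 :: "real^2" where "ax2 \<equiv> axis 2 1"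

lemma plane_decomp: "(X::real^2) = (X $ 1) *\<^sub>R ax1 + (X $ 2) *\<^sub>R ax2"
  by (simp add: vec_eq_iff forall_2 axis_def)

locale sphere_patch =
  fixes V :: "(real^2) set" and G :: "real^2 \<Rightarrow> 'a::euclidean_space"
  assumes V: "open V" and G: "smooth_on G V"
    and unit: "\<And>u. u \<in> V \<Longrightarrow> G u \<bullet> G u = 1"
    and imm: "\<And>u X. u \<in> V \<Longrightarrow> dd X G u = 0 \<Longrightarrow> X = 0"
begin

definition t1 where "t1 u = gs1 (dd ax1 G u) (dd ax2 G u)"
definition t2 where "t2 u = gs2 (dd ax1 G u) (dd ax2 G u)"

definition normal where
  "normal u = {v. v \<bullet> G u = 0 \<and> (\<forall>X. v \<bullet> dd X G u = 0)}"

definition nproj where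
  "nproj u v = v - (v \<bullet> G u) *\<^sub>R G u - (v \<bullet> t1 u) *\<^sub>R t1 u - (v \<bullet> t2 u) *\<^sub>R t2 u"

lemma diffG: "u \<in> V \<Longrightarrow> G differentiable (at u)"
  by (rule smooth_on_differentiable[OF G V])

lemma dd_coords:
  "u \<in> V \<Longrightarrow> dd X G u = (X $ 1) *\<^sub>R dd ax1 G u + (X $ 2) *\<^sub>R dd ax2 G u"
  by (subst plane_decomp[of X]) (simp add: dd_add_arg dd_scale_arg diffG)

lemma indep: 
  assumes u: "u \<in> V"
  shows "indep2 (dd ax1 G u) (dd ax2 G u)"
  unfolding indep2_def
proof (intro allI impI)
  fix x y :: real assume "x *\<^sub>R dd ax1 G u + y *\<^sub>R dd ax2 G u = 0"
  then have "dd (x *\<^sub>R ax1 + y *\<^sub>R ax2) G u = 0"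
    by (simp add: dd_add_arg dd_scale_arg diffG[OF u])
  then have 0: "x *\<^sub>R ax1 + y *\<^sub>R ax2 = 0" using imm[OF u] by blast
  have "(x *\<^sub>R ax1 + y *\<^sub>R ax2) $ 1 = x" "(x *\<^sub>R ax1 + y *\<^sub>R ax2) $ 2 = y"
    by (simp_all add: axis_def)
  then show "x = 0 \<and> y = 0" using 0 by simp
qed

lemma radial_orth: 
  assumes u: "u \<in> V"
  shows "G u \<bullet> dd X G u = 0"
proof -
  have "dd X (\<lambda>v. G v \<bullet> G v) u = dd X (\<lambda>v. 1) u"
    by (rule dd_cong[OF V u]) (simp add: unit)
  then show ?thesis
    using dd_inner[OF diffG[OF u] diffG[OF u], of X] by (simp add: dd_const inner_commute)
qed

lemma frame_orthonormal:
  assumes u: "u \<in> V"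
  shows "t1 u \<bullet> t1 u = 1" "t2 u \<bullet> t2 u = 1" "t1 u \<bullet> t2 u = 0" "t2 u \<bullet> t1 u = 0"
    "G u \<bullet> t1 u = 0" "G u \<bullet> t2 u = 0" "t1 u \<bullet> G u = 0" "t2 u \<bullet> G u = 0"
proof -
  show "t1 u \<bullet> t1 u = 1" "t2 u \<bullet> t2 u = 1" "t1 u \<bullet> t2 u = 0" "t2 u \<bullet> t1 u = 0"
    unfolding t1_def t2_def by (rule gs_orthonormal[OF indep[OF u]])+
  show 1: "G u \<bullet> t1 u = 0" "G u \<bullet> t2 u = 0"
    unfolding t1_def t2_def gs1_def gs2_def by (simp_all add: inner_diff_right radial_orth[OF u])
  show "t1 u \<bullet> G u = 0" "t2 u \<bullet> G u = 0" using 1 by (simp_all add: inner_commute)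
qed

lemma t_in_range:
  assumes u: "u \<in> V"
  shows "\<exists>X. t1 u = dd X G u" "\<exists>X. t2 u = dd X G u"
proof -
  note D = dd_add_arg[OF diffG[OF u]] dd_scale_arg[OF diffG[OF u]]
  have "t1 u = dd (inverse (sqrt (dd ax1 G u \<bullet> dd ax1 G u)) *\<^sub>R ax1) G u"
    by (simp add: t1_def gs1_def D)
  then show "\<exists>X. t1 u = dd X G u" by blast
  have "t2 u = dd (gs_norm (dd ax1 G u \<bullet> dd ax1 G u) (dd ax1 G u \<bullet> dd ax2 G u) (dd ax2 G u \<bullet> dd ax2 G u)
    *\<^sub>R (ax2 + (- (dd ax1 G u \<bullet> dd ax2 G u * inverse (dd ax1 G u \<bullet> dd ax1 G u))) *\<^sub>R ax1)) G u"
    unfolding t2_def gs2_def D by simp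
  then show "\<exists>X. t2 u = dd X G u" by blast
qed

lemma dd_in_span_t:
  assumes u: "u \<in> V"
  shows "dd X G u \<in> span {t1 u, t2 u}"
  unfolding t1_def t2_def gs_span[OF indep[OF u]]
  by (subst dd_coords[OF u]) (intro span_add span_scale span_base; simp)

lemma normal_iff:
  assumes u: "u \<in> V"
  shows "v \<in> normal u \<longleftrightarrow> v \<bullet> G u = 0 \<and> v \<bullet> t1 u = 0 \<and> v \<bullet> t2 u = 0"
proof
  assume "v \<in> normal u"
  then show "v \<bullet> G u = 0 \<and> v \<bullet> t1 u = 0 \<and> v \<bullet> t2 u = 0"
    using t_in_range[OF u] unfolding normal_def by auto
next
  assume *: "v \<bullet> G u = 0 \<and> v \<bullet> t1 u = 0 \<and> v \<bullet> t2 u = 0"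
  have "dd X G u \<bullet> v = 0" for X
    by (rule inner_span_zero[OF dd_in_span_t[OF u]]) (use * in \<open>auto simp: inner_commute\<close>)
  then show "v \<in> normal u" using * unfolding normal_def by (simp add: inner_commute)
qed

lemma subspace_normal: "subspace (normal u)"
  unfolding normal_def subspace_def by (simp add: inner_add_left)

lemma nproj_normal: "u \<in> V \<Longrightarrow> nproj u v \<in> normal u"
  by (simp add: normal_iff nproj_def inner_diff_left frame_orthonormal unit)

lemma nproj_inner: "u \<in> V \<Longrightarrow> w \<in> normal u \<Longrightarrow> nproj u v \<bullet> w = v \<bullet> w"
  using normal_iff[of u w]
  by (simp add: nproj_def inner_diff_left inner_commute[of "G u" w] inner_commute[of "t1 u" w]
      inner_commute[of "t2 u" w])

lemma oproj_normal: "u \<in> V \<Longrightarrow> oproj (normal u) v = nproj u v"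
  by (rule oproj_unique[OF subspace_normal nproj_normal]) (simp_all add: inner_diff_left nproj_inner)

lemma smooth_dl: "smooth_on (dl Xs G) V"
  by (rule smooth_on_dl[OF G V])

lemma smooth_frame: "smooth_on t1 V" "smooth_on t2 V"
  using smooth_on_gs(4,5)[OF V smooth_on_dd[OF G V] smooth_on_dd[OF G V] indep]
  unfolding t1_def[abs_def] t2_def[abs_def] by simp_all

lemma osc_frame: "osc V G 1 G" "osc V G 1 t1" "osc V G 1 t2"
proof -
  note S = smooth_on_gs[OF V smooth_on_dd[OF G V] smooth_on_dd[OF G V] indep]
  show "osc V G 1 G" using osc_dl[OF V, of "[]" 1 G] by simp
  have 1: "osc V G 1 (dd ax1 G)" "osc V G 1 (dd ax2 G)"
    using osc_dl[OF V, of "[ax1]" 1 G] osc_dl[OF V, of "[ax2]" 1 G] by simp_all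
  show "osc V G 1 t1"
    unfolding t1_def[abs_def] gs1_def by (rule osc_scale[OF V S(1) 1(1)])
  show "osc V G 1 t2"
    unfolding t2_def[abs_def] gs2_def
    by (rule osc_scale[OF V S(2) osc_diff[OF V 1(2) osc_scale[OF V S(3) 1(1)]]])
qed

text \<open>The coefficients of the projection are smooth, since they come from a smooth orthonormal frame.\<close>
lemma osc_nproj:
  assumes F: "smooth_on F V"
  shows "osc V G 1 (\<lambda>u. F u - nproj u (F u))"
proof -
  have "osc V G 1 (\<lambda>u. (F u \<bullet> G u) *\<^sub>R G u + ((F u \<bullet> t1 u) *\<^sub>R t1 u + (F u \<bullet> t2 u) *\<^sub>R t2 u))"
    by (intro osc_add osc_scale osc_frame smooth_on_inner F G smooth_frame V)
  then show ?thesis by (rule osc_cong) (simp add: nproj_def)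
qed

text \<open>Each normal derivative differs from the ordinary derivative by terms of order one, so the
  iterated normal derivatives have the partial derivatives as their leading terms. This is what
  makes the higher fundamental forms symmetric, since partial derivatives commute.\<close>
lemma osc_iterated_normal_derivative:
  assumes I1: "\<And>X u. u \<in> V \<Longrightarrow> I [X] u = dd X G u"
    and I2: "\<And>X Y Xs u. u \<in> V \<Longrightarrow> I (X # Y # Xs) u = nproj u (dd X (I (Y # Xs)) u)"
  shows "osc V G (length Xs) (\<lambda>u. I (X # Xs) u - dl (X # Xs) G u)"
proof (induction Xs arbitrary: X)
  case Nil
  show ?case by (rule osc_zero) (simp add: I1)
next
  case (Cons Y Ys)
  define D where "D u = I (Y # Ys) u - dl (Y # Ys) G u" for u
  have D: "osc V G (length Ys) D" using Cons.IH D_def[abs_def] by simp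
  have sD: "smooth_on D V" by (rule osc_smooth[OF V G D])
  have sI: "smooth_on (I (Y # Ys)) V"
    using smooth_on_add[OF sD smooth_dl[of "Y # Ys"] V] by (simp add: D_def)
  have eq: "dd X D u - (dd X (I (Y # Ys)) u - nproj u (dd X (I (Y # Ys)) u)) =
      I (X # Y # Ys) u - dl (X # Y # Ys) G u" if u: "u \<in> V" for u
  proof -
    note d = smooth_on_differentiable[OF _ V u]
    have "dd X D u = dd X (I (Y # Ys)) u - dd X (dl (Y # Ys) G) u"
      unfolding D_def[abs_def] by (rule dd_diff[OF d[OF sI] d[OF smooth_dl]])
    then show ?thesis by (simp add: I2[OF u])
  qed
  have "osc V G (length (Y # Ys))
      (\<lambda>u. dd X D u - (dd X (I (Y # Ys)) u - nproj u (dd X (I (Y # Ys)) u)))"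
    using osc_dd[OF V G D, of X] osc_mono[OF osc_nproj[OF smooth_on_dd[OF sI V, of X]], of "length (Y # Ys)"]
    by (intro osc_diff[OF V, where F = "dd X D"]) simp_all
  then show ?case by (rule osc_cong) (rule eq)
qed

end


section \<open>From the surface to coordinates\<close>

lemma chart_facts:
  assumes A: "oriented_surface A" and c: "c \<in> A"
  shows chart_open: "open (fst c)"
    and chart_image_open: "open (snd c ` fst c)"
    and chart_homeo: "homeomorphism (fst c) (snd c ` fst c) (snd c) (inv_into (fst c) (snd c))"
  using A c unfolding oriented_surface_def by (auto simp: case_prod_beta)

lemma chart_inv:
  assumes A: "oriented_surface A" and c: "c \<in> A"
  shows "p \<in> fst c \<Longrightarrow> inv_into (fst c) (snd c) (snd c p) = p"
    and "W \<subseteq> fst c \<Longrightarrow> u \<in> snd c ` W \<Longrightarrow> snd c (inv_into (fst c) (snd c) u) = u"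
    and "W \<subseteq> fst c \<Longrightarrow> u \<in> snd c ` W \<Longrightarrow> inv_into (fst c) (snd c) u \<in> W"
  using homeomorphism_apply1[OF chart_homeo[OF A c]] homeomorphism_apply2[OF chart_homeo[OF A c]]
  by (auto simp: subset_iff)

lemma open_chart_image:
  assumes A: "oriented_surface A" and c: "c \<in> A" and W: "open W"
  shows "open (snd c ` (W \<inter> fst c))"
proof -
  have "openin (top_of_set (snd c ` fst c)) (snd c ` (W \<inter> fst c))"
    using homeomorphism_imp_open_map[OF chart_homeo[OF A c] openin_open_Int[OF W]]
    by (simp add: Int_commute)
  then show ?thesis using chart_image_open[OF A c] openin_open_eq by blast
qed

lemma open_chart_preimage:
  assumes A: "oriented_surface A" and c: "c \<in> A" and B: "open B" "B \<subseteq> snd c ` fst c"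
  shows "open (inv_into (fst c) (snd c) ` B)"
proof -
  have "openin (top_of_set (fst c)) (inv_into (fst c) (snd c) ` B)"
    using homeomorphism_imp_open_map[OF homeomorphism_symD[OF chart_homeo[OF A c]], of B] B
    by (metis openin_open_eq chart_image_open[OF A c])
  then show ?thesis using chart_open[OF A c] openin_open_eq by blast
qed

lemma in_chart_at:
  assumes "oriented_surface A" "c \<in> A" "p \<in> fst c"
  shows "in_chart c f (snd c p) = f p"
  by (simp add: in_chart_def chart_inv(1)[OF assms])

text \<open>By the chain rule \<open>Y\<close> is the image of \<open>X\<close> under the derivative of the transition map, so it is the
  same for all maps \<open>g\<close>. Two immersions can therefore be compared in any chart.\<close>
lemma dmap_chart_change:
  fixes A :: "('l::{t2_space,second_countable_topology}) chart set"
  assumes A: "oriented_surface A" and c: "c \<in> A" "p \<in> fst c" and c': "c' \<in> A" "p \<in> fst c'"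
  obtains Y where "\<And>g :: 'l \<Rightarrow> 'a::euclidean_space. smooth_map A UNIV g \<Longrightarrow> dmap c' g p X = dmap c g p Y"
proof -
  define V where "V = snd c' ` (fst c \<inter> fst c')"
  define v where "v = snd c' p"
  define \<tau> where "\<tau> = in_chart c' (snd c)"
  have V: "open V" unfolding V_def by (rule open_chart_image[OF A c'(1) chart_open[OF A c(1)]])
  have v: "v \<in> V" using c c' by (auto simp: V_def v_def)
  have "smooth_on \<tau> V"
    using A c(1) c'(1) unfolding oriented_surface_def V_def \<tau>_def
    by (metis (no_types, lifting) Int_commute case_prodD prod.collapse)
  then have d\<tau>: "\<tau> differentiable (at v)" by (rule smooth_on_differentiable[OF _ V v])
  have \<tau>v: "\<tau> v = snd c p" unfolding \<tau>_def v_def by (rule in_chart_at[OF A c'])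
  show ?thesis
  proof (rule that)
    fix g :: "'l \<Rightarrow> 'a" assume g: "smooth_map A UNIV g"
    have "smooth_on (in_chart c g) (snd c ` (UNIV \<inter> fst c))"
      using g c(1) unfolding smooth_map_def by blast
    then have dg: "in_chart c g differentiable (at (\<tau> v))"
      unfolding \<tau>v
      by (rule smooth_on_differentiable) (use open_chart_image[OF A c(1) open_UNIV] c(2) in auto)
    have "dmap c' g p X = dd X (in_chart c' g) v" unfolding v_def by (rule dmap_eq_dd)
    also have "\<dots> = dd X (in_chart c g \<circ> \<tau>) v"
    proof (rule dd_cong[OF V v])
      fix w assume "w \<in> V"
      then have "inv_into (fst c') (snd c') w \<in> fst c \<inter> fst c'"
        unfolding V_def by (rule chart_inv(3)[OF A c'(1) Int_lower2])
      then show "in_chart c' g w = (in_chart c g \<circ> \<tau>) w"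
        by (simp add: \<tau>_def in_chart_def chart_inv(1)[OF A c(1)])
    qed
    also have "\<dots> = dd (dd X \<tau> v) (in_chart c g) (\<tau> v)"
      using dd_eqI[OF diff_chain_at[OF has_derivative_dd[OF d\<tau>] has_derivative_dd[OF dg]]]
      by simp
    also have "\<dots> = dmap c g p (dd X \<tau> v)" by (simp add: \<tau>v dmap_eq_dd)
    finally show "dmap c' g p X = dmap c g p (dd X \<tau> v)" .
  qed
qed

lemma tangent_plane_chart:
  fixes g :: "'l::{t2_space,second_countable_topology} \<Rightarrow> 'a::euclidean_space"
  assumes A: "oriented_surface A" and c: "c \<in> A" and p: "p \<in> fst c"
    and g: "smooth_map A UNIV g"
  shows "tangent_plane A g p = range (dmap c g p)"
proof -
  have "range (dmap c' g p) \<subseteq> range (dmap c g p)" if c': "c' \<in> A" and p': "p \<in> fst c'" for c'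
  proof
    fix t assume "t \<in> range (dmap c' g p)"
    then obtain X where t: "t = dmap c' g p X" by blast
    obtain Y where "dmap c' g p X = dmap c g p Y"
      using dmap_chart_change[OF A c p c' p', of X] g by blast
    then show "t \<in> range (dmap c g p)" unfolding t by simp
  qed
  moreover have "range (dmap c g p) \<subseteq> tangent_plane A g p"
    unfolding tangent_plane_def using c p by blast
  ultimately show ?thesis unfolding tangent_plane_def by blast
qed

text \<open>The open set \<open>W\<close> makes it possible to shrink the chart to the common domain of local frames.\<close>
lemma sphere_patch_chart:
  fixes g :: "'l::{t2_space,second_countable_topology} \<Rightarrow> 'a::euclidean_space"
  assumes A: "oriented_surface A" and c: "c \<in> A" and g: "sphere_immersion A g" and W: "open W"
  shows "sphere_patch (snd c ` (W \<inter> fst c)) (in_chart c g)"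
proof
  let ?V = "snd c ` (W \<inter> fst c)"
  show V: "open ?V" by (rule open_chart_image[OF A c W])
  have "smooth_on (in_chart c g) (snd c ` (UNIV \<inter> fst c))"
    using g c unfolding sphere_immersion_def smooth_map_def by blast
  then show s: "smooth_on (in_chart c g) ?V" by (rule smooth_on_subset[OF _ V]) auto
  show "in_chart c g u \<bullet> in_chart c g u = 1" for u
    using g unfolding sphere_immersion_def
    by (auto simp: in_chart_def dist_norm image_subset_iff norm_eq_1)
  fix u X assume u: "u \<in> ?V" and 0: "dd X (in_chart c g) u = 0"
  obtain p where p: "p \<in> fst c" "u = snd c p" using u by blast
  have "inj (dmap c g p)" using g c p(1) unfolding sphere_immersion_def by blast
  moreover have "dmap c g p X = dmap c g p 0"
    using 0 linear_0[OF linear_dd[OF smooth_on_differentiable[OF s V u]]] by (simp add: dmap_eq_dd p(2))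
  ultimately show "X = 0" by (simp add: inj_eq)
qed

lemma normal_space_chart:
  fixes g :: "'l::{t2_space,second_countable_topology} \<Rightarrow> 'a::euclidean_space"
  assumes A: "oriented_surface A" and c: "c \<in> A" and g: "sphere_immersion A g" and W: "open W"
    and p: "p \<in> W \<inter> fst c"
  shows "normal_space A g p = sphere_patch.normal (in_chart c g) (snd c p)"
proof -
  interpret sphere_patch "snd c ` (W \<inter> fst c)" "in_chart c g"
    by (rule sphere_patch_chart[OF A c g W])
  have "tangent_plane A g p = range (dmap c g p)"
    using tangent_plane_chart[OF A c] g p unfolding sphere_immersion_def by blast
  then show ?thesis
    using p by (auto simp: normal_space_def normal_def in_chart_at[OF A c] dmap_eq_dd)
qed

lemma normal_conn_chart:
  fixes g :: "'l::{t2_space,second_countable_topology} \<Rightarrow> 'a::euclidean_space"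
  assumes A: "oriented_surface A" and c: "c \<in> A" and g: "sphere_immersion A g" and W: "open W"
    and p: "p \<in> W \<inter> fst c"
  shows "normal_conn A c g X \<xi> p =
    sphere_patch.nproj (in_chart c g) (snd c p) (dd X (in_chart c \<xi>) (snd c p))"
proof -
  interpret sphere_patch "snd c ` (W \<inter> fst c)" "in_chart c g"
    by (rule sphere_patch_chart[OF A c g W])
  show ?thesis
    using p by (simp add: normal_conn_def normal_space_chart[OF A c g W p] oproj_normal dmap_eq_dd)
qed

lemma osc_iter_ff:
  fixes g :: "'l::{t2_space,second_countable_topology} \<Rightarrow> 'a::euclidean_space"
  assumes A: "oriented_surface A" and c: "c \<in> A" and g: "sphere_immersion A g" and W: "open W"
  shows "osc (snd c ` (W \<inter> fst c)) (in_chart c g) (length Xs)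
    (\<lambda>u. in_chart c (iter_ff A c g (X # Xs)) u - dl (X # Xs) (in_chart c g) u)"
proof -
  interpret sphere_patch "snd c ` (W \<inter> fst c)" "in_chart c g"
    by (rule sphere_patch_chart[OF A c g W])
  show ?thesis
  proof (rule osc_iterated_normal_derivative[of "\<lambda>Xs. in_chart c (iter_ff A c g Xs)"])
    fix u X Y Xs assume "u \<in> snd c ` (W \<inter> fst c)"
    then obtain p where p: "p \<in> W \<inter> fst c" "u = snd c p" by blast
    show "in_chart c (iter_ff A c g [X]) u = dd X (in_chart c g) u"
      using p by (simp add: in_chart_at[OF A c] dmap_eq_dd)
    show "in_chart c (iter_ff A c g (X # Y # Xs)) u =
        nproj u (dd X (in_chart c (iter_ff A c g (Y # Xs))) u)"
      using p by (simp add: in_chart_at[OF A c] normal_conn_chart[OF A c g W p(1)])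
  qed
qed

section \<open>Traceless symmetric forms on the plane and circular ellipses\<close>

text \<open>Expanding one argument at a time, symmetry and the vanishing trace reduce every term to
  \<open>F(X, \<dots>, X)\<close> or \<open>F(Y, X, \<dots>, X)\<close>, and the addition theorems collect the coefficients. So these two
  vectors are conjugate semi-diameters of the ellipse of curvature.\<close>
lemma traceless_form_rotation:
  fixes F :: "'v::real_vector list \<Rightarrow> 'a::real_vector"
  assumes perm: "\<And>Xs Ys. length Xs = r \<Longrightarrow> mset Xs = mset Ys \<Longrightarrow> F Xs = F Ys"
    and lin: "\<And>a b P Q Xs. length Xs + 1 = r \<Longrightarrow> F ((a *\<^sub>R P + b *\<^sub>R Q) # Xs) = a *\<^sub>R F (P # Xs) + b *\<^sub>R F (Q # Xs)"
    and trace: "\<And>Xs. length Xs + 2 = r \<Longrightarrow> F (Y # Y # Xs) = - F (X # X # Xs)"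
    and r: "r = Suc k"
  defines "Z \<equiv> \<lambda>t. cos t *\<^sub>R X + sin t *\<^sub>R Y"
  shows "F (replicate r (Z t)) = cos (real r * t) *\<^sub>R F (replicate r X) + sin (real r * t) *\<^sub>R F (Y # replicate k X)"
proof -
  define a where "a = F (replicate r X)"
  define b where "b = F (Y # replicate k X)"
  \<comment> \<open>The second family, with one argument \<open>Y\<close> left, is what the induction step of the first one needs.\<close>
  have "(\<forall>j. i + j = r \<longrightarrow> F (replicate i (Z t) @ replicate j X) = cos (real i * t) *\<^sub>R a + sin (real i * t) *\<^sub>R b) \<and>
    (\<forall>j. Suc (i + j) = r \<longrightarrow> F (replicate i (Z t) @ Y # replicate j X) = cos (real i * t) *\<^sub>R b - sin (real i * t) *\<^sub>R a)" for i
  proof (induction i)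
    case 0
    then show ?case by (simp add: a_def b_def r)
  next
    case (Suc i)
    have c: "cos (real (Suc i) * t) = cos t * cos (real i * t) - sin t * sin (real i * t)"
      "sin (real (Suc i) * t) = sin t * cos (real i * t) + cos t * sin (real i * t)"
      by (simp_all add: distrib_right cos_add sin_add)
    note IH = Suc.IH[THEN conjunct1, rule_format] Suc.IH[THEN conjunct2, rule_format]
    show ?case
    proof (intro conjI allI impI)
      fix j assume j: "Suc i + j = r"
      have "F (replicate (Suc i) (Z t) @ replicate j X)
        = cos t *\<^sub>R F (X # replicate i (Z t) @ replicate j X) + sin t *\<^sub>R F (Y # replicate i (Z t) @ replicate j X)"
        using lin[of "replicate i (Z t) @ replicate j X" "cos t" X "sin t" Y] j by (simp add: Z_def)
      also have "F (X # replicate i (Z t) @ replicate j X) = F (replicate i (Z t) @ replicate (Suc j) X)"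
        by (rule perm) (use j in simp_all)
      also have "\<dots> = cos (real i * t) *\<^sub>R a + sin (real i * t) *\<^sub>R b"
        by (rule IH(1)) (use j in simp)
      also have "F (Y # replicate i (Z t) @ replicate j X) = F (replicate i (Z t) @ Y # replicate j X)"
        by (rule perm) (use j in simp_all)
      also have "\<dots> = cos (real i * t) *\<^sub>R b - sin (real i * t) *\<^sub>R a"
        by (rule IH(2)) (use j in simp)
      finally show "F (replicate (Suc i) (Z t) @ replicate j X) =
          cos (real (Suc i) * t) *\<^sub>R a + sin (real (Suc i) * t) *\<^sub>R b"
        unfolding c by (simp add: algebra_simps)
    next
      fix j assume j: "Suc (Suc i + j) = r"
      have "F (replicate (Suc i) (Z t) @ Y # replicate j X)
        = cos t *\<^sub>R F (X # replicate i (Z t) @ Y # replicate j X) + sin t *\<^sub>R F (Y # replicate i (Z t) @ Y # replicate j X)"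
        using lin[of "replicate i (Z t) @ Y # replicate j X" "cos t" X "sin t" Y] j by (simp add: Z_def)
      also have "F (X # replicate i (Z t) @ Y # replicate j X) = F (replicate i (Z t) @ Y # replicate (Suc j) X)"
        by (rule perm) (use j in simp_all)
      also have "\<dots> = cos (real i * t) *\<^sub>R b - sin (real i * t) *\<^sub>R a"
        by (rule IH(2)) (use j in simp)
      also have "F (Y # replicate i (Z t) @ Y # replicate j X) = F (Y # Y # replicate i (Z t) @ replicate j X)"
        by (rule perm) (use j in simp_all)
      also have "\<dots> = - F (X # X # replicate i (Z t) @ replicate j X)"
        by (rule trace) (use j in simp)
      also have "F (X # X # replicate i (Z t) @ replicate j X) = F (replicate i (Z t) @ replicate (Suc (Suc j)) X)"
        by (rule perm) (use j in simp_all)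
      also have "\<dots> = cos (real i * t) *\<^sub>R a + sin (real i * t) *\<^sub>R b"
        by (rule IH(1)) (use j in simp)
      finally show "F (replicate (Suc i) (Z t) @ Y # replicate j X) =
          cos (real (Suc i) * t) *\<^sub>R b - sin (real (Suc i) * t) *\<^sub>R a"
        unfolding c by (simp add: algebra_simps)
    qed
  qed
  from this[of r] show ?thesis by (simp add: a_def b_def)
qed

lemma symmetric_form_scale:
  fixes F :: "'v::real_vector list \<Rightarrow> 'a::real_vector"
  assumes perm: "\<And>Xs Ys. length Xs = r \<Longrightarrow> mset Xs = mset Ys \<Longrightarrow> F Xs = F Ys"
    and lin: "\<And>a b P Q Xs. length Xs + 1 = r \<Longrightarrow> F ((a *\<^sub>R P + b *\<^sub>R Q) # Xs) = a *\<^sub>R F (P # Xs) + b *\<^sub>R F (Q # Xs)"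
  shows "F (replicate r (k *\<^sub>R Z)) = k ^ r *\<^sub>R F (replicate r Z)"
proof -
  have "\<forall>j. i + j = r \<longrightarrow> F (replicate i (k *\<^sub>R Z) @ replicate j Z) = k ^ i *\<^sub>R F (replicate r Z)" for i
  proof (induction i)
    case 0
    then show ?case by simp
  next
    case (Suc i)
    show ?case
    proof (intro allI impI)
      fix j assume j: "Suc i + j = r"
      have "F (replicate (Suc i) (k *\<^sub>R Z) @ replicate j Z) = k *\<^sub>R F (Z # replicate i (k *\<^sub>R Z) @ replicate j Z)"
        using lin[of "replicate i (k *\<^sub>R Z) @ replicate j Z" k Z 0 Z] j by simp
      also have "F (Z # replicate i (k *\<^sub>R Z) @ replicate j Z) = F (replicate i (k *\<^sub>R Z) @ replicate (Suc j) Z)"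
        by (rule perm) (use j in simp_all)
      also have "\<dots> = k ^ i *\<^sub>R F (replicate r Z)" by (rule Suc.IH[rule_format]) (use j in simp)
      finally show "F (replicate (Suc i) (k *\<^sub>R Z) @ replicate j Z) = k ^ Suc i *\<^sub>R F (replicate r Z)" by simp
    qed
  qed
  from this[of r] show ?thesis by simp
qed

text \<open>Opposite points of the ellipse are equidistant from the centre of the circle, so every point
  is orthogonal to the centre and all points have the same length.\<close>
lemma circle_conjugate_diameters:
  assumes "is_circle C" and C: "\<And>t. cos t *\<^sub>R a + sin t *\<^sub>R b \<in> C"
  shows "a \<bullet> a = b \<bullet> b" "a \<bullet> b = 0"
proof -
  obtain z u v r where uv: "norm u = 1" "norm v = 1" "u \<bullet> v = 0"
    and Ceq: "C = {z + (r * cos t) *\<^sub>R u + (r * sin t) *\<^sub>R v |t. t \<in> (UNIV :: real set)}"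
    using assms(1) unfolding is_circle_def by blast
  have sph: "(x - z) \<bullet> (x - z) = r\<^sup>2" if x: "x \<in> C" for x
  proof -
    obtain t where t: "x = z + (r * cos t) *\<^sub>R u + (r * sin t) *\<^sub>R v" using x Ceq by blast
    have "u \<bullet> u = 1" "v \<bullet> v = 1" "v \<bullet> u = 0" using uv by (simp_all add: norm_eq_1 inner_commute)
    then have "(x - z) \<bullet> (x - z) = r * cos t * (r * cos t) + r * sin t * (r * sin t)"
      unfolding t using uv(3) by (simp add: inner_add_left inner_add_right)
    also have "\<dots> = r\<^sup>2 * ((cos t)\<^sup>2 + (sin t)\<^sup>2)" by (simp only: power2_eq_square algebra_simps)
    finally show ?thesis by simp
  qed
  have len: "p \<bullet> p = r\<^sup>2 - z \<bullet> z" if p: "p \<in> C" "- p \<in> C" for p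
    using sph[OF p(1)] sph[OF p(2)] by (simp add: inner_diff_left inner_diff_right inner_commute[of z p])
  have neg: "- (cos t *\<^sub>R a + sin t *\<^sub>R b) \<in> C" for t
    using C[of "t + pi"] by simp
  have L: "(cos t *\<^sub>R a + sin t *\<^sub>R b) \<bullet> (cos t *\<^sub>R a + sin t *\<^sub>R b) = r\<^sup>2 - z \<bullet> z" for t
    by (rule len[OF C neg])
  have a: "a \<bullet> a = r\<^sup>2 - z \<bullet> z" using L[of 0] by simp
  have b: "b \<bullet> b = r\<^sup>2 - z \<bullet> z" using L[of "pi / 2"] by simp
  \<comment> \<open>The diagonal direction has the same length as \<open>a\<close> and \<open>b\<close>, which makes the mixed term vanish.\<close>
  have h: "cos (pi / 4) = sqrt 2 / 2" "sin (pi / 4) = sqrt 2 / 2" by (simp_all add: cos_45 sin_45)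
  have half: "(sqrt 2 / 2) * ((sqrt 2 / 2) * x) = x / 2" for x :: real by simp
  have "(sqrt 2 / 2) * ((sqrt 2 / 2) * (a \<bullet> a + 2 * (a \<bullet> b) + b \<bullet> b)) = r\<^sup>2 - z \<bullet> z"
    using L[of "pi / 4"] unfolding h
    by (simp add: inner_add_left inner_add_right inner_commute[of b a] algebra_simps)
  then show "a \<bullet> b = 0" using a b unfolding half by simp
  show "a \<bullet> a = b \<bullet> b" using a b by simp
qed

text \<open>Lagrange's identity shows that the area of the parallelogram is the product of the equal lengths;
  then \<open>b\<close> has distance \<open>0\<close> from the quarter turn of \<open>a\<close>.\<close>
lemma quarter_turn_coords:
  fixes a1 a2 b1 b2 :: real
  assumes "a1 * a1 + a2 * a2 = b1 * b1 + b2 * b2" "a1 * b1 + a2 * b2 = 0" "0 < a1 * b2 - a2 * b1"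
  shows "b1 = - a2" "b2 = a1"
proof -
  define N where "N = a1 * a1 + a2 * a2"
  define d where "d = a1 * b2 - a2 * b1"
  have "d * d + (a1 * b1 + a2 * b2) * (a1 * b1 + a2 * b2) = N * (b1 * b1 + b2 * b2)"
    unfolding d_def N_def by (simp add: algebra_simps)
  then have "d\<^sup>2 = N\<^sup>2" using assms N_def by (simp add: power2_eq_square)
  moreover have "N \<ge> 0" by (simp add: N_def)
  ultimately have "d = N" using assms(3) d_def by (simp add: power2_eq_iff_nonneg)
  then have "(b1 + a2) * (b1 + a2) + (b2 - a1) * (b2 - a1) = 0"
    using assms(1) unfolding d_def N_def by (simp add: algebra_simps)
  then have "b1 + a2 = 0 \<and> b2 - a1 = 0" by (simp add: sum_squares_eq_zero_iff)
  then show "b1 = - a2" "b2 = a1" by linarith+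
qed

lemma cramer:
  fixes X Y Z :: "real^2"
  assumes "X $ 1 * Y $ 2 - X $ 2 * Y $ 1 \<noteq> 0"
  obtains \<alpha> \<beta> where "Z = \<alpha> *\<^sub>R X + \<beta> *\<^sub>R Y"
proof
  let ?d = "X $ 1 * Y $ 2 - X $ 2 * Y $ 1"
  show "Z = ((Z $ 1 * Y $ 2 - Z $ 2 * Y $ 1) / ?d) *\<^sub>R X + ((X $ 1 * Z $ 2 - X $ 2 * Z $ 1) / ?d) *\<^sub>R Y"
    using assms by (simp add: vec_eq_iff forall_2 add_divide_distrib[symmetric] eq_divide_eq)
      (simp add: algebra_simps)
qed

text \<open>The system says that the matrix of a nonzero complex number annihilates \<open>(x, y)\<close>.\<close>
lemma rotation_kernel:
  fixes a1 a2 x y :: real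
  assumes "a1 * x + a2 * y = 0" "a1 * y = a2 * x" "a1 \<noteq> 0 \<or> a2 \<noteq> 0"
  shows "x = 0" "y = 0"
proof -
  have n: "\<not> a1 * a1 + a2 * a2 = 0" using assms(3) by (simp add: sum_squares_eq_zero_iff)
  have "(a1 * a1 + a2 * a2) * x = a1 * (a1 * x + a2 * y) + a2 * (a2 * x - a1 * y)"
    by (simp add: algebra_simps)
  then have "(a1 * a1 + a2 * a2) * x = 0"
    unfolding assms(1,2) by (simp only: diff_self mult_zero_right add_0_right)
  then show "x = 0" using n mult_eq_0_iff[of "a1 * a1 + a2 * a2" x] by blast
  have "(a1 * a1 + a2 * a2) * y = a2 * (a1 * x + a2 * y) - a1 * (a2 * x - a1 * y)"
    by (simp add: algebra_simps)
  then have "(a1 * a1 + a2 * a2) * y = 0"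
    unfolding assms(1,2) by (simp only: diff_self mult_zero_right add_0_right)
  then show "y = 0" using n mult_eq_0_iff[of "a1 * a1 + a2 * a2" y] by blast
qed

lemma det_vector_pair: "det (vector [X, Y] :: real^2^2) = X $ 1 * Y $ 2 - X $ 2 * Y $ 1"
  by (simp add: det_2 vector_2)


section \<open>Minimality and the complex structure on a patch\<close>

context sphere_patch
begin

lemma dd_nonzero: "u \<in> V \<Longrightarrow> X \<noteq> 0 \<Longrightarrow> 0 < dd X G u \<bullet> dd X G u"
  using imm[of u X] by auto

lemma dd_lin:
  "u \<in> V \<Longrightarrow> dd (a *\<^sub>R P + b *\<^sub>R Q) (dl Xs G) u = a *\<^sub>R dd P (dl Xs G) u + b *\<^sub>R dd Q (dl Xs G) u"
  using smooth_on_differentiable[OF smooth_dl V] by (simp add: dd_add_arg dd_scale_arg)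

lemma dd_lin0:
  "u \<in> V \<Longrightarrow> dd (a *\<^sub>R P + b *\<^sub>R Q) G u = a *\<^sub>R dd P G u + b *\<^sub>R dd Q G u"
  using dd_lin[of u a P b Q "[]"] by simp

lemma nproj_lin: "nproj u (a *\<^sub>R v + b *\<^sub>R w) = a *\<^sub>R nproj u v + b *\<^sub>R nproj u w"
  by (simp add: nproj_def inner_add_left algebra_simps)

text \<open>The trace of the second fundamental form in the possibly oblique basis \<open>X, Y\<close>, multiplied by
  the determinant of the metric.\<close>
lemma oblique_trace:
  assumes min: "\<And>X Y. dd X G u \<bullet> dd X G u = 1 \<Longrightarrow> dd Y G u \<bullet> dd Y G u = 1 \<Longrightarrow> dd X G u \<bullet> dd Y G u = 0
      \<Longrightarrow> nproj u (dl [X, X] G u) + nproj u (dl [Y, Y] G u) = 0"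
    and u: "u \<in> V" and XY: "indep2 (dd X G u) (dd Y G u)"
  shows "nproj u ((dd Y G u \<bullet> dd Y G u) *\<^sub>R dl [X, X] G u
     + ((- 2 * (dd X G u \<bullet> dd Y G u)) *\<^sub>R dl [X, Y] G u + (dd X G u \<bullet> dd X G u) *\<^sub>R dl [Y, Y] G u)) = 0"
proof -
  define p r s where "p = dd X G u \<bullet> dd X G u" and "r = dd X G u \<bullet> dd Y G u" and "s = dd Y G u \<bullet> dd Y G u"
  define \<Delta> where "\<Delta> = s - r * r * inverse p"
  have p: "p > 0" and \<Delta>: "\<Delta> > 0"
    using indep2_gram[OF XY] unfolding p_def r_def s_def \<Delta>_def by auto
  define B where "B P Q = nproj u (dl [P, Q] G u)" for P Q
  have sym: "B P Q = B Q P" for P Q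
    unfolding B_def using dl_mset[OF V G, of "[P, Q]" "[Q, P]"] u by simp
  have lin: "B (a *\<^sub>R P + b *\<^sub>R P') Q = a *\<^sub>R B P Q + b *\<^sub>R B P' Q" for a b P P' Q
    unfolding B_def using dd_lin[OF u, of a P b P' "[Q]"] by (simp add: nproj_lin)
  have lin': "B Q (a *\<^sub>R P + b *\<^sub>R P') = a *\<^sub>R B Q P + b *\<^sub>R B Q P'" for a b P P' Q
    using lin sym by metis
  define x where "x = inverse (sqrt p)"
  define y where "y = inverse (sqrt \<Delta>)"
  have xx: "x * x = inverse p" and yy: "y * y = inverse \<Delta>"
    using p \<Delta> by (simp_all add: x_def y_def inverse_mult_distrib[symmetric] del: inverse_mult_distrib)
  \<comment> \<open>\<open>P, Q\<close> is the Gram--Schmidt basis for \<open>X, Y\<close>, to which minimality applies.\<close>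
  define P where "P = x *\<^sub>R X + 0 *\<^sub>R Y"
  define Q where "Q = (- (y * r * inverse p)) *\<^sub>R X + y *\<^sub>R Y"
  have g: "dd (a *\<^sub>R X + b *\<^sub>R Y) G u \<bullet> dd (a' *\<^sub>R X + b' *\<^sub>R Y) G u = a * a' * p + (a * b' + b * a') * r + b * b' * s"
    for a b a' b'
    unfolding dd_lin0[OF u] p_def r_def s_def
    by (simp add: inner_add_left inner_add_right inner_commute[of "dd Y G u" "dd X G u"] algebra_simps)
  have PP: "dd P G u \<bullet> dd P G u = 1" unfolding P_def g using xx p by simp
  have QQ: "dd Q G u \<bullet> dd Q G u = 1"
  proof -
    have "dd Q G u \<bullet> dd Q G u = (y * y) * \<Delta>"
      unfolding Q_def g \<Delta>_def using p by (simp add: field_simps)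
    then show ?thesis using yy \<Delta> by simp
  qed
  have PQ: "dd P G u \<bullet> dd Q G u = 0" unfolding P_def Q_def g using p by (simp add: field_simps)
  have "B P P + B Q Q = 0" using min[OF PP QQ PQ] by (simp add: B_def)
  moreover have "B P P = inverse p *\<^sub>R B X X"
    unfolding P_def lin lin' by (simp add: xx)
  moreover have "B Q Q = inverse \<Delta> *\<^sub>R ((r * r * inverse p * inverse p) *\<^sub>R B X X
      + (- 2 * r * inverse p) *\<^sub>R B X Y + B Y Y)"
    unfolding Q_def lin lin' sym[of Y X] yy[symmetric] by (simp add: algebra_simps flip: scaleR_add_left)
  ultimately have "(p * \<Delta>) *\<^sub>R (inverse p *\<^sub>R B X X + inverse \<Delta> *\<^sub>R ((r * r * inverse p * inverse p) *\<^sub>R B X X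
      + (- 2 * r * inverse p) *\<^sub>R B X Y + B Y Y)) = 0" by simp
  moreover have "p * \<Delta> * inverse p = \<Delta>" "p * \<Delta> * inverse \<Delta> = p" using p \<Delta> by simp_all
  ultimately have "\<Delta> *\<^sub>R B X X + p *\<^sub>R ((r * r * inverse p * inverse p) *\<^sub>R B X X
      + (- 2 * r * inverse p) *\<^sub>R B X Y + B Y Y) = 0"
    by (simp only: scaleR_add_right[of "p * \<Delta>"] scaleR_scaleR)
  moreover have "\<Delta> *\<^sub>R B X X + p *\<^sub>R ((r * r * inverse p * inverse p) *\<^sub>R B X X
      + (- 2 * r * inverse p) *\<^sub>R B X Y + B Y Y) = s *\<^sub>R B X X + ((- 2 * r) *\<^sub>R B X Y + p *\<^sub>R B Y Y)"
  proof -
    have "p * (r * r * inverse p * inverse p) = r * r * inverse p" "p * (- 2 * r * inverse p) = - 2 * r"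
      using p by simp_all
    then show ?thesis
      unfolding \<Delta>_def by (simp only: scaleR_add_right scaleR_scaleR scaleR_diff_left) simp
  qed
  ultimately have "s *\<^sub>R B X X + 1 *\<^sub>R ((- 2 * r) *\<^sub>R B X Y + p *\<^sub>R B Y Y) = 0" by simp
  then show ?thesis
    unfolding B_def nproj_lin[symmetric] by (simp add: p_def r_def s_def)
qed

text \<open>Minimality says that a second order combination of partial derivatives has order one.
  Differentiating this relation shows that the trace of every iterated derivative drops by one
  order.\<close>
lemma trace_drops_order:
  assumes min: "\<And>u X Y. u \<in> V \<Longrightarrow> dd X G u \<bullet> dd X G u = 1 \<Longrightarrow> dd Y G u \<bullet> dd Y G u = 1 \<Longrightarrow> dd X G u \<bullet> dd Y G u = 0
      \<Longrightarrow> nproj u (dl [X, X] G u) + nproj u (dl [Y, Y] G u) = 0"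
    and u: "u \<in> V" and X0: "X \<noteq> 0"
    and conf: "dd X G u \<bullet> dd X G u = dd Y G u \<bullet> dd Y G u" "dd X G u \<bullet> dd Y G u = 0"
  shows "dl (X # X # Xs) G u + dl (Y # Y # Xs) G u \<in> span {dl Ys G u |Ys. length Ys \<le> length Xs + 1}"
proof -
  define p r s where "p v = dd X G v \<bullet> dd X G v" and "r v = - 2 * (dd X G v \<bullet> dd Y G v)"
    and "s v = dd Y G v \<bullet> dd Y G v" for v
  have pos: "dd X G u \<bullet> dd X G u > 0" by (rule dd_nonzero[OF u X0])
  have XY: "a = 0 \<and> b = 0" if "a *\<^sub>R X + b *\<^sub>R Y = 0" for a b
  proof -
    have 0: "a *\<^sub>R dd X G u + b *\<^sub>R dd Y G u = 0"
      using dd_lin0[OF u, of a X b Y] that linear_0[OF linear_dd[OF diffG[OF u]]] by simp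
    have "(a *\<^sub>R dd X G u + b *\<^sub>R dd Y G u) \<bullet> dd X G u = 0" "(a *\<^sub>R dd X G u + b *\<^sub>R dd Y G u) \<bullet> dd Y G u = 0"
      unfolding 0 by simp_all
    then show ?thesis using pos conf by (simp add: inner_add_left inner_commute[of "dd Y G u" "dd X G u"])
  qed
  have ind: "indep2 (dd X G v) (dd Y G v)" if v: "v \<in> V" for v
    unfolding indep2_def using XY imm[OF v] dd_lin0[OF v] by metis
  have sm: "smooth_on p V" "smooth_on r V" "smooth_on s V"
    unfolding p_def[abs_def] r_def[abs_def] s_def[abs_def]
    by (intro smooth_on_mult smooth_on_inner smooth_on_const smooth_on_dd V G)+
  define D where "D v = s v *\<^sub>R dl [X, X] G v + (r v *\<^sub>R dl [X, Y] G v + p v *\<^sub>R dl [Y, Y] G v)" for v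
  have sD: "smooth_on D V"
    unfolding D_def[abs_def] by (intro smooth_on_add smooth_on_scaleR smooth_dl sm V)
  \<comment> \<open>\<open>D\<close> has no normal component, so it equals its tangential part, which has order one.\<close>
  have "nproj v (D v) = 0" if v: "v \<in> V" for v
    unfolding D_def p_def r_def s_def by (rule oblique_trace[OF min[OF v] v ind[OF v]])
  then have oD: "osc V G 1 D"
    by (intro osc_cong[OF osc_nproj[OF sD]]) simp
  define k where "k = length Xs + 1"
  \<comment> \<open>the errors made by pulling the coefficients out of the differentiation\<close>
  define D1 where "D1 v = dl Xs (\<lambda>v. s v *\<^sub>R dl [X, X] G v) v - s v *\<^sub>R dl (Xs @ [X, X]) G v" for v
  define D2 where "D2 v = dl Xs (\<lambda>v. r v *\<^sub>R dl [X, Y] G v) v - r v *\<^sub>R dl (Xs @ [X, Y]) G v" for v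
  define D3 where "D3 v = dl Xs (\<lambda>v. p v *\<^sub>R dl [Y, Y] G v) v - p v *\<^sub>R dl (Xs @ [Y, Y]) G v" for v
  have o: "osc V G k D1" "osc V G k D2" "osc V G k D3"
    using osc_dl_scaleR[OF V G sm(3), of Xs "[X, X]"] osc_dl_scaleR[OF V G sm(2), of Xs "[X, Y]"]
      osc_dl_scaleR[OF V G sm(1), of Xs "[Y, Y]"]
    by (simp_all add: D1_def[abs_def] D2_def[abs_def] D3_def[abs_def] k_def)
  have o4: "osc V G k (dl Xs D)" using osc_dl_osc[OF V G oD, of Xs] by (simp add: k_def)
  have mem: "dl Xs D u - (D1 u + (D2 u + D3 u)) \<in> span {dl Ys G u |Ys. length Ys \<le> k}"
    by (rule osc_span[OF osc_diff[OF V o4 osc_add[OF o(1) osc_add[OF o(2,3)]]] u])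
  have sums: "smooth_on (\<lambda>v. s v *\<^sub>R dl [X, X] G v) V" "smooth_on (\<lambda>v. r v *\<^sub>R dl [X, Y] G v) V"
    "smooth_on (\<lambda>v. p v *\<^sub>R dl [Y, Y] G v) V"
    by (intro smooth_on_scaleR smooth_dl sm V)+
  have "dl Xs D u = dl Xs (\<lambda>v. s v *\<^sub>R dl [X, X] G v) u
      + (dl Xs (\<lambda>v. r v *\<^sub>R dl [X, Y] G v) u + dl Xs (\<lambda>v. p v *\<^sub>R dl [Y, Y] G v) u)"
    unfolding D_def[abs_def] dl_add[OF V sums(1) smooth_on_add[OF sums(2,3) V] u] dl_add[OF V sums(2,3) u] ..
  then have "dl Xs D u - (D1 u + (D2 u + D3 u)) =
      s u *\<^sub>R dl (Xs @ [X, X]) G u + (r u *\<^sub>R dl (Xs @ [X, Y]) G u + p u *\<^sub>R dl (Xs @ [Y, Y]) G u)"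
    by (simp add: D1_def D2_def D3_def)
  also have "\<dots> = p u *\<^sub>R (dl (X # X # Xs) G u + dl (Y # Y # Xs) G u)"
    using conf dl_mset[OF V G, of "Xs @ [X, X]" "X # X # Xs"] dl_mset[OF V G, of "Xs @ [Y, Y]" "Y # Y # Xs"] u
    by (simp add: p_def r_def s_def scaleR_add_right)
  finally have "p u *\<^sub>R (dl (X # X # Xs) G u + dl (Y # Y # Xs) G u) \<in> span {dl Ys G u |Ys. length Ys \<le> k}"
    using mem by simp
  then have "inverse (p u) *\<^sub>R (p u *\<^sub>R (dl (X # X # Xs) G u + dl (Y # Y # Xs) G u)) \<in> span {dl Ys G u |Ys. length Ys \<le> k}"
    by (rule span_scale)
  then show ?thesis using pos by (simp add: k_def p_def)
qed

text \<open>Rotating the gradient of \<open>Z \<mapsto> dG X \<bullet> dG Z\<close> in the coordinate plane gives a vector \<open>Y0\<close> whose image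
  is orthogonal to \<open>dG X\<close>; it is then scaled. This shows that the description of the complex structure
  by \<open>cstruct\<close> is not void.\<close>
lemma rotation_exists_unique:
  assumes u: "u \<in> V" and X: "X \<noteq> 0"
  shows "\<exists>!Y. dd X G u \<bullet> dd Y G u = 0 \<and> norm (dd Y G u) = norm (dd X G u) \<and> 0 < det (vector [X, Y] :: real^2^2)"
proof -
  let ?a = "dd ax1 G u" and ?b = "dd ax2 G u" and ?x = "dd X G u"
  define Y0 where "Y0 = (- (?x \<bullet> ?b)) *\<^sub>R ax1 + (?x \<bullet> ?a) *\<^sub>R ax2"
  have Y0: "Y0 $ 1 = - (?x \<bullet> ?b)" "Y0 $ 2 = ?x \<bullet> ?a" by (simp_all add: Y0_def axis_def)
  have orth: "?x \<bullet> dd Y0 G u = 0"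
    unfolding Y0_def dd_lin0[OF u] by (simp add: inner_add_right inner_diff_right)
  have "?x \<bullet> ?x = X $ 1 * (?x \<bullet> ?a) + X $ 2 * (?x \<bullet> ?b)"
    by (subst (2) dd_coords[OF u, of X]) (simp add: inner_add_right)
  then have det0: "X $ 1 * Y0 $ 2 - X $ 2 * Y0 $ 1 > 0"
    using dd_nonzero[OF u X] Y0 by simp
  then have "Y0 \<noteq> 0" by auto
  then have n0: "norm (dd Y0 G u) > 0" using imm[OF u] by auto
  have nx: "norm ?x > 0" using imm[OF u] X by auto
  define \<rho> where "\<rho> = norm ?x / norm (dd Y0 G u)"
  have \<rho>: "\<rho> > 0" using n0 nx by (simp add: \<rho>_def)
  have dY: "dd (\<rho> *\<^sub>R Y0) G u = \<rho> *\<^sub>R dd Y0 G u" by (rule dd_scale_arg[OF diffG[OF u]])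
  have detY: "X $ 1 * (\<rho> *\<^sub>R Y0) $ 2 - X $ 2 * (\<rho> *\<^sub>R Y0) $ 1 = \<rho> * (X $ 1 * Y0 $ 2 - X $ 2 * Y0 $ 1)"
    by (simp add: algebra_simps)
  show ?thesis
  proof (rule ex1I[of _ "\<rho> *\<^sub>R Y0"], intro conjI)
    show "?x \<bullet> dd (\<rho> *\<^sub>R Y0) G u = 0" using orth by (simp add: dY)
    show "norm (dd (\<rho> *\<^sub>R Y0) G u) = norm ?x" using n0 \<rho> unfolding dY by (simp add: \<rho>_def)
    show "0 < det (vector [X, \<rho> *\<^sub>R Y0] :: real^2^2)" unfolding det_vector_pair detY using \<rho> det0 by simp
  next
    fix Y assume Y: "?x \<bullet> dd Y G u = 0 \<and> norm (dd Y G u) = norm ?x \<and> 0 < det (vector [X, Y] :: real^2^2)"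
    obtain \<alpha> \<beta> where ab: "\<rho> *\<^sub>R Y0 = \<alpha> *\<^sub>R X + \<beta> *\<^sub>R Y"
      using cramer[of X Y "\<rho> *\<^sub>R Y0"] Y[unfolded det_vector_pair] by (metis less_irrefl)
    have "\<alpha> * (?x \<bullet> ?x) + \<beta> * (?x \<bullet> dd Y G u) = ?x \<bullet> dd (\<rho> *\<^sub>R Y0) G u"
      unfolding ab dd_lin0[OF u] by (simp add: inner_add_right)
    then have "\<alpha> = 0" using Y orth nx by (simp add: dY)
    then have ab: "\<rho> *\<^sub>R Y0 = \<beta> *\<^sub>R Y" using ab by simp
    have "norm (dd (\<beta> *\<^sub>R Y) G u) = norm ?x" unfolding ab[symmetric] dY using n0 \<rho> by (simp add: \<rho>_def)
    then have "\<bar>\<beta>\<bar> = 1" using Y nx by (simp add: dd_scale_arg[OF diffG[OF u]])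
    moreover have "\<beta> * (X $ 1 * Y $ 2 - X $ 2 * Y $ 1) = \<rho> * (X $ 1 * Y0 $ 2 - X $ 2 * Y0 $ 1)"
      using detY unfolding ab by (simp add: algebra_simps)
    then have "\<beta> * (X $ 1 * Y $ 2 - X $ 2 * Y $ 1) > 0" using mult_pos_pos[OF \<rho> det0] by simp
    then have "\<beta> > 0" using Y[unfolded det_vector_pair] zero_less_mult_pos2 by blast
    ultimately show "Y = \<rho> *\<^sub>R Y0" using ab by simp
  qed
qed

end

lemma cstruct_facts:
  fixes g :: "'l::{t2_space,second_countable_topology} \<Rightarrow> 'a::euclidean_space"
  assumes A: "oriented_surface A" and c: "c \<in> A" and g: "sphere_immersion A g"
    and p: "p \<in> fst c" and X: "X \<noteq> 0"
  defines "Y \<equiv> cstruct c g p X"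
  shows "dmap c g p X \<bullet> dmap c g p Y = 0" "dmap c g p X \<bullet> dmap c g p X = dmap c g p Y \<bullet> dmap c g p Y"
    "X $ 1 * Y $ 2 - X $ 2 * Y $ 1 \<noteq> 0"
proof -
  interpret sphere_patch "snd c ` (UNIV \<inter> fst c)" "in_chart c g"
    by (rule sphere_patch_chart[OF A c g open_UNIV])
  have u: "snd c p \<in> snd c ` (UNIV \<inter> fst c)" using p by simp
  have "dmap c g p X \<bullet> dmap c g p Y = 0 \<and> norm (dmap c g p Y) = norm (dmap c g p X) \<and> 0 < det (vector [X, Y] :: real^2^2)"
    unfolding Y_def cstruct_def using theI'[OF rotation_exists_unique[OF u X]] X by (simp add: dmap_eq_dd)
  then show "dmap c g p X \<bullet> dmap c g p Y = 0" "dmap c g p X \<bullet> dmap c g p X = dmap c g p Y \<bullet> dmap c g p Y"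
    "X $ 1 * Y $ 2 - X $ 2 * Y $ 1 \<noteq> 0"
    by (auto simp: det_vector_pair norm_eq)
qed

section \<open>Higher fundamental forms and osculating spaces\<close>

lemma subspace_Nsum: "subspace (Nsum A c g k p)"
  by (cases k) (simp_all add: subspace_0 subspace_single_0 del: Nsum.simps(2), simp add: Nsum_Suc)

lemma Nsum_mono:
  assumes "k \<le> l"
  shows "Nsum A c g k p \<subseteq> Nsum A c g l p"
  using assms
proof (induction l rule: dec_induct)
  case (step l)
  have "Nsum A c g l p \<subseteq> Nsum A c g (Suc l) p"
    unfolding Nsum_Suc by (meson Un_upper1 span_superset subset_trans)
  then show ?case using step by blast
qed simp

lemma fund_form_orth_Nsum:
  assumes "length Xs = Suc (Suc k)" "v \<in> Nsum A c g k p"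
  shows "fund_form A c g p Xs \<bullet> v = 0"
  using oproj_orth[OF subspace_Nsum assms(2)] assms(1) by (simp add: fund_form_def)

text \<open>The fundamental forms are defined as components orthogonal to the previous normal spaces. This is
  the source of the orthogonality of all normal planes.\<close>
lemma curv_space_orth_Nsum:
  assumes "w \<in> curv_space A c g (Suc k) p" "v \<in> Nsum A c g k p"
  shows "w \<bullet> v = 0"
  using assms(1) unfolding curv_space_def
  by (rule inner_span_zero) (use fund_form_orth_Nsum[OF _ assms(2)] in auto)

lemma iter_ff_in_Nsum:
  assumes "length Xs = Suc (Suc k)"
  shows "iter_ff A c g Xs p \<in> Nsum A c g (Suc k) p"
proof -
  have l: "length (rev Xs) = Suc (Suc k)" using assms by simp
  have "iter_ff A c g Xs p = fund_form A c g p (rev Xs) + oproj (Nsum A c g k p) (iter_ff A c g Xs p)"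
    using l by (simp add: fund_form_def)
  moreover have "fund_form A c g p (rev Xs) \<in> curv_space A c g (Suc k) p"
    unfolding curv_space_def by (rule span_base) (use l in auto)
  moreover have "oproj (Nsum A c g k p) (iter_ff A c g Xs p) \<in> Nsum A c g k p"
    by (rule oproj_in[OF subspace_Nsum])
  ultimately show ?thesis unfolding Nsum_Suc by (metis Un_iff span_add span_base)
qed

lemma second_ff_chart:
  fixes g :: "'l::{t2_space,second_countable_topology} \<Rightarrow> 'a::euclidean_space"
  assumes A: "oriented_surface A" and c: "c \<in> A" and g: "sphere_immersion A g" and p: "p \<in> fst c"
  shows "second_ff A c g p X Y = sphere_patch.nproj (in_chart c g) (snd c p) (dl [X, Y] (in_chart c g) (snd c p))"
proof -
  let ?V = "snd c ` (UNIV \<inter> fst c)"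
  have "second_ff A c g p X Y = sphere_patch.nproj (in_chart c g) (snd c p)
      (dd X (in_chart c (iter_ff A c g [Y])) (snd c p))"
    using normal_conn_chart[OF A c g open_UNIV, of p] p by (simp add: second_ff_def)
  also have "dd X (in_chart c (iter_ff A c g [Y])) (snd c p) = dd X (dl [Y] (in_chart c g)) (snd c p)"
  proof (rule dd_cong[OF open_chart_image[OF A c open_UNIV]])
    show "snd c p \<in> ?V" using p by simp
    fix v assume "v \<in> ?V"
    then obtain p' where "p' \<in> fst c" "v = snd c p'" by blast
    then show "in_chart c (iter_ff A c g [Y]) v = dl [Y] (in_chart c g) v"
      by (simp add: in_chart_at[OF A c] dmap_eq_dd)
  qed
  finally show ?thesis by simp
qed

text \<open>The situation at the points of the open dense set on which the plane bundles come from the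
  fundamental forms. The orientations are encoded by the bases \<open>e s, f s\<close>.\<close>
locale adapted_point =
  fixes A :: "('l::{t2_space,second_countable_topology}) chart set" and c :: "'l chart"
    and g :: "'l \<Rightarrow> 'a::euclidean_space" and q :: 'l and m :: nat and e f :: "nat \<Rightarrow> 'a"
  assumes A: "oriented_surface A" and c: "c \<in> A" and q: "q \<in> fst c"
    and min: "minimal_surface A g"
    and curv: "\<And>s. s \<in> {1..m} \<Longrightarrow> curv_space A c g s q = span {e s, f s}"
    and ons: "\<And>s. s \<in> {1..m} \<Longrightarrow> e s \<bullet> e s = 1" "\<And>s. s \<in> {1..m} \<Longrightarrow> f s \<bullet> f s = 1"
      "\<And>s. s \<in> {1..m} \<Longrightarrow> e s \<bullet> f s = 0"
    and nrm: "\<And>s. s \<in> {1..m} \<Longrightarrow> e s \<in> normal_space A g q" "\<And>s. s \<in> {1..m} \<Longrightarrow> f s \<in> normal_space A g q"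
    and circ: "\<And>s. s \<in> {1..m} \<Longrightarrow> is_circle (curv_ellipse A c g s q)"
    and orient: "\<And>s X. s \<in> {1..m} \<Longrightarrow> X \<noteq> 0 \<Longrightarrow>
      0 < (fund_form A c g q (replicate (s + 1) X) \<bullet> e s) * (fund_form A c g q (cstruct c g q X # replicate s X) \<bullet> f s)
        - (fund_form A c g q (replicate (s + 1) X) \<bullet> f s) * (fund_form A c g q (cstruct c g q X # replicate s X) \<bullet> e s)"
begin

definition D :: "(real^2) list \<Rightarrow> 'a" where "D Xs = dl Xs (in_chart c g) (snd c q)"
definition Osc :: "nat \<Rightarrow> 'a set" where "Osc k = span {D Xs |Xs. length Xs \<le> k}"

lemma immersion: "sphere_immersion A g" using min unfolding minimal_surface_def by blast

sublocale patch: sphere_patch "snd c ` (UNIV \<inter> fst c)" "in_chart c g"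
  by (rule sphere_patch_chart[OF A c immersion open_UNIV])

lemma u: "snd c q \<in> snd c ` (UNIV \<inter> fst c)" using q by simp

lemma D_mset: "mset Xs = mset Ys \<Longrightarrow> D Xs = D Ys"
  unfolding D_def by (rule dl_mset[OF patch.V patch.G _ u])

lemma D_lin: "D ((a *\<^sub>R P + b *\<^sub>R Q) # Xs) = a *\<^sub>R D (P # Xs) + b *\<^sub>R D (Q # Xs)"
  unfolding D_def using patch.dd_lin[OF u] by simp

lemma subspace_Osc: "subspace (Osc k)" by (simp add: Osc_def)

lemma D_Osc: "length Xs \<le> k \<Longrightarrow> D Xs \<in> Osc k"
  unfolding Osc_def by (rule span_base) blast

lemma Osc_mono: "k \<le> l \<Longrightarrow> Osc k \<subseteq> Osc l"
  unfolding Osc_def by (rule span_mono) (auto intro: le_trans)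

lemma D_minus_iter_ff: "iter_ff A c g (X # Xs) q - D (X # Xs) \<in> Osc (length Xs)"
  using osc_span[OF osc_iter_ff[OF A c immersion open_UNIV] u, of X Xs]
  unfolding Osc_def D_def by (simp add: in_chart_at[OF A c q])

lemma plane_normal:
  assumes "t \<in> {1..m}" "w \<in> span {e t, f t}"
  shows "w \<in> patch.normal (snd c q)"
proof -
  have "e t \<in> patch.normal (snd c q)" "f t \<in> patch.normal (snd c q)"
    using nrm[OF assms(1)] normal_space_chart[OF A c immersion open_UNIV, of q] q by auto
  then have "span {e t, f t} \<subseteq> patch.normal (snd c q)"
    by (intro span_minimal patch.subspace_normal) auto
  then show ?thesis using assms(2) by blast
qed

lemma plane_orth_Nsum:
  assumes "t \<in> {1..m}" "w \<in> span {e t, f t}" "k < t" "v \<in> Nsum A c g k q"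
  shows "v \<bullet> w = 0"
proof -
  obtain t' where t': "t = Suc t'" using assms(3) by (cases t) auto
  have "v \<in> Nsum A c g t' q"
    by (rule subsetD[OF Nsum_mono assms(4)]) (use assms(3) t' in simp)
  then show ?thesis
    using curv_space_orth_Nsum[of w A c g t' q v] assms(1,2) curv[of t] t' by (simp add: inner_commute)
qed

text \<open>The osculating space of order \<open>t\<close> is spanned by position, tangent plane and the first
  \<open>t - 1\<close> normal planes.\<close>
lemma plane_orth_D:
  assumes t: "t \<in> {1..m}" and w: "w \<in> span {e t, f t}"
  shows "length Xs \<le> t \<Longrightarrow> D Xs \<bullet> w = 0"
proof (induction Xs rule: length_induct)
  case (1 Xs)
  have nw: "w \<bullet> in_chart c g (snd c q) = 0" "w \<bullet> dd X (in_chart c g) (snd c q) = 0" for X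
    using plane_normal[OF t w] unfolding patch.normal_def by auto
  show ?case
  proof (cases Xs rule: remdups_adj.cases)
    case 1
    then show ?thesis using nw(1) by (simp add: D_def inner_commute)
  next
    case (2 X)
    then show ?thesis using nw(2)[of X] by (simp add: D_def inner_commute)
  next
    case (3 X Y Ys)
    let ?I = "iter_ff A c g (X # Y # Ys) q"
    have "?I - D (X # Y # Ys) \<in> Osc (length (Y # Ys))" by (rule D_minus_iter_ff)
    then have "(?I - D (X # Y # Ys)) \<bullet> w = 0"
      unfolding Osc_def by (rule inner_span_zero) (use 1 3 in auto)
    moreover have "?I \<bullet> w = 0"
      by (rule plane_orth_Nsum[OF t w _ iter_ff_in_Nsum[of _ "length Ys"]]) (use 1(2) 3 in auto)
    ultimately show ?thesis by (simp add: 3 inner_diff_left)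
  qed
qed

lemma plane_orth_Osc:
  assumes t: "t \<in> {1..m}" and w: "w \<in> span {e t, f t}" and x: "x \<in> Osc k" "k \<le> t"
  shows "x \<bullet> w = 0"
  using x(1) unfolding Osc_def
  by (rule inner_span_zero) (use plane_orth_D[OF t w] x(2) in auto)

text \<open>The iterated normal derivative differs from the partial derivative by terms of order \<open>s\<close>, which are
  orthogonal to the \<open>s\<close>-th plane.\<close>
lemma fund_form_inner:
  assumes s: "s \<in> {1..m}" and w: "w \<in> span {e s, f s}" and l: "length Xs = s + 1"
  shows "fund_form A c g q Xs \<bullet> w = D Xs \<bullet> w"
proof -
  let ?I = "iter_ff A c g (rev Xs) q"
  have s1: "s \<ge> 1" using s by simp
  obtain Y Ys where Y: "rev Xs = Y # Ys" using l by (cases "rev Xs") auto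
  have lY: "length Ys = s" using arg_cong[OF Y, of length] l by simp
  have "(?I - D (rev Xs)) \<bullet> w = 0"
    using plane_orth_Osc[OF s w, of _ s] D_minus_iter_ff[of Y Ys] unfolding Y lY by blast
  moreover have "D (rev Xs) = D Xs" by (rule D_mset) simp
  moreover have "oproj (Nsum A c g (s - 1) q) ?I \<bullet> w = 0"
    by (rule plane_orth_Nsum[OF s w _ oproj_in[OF subspace_Nsum]]) (use s1 in simp)
  moreover have "fund_form A c g q Xs = ?I - oproj (Nsum A c g (s - 1) q) ?I"
    using l s1 by (simp add: fund_form_def)
  ultimately show ?thesis
    by (simp add: inner_diff_left)
qed

definition P :: "nat \<Rightarrow> 'a \<Rightarrow> 'a" where "P s v = (v \<bullet> e s) *\<^sub>R e s + (v \<bullet> f s) *\<^sub>R f s"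

lemma fund_form_eq:
  assumes s: "s \<in> {1..m}" and l: "length Xs = s + 1"
  shows "fund_form A c g q Xs = P s (D Xs)"
proof -
  have "fund_form A c g q Xs \<in> curv_space A c g s q"
    unfolding curv_space_def by (rule span_base) (use l in auto)
  then have "fund_form A c g q Xs = P s (fund_form A c g q Xs)"
    using span_pair_coords[OF ons[OF s]] curv[OF s] unfolding P_def by simp
  also have "\<dots> = P s (D Xs)"
    unfolding P_def using fund_form_inner[OF s _ l] by (simp add: span_base)
  finally show ?thesis .
qed

lemma Nsum_Osc: "Nsum A c g k q \<subseteq> Osc (k + 1)"
proof (induction k)
  case 0
  then show ?case using subspace_0[OF subspace_Osc] by simp
next
  case (Suc k)
  have up: "Nsum A c g k q \<subseteq> Osc (Suc k + 1)" using Suc Osc_mono[of "k + 1" "Suc k + 1"] by auto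
  have "iter_ff A c g (rev Xs) q - oproj (Nsum A c g k q) (iter_ff A c g (rev Xs) q) \<in> Osc (Suc k + 1)"
    if l: "length Xs = k + 2" for Xs
  proof -
    obtain Y Ys where Y: "rev Xs = Y # Ys" using l by (cases "rev Xs") auto
    have lY: "length Ys = k + 1" using arg_cong[OF Y, of length] l by simp
    have "iter_ff A c g (Y # Ys) q - D (Y # Ys) \<in> Osc (Suc k + 1)"
      using D_minus_iter_ff[of Y Ys] Osc_mono[of "length Ys" "Suc k + 1"] lY by auto
    then have "(iter_ff A c g (Y # Ys) q - D (Y # Ys)) + D (Y # Ys) \<in> Osc (Suc k + 1)"
      by (rule subspace_add[OF subspace_Osc _ D_Osc]) (use lY in simp)
    then have "iter_ff A c g (rev Xs) q \<in> Osc (Suc k + 1)" by (simp add: Y)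
    then show ?thesis
      by (rule subspace_diff[OF subspace_Osc _ subsetD[OF up oproj_in[OF subspace_Nsum]]])
  qed
  then have "Nsum A c g k q \<union> {iter_ff A c g (rev Xs) q - oproj (Nsum A c g k q) (iter_ff A c g (rev Xs) q) |Xs.
        length Xs = k + 2} \<subseteq> Osc (Suc k + 1)" using up by blast
  then show ?case unfolding Nsum.simps by (rule span_minimal[OF _ subspace_Osc])
qed

lemma D_minus_P:
  assumes s: "s \<in> {1..m}" and l: "length Xs = s + 1"
  shows "D Xs - P s (D Xs) \<in> Osc s"
proof -
  let ?I = "iter_ff A c g (rev Xs) q"
  have s1: "s \<ge> 1" using s by simp
  obtain Y Ys where Y: "rev Xs = Y # Ys" using l by (cases "rev Xs") auto
  have lY: "length Ys = s" using arg_cong[OF Y, of length] l by simp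
  have "oproj (Nsum A c g (s - 1) q) ?I \<in> Osc s"
    using Nsum_Osc[of "s - 1"] oproj_in[OF subspace_Nsum, of A c g "s - 1" q ?I] s1 by auto
  moreover have "?I - D (rev Xs) \<in> Osc s" using D_minus_iter_ff[of Y Ys] unfolding Y lY .
  ultimately have "oproj (Nsum A c g (s - 1) q) ?I - (?I - D (rev Xs)) \<in> Osc s"
    by (rule subspace_diff[OF subspace_Osc])
  moreover have "D (rev Xs) = D Xs" by (rule D_mset) simp
  moreover have "P s (D Xs) = ?I - oproj (Nsum A c g (s - 1) q) ?I"
    using l s1 by (simp add: fund_form_def flip: fund_form_eq[OF s l])
  then have "D Xs - P s (D Xs) = oproj (Nsum A c g (s - 1) q) ?I - (?I - D Xs)" by simp
  ultimately show ?thesis by metis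
qed

lemma cstruct_patch:
  assumes "X \<noteq> 0"
  shows "dd X (in_chart c g) (snd c q) \<bullet> dd (cstruct c g q X) (in_chart c g) (snd c q) = 0"
    "dd X (in_chart c g) (snd c q) \<bullet> dd X (in_chart c g) (snd c q) =
      dd (cstruct c g q X) (in_chart c g) (snd c q) \<bullet> dd (cstruct c g q X) (in_chart c g) (snd c q)"
  using cstruct_facts(1,2)[OF A c immersion q assms] by (simp_all add: dmap_eq_dd)

text \<open>The trace drops to order \<open>s\<close>, and all derivatives of order \<open>s\<close> are orthogonal to the \<open>s\<close>-th plane.\<close>
lemma trace_orth_plane:
  assumes s: "s \<in> {1..m}" and w: "w \<in> span {e s, f s}" and X: "X \<noteq> 0" and l: "length Xs + 1 = s"
  defines "Y \<equiv> cstruct c g q X"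
  shows "D (Y # Y # Xs) \<bullet> w = - (D (X # X # Xs) \<bullet> w)"
proof -
  have "D (X # X # Xs) + D (Y # Y # Xs) \<in> Osc (length Xs + 1)"
    unfolding D_def Osc_def
  proof (rule patch.trace_drops_order[OF _ u X])
    fix v X Y assume v: "v \<in> snd c ` (UNIV \<inter> fst c)"
      and o: "dd X (in_chart c g) v \<bullet> dd X (in_chart c g) v = 1"
        "dd Y (in_chart c g) v \<bullet> dd Y (in_chart c g) v = 1" "dd X (in_chart c g) v \<bullet> dd Y (in_chart c g) v = 0"
    obtain p where p: "p \<in> fst c" "v = snd c p" using v by blast
    have nc: "second_ff A c g p X Y = patch.nproj v (dl [X, Y] (in_chart c g) v)" for X Y
      using second_ff_chart[OF A c immersion p(1)] unfolding p(2) .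
    have "second_ff A c g p X X + second_ff A c g p Y Y = 0"
      using min c p(1) o unfolding minimal_surface_def p(2) by (simp add: dmap_eq_dd norm_eq_1)
    then show "patch.nproj v (dl [X, X] (in_chart c g) v) + patch.nproj v (dl [Y, Y] (in_chart c g) v) = 0"
      unfolding nc .
  qed (use cstruct_patch[OF X] in \<open>simp_all add: Y_def\<close>)
  then have "(D (X # X # Xs) + D (Y # Y # Xs)) \<bullet> w = 0" by (rule plane_orth_Osc[OF s w]) (use l in simp)
  then show ?thesis by (simp add: inner_add_left)
qed

text \<open>Circularity of the ellipses in terms of partial derivatives: applying the complex structure
  to one argument turns the normal component by a right angle.\<close>
lemma quarter_turn_forms:
  assumes s: "s \<in> {1..m}" and X: "X \<noteq> 0"
  defines "Y \<equiv> cstruct c g q X"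
  shows "D (Y # replicate s X) \<bullet> e s = - (D (replicate (Suc s) X) \<bullet> f s)"
    "D (Y # replicate s X) \<bullet> f s = D (replicate (Suc s) X) \<bullet> e s"
    "D (replicate (Suc s) X) \<bullet> e s \<noteq> 0 \<or> D (replicate (Suc s) X) \<bullet> f s \<noteq> 0"
proof -
  define F where "F Xs = P s (D Xs)" for Xs
  define a where "a = F (replicate (Suc s) X)"
  define b where "b = F (Y # replicate s X)"
  have perm: "F Xs = F Ys" if "mset Xs = mset Ys" for Xs Ys
    unfolding F_def using D_mset[OF that] by simp
  have lin: "F ((x *\<^sub>R X1 + y *\<^sub>R X2) # Xs) = x *\<^sub>R F (X1 # Xs) + y *\<^sub>R F (X2 # Xs)" for x y X1 X2 Xs
    unfolding F_def P_def D_lin by (simp add: inner_add_left algebra_simps)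
  have trace: "F (Y # Y # Xs) = - F (X # X # Xs)" if "length Xs + 2 = Suc s" for Xs
    unfolding F_def P_def Y_def using that trace_orth_plane[OF s _ X, of _ Xs] by (simp add: span_base)
  define len where "len = norm (dmap c g q X)"
  have len: "len > 0" using patch.dd_nonzero[OF u X] by (simp add: len_def dmap_eq_dd)
  define \<rho> where "\<rho> = inverse len ^ Suc s"
  have \<rho>: "\<rho> > 0" using len by (simp add: \<rho>_def)
  have mem: "cos \<tau> *\<^sub>R (\<rho> *\<^sub>R a) + sin \<tau> *\<^sub>R (\<rho> *\<^sub>R b) \<in> curv_ellipse A c g s q" for \<tau>
  proof -
    \<comment> \<open>The ellipse is run through \<open>s + 1\<close> times as fast as the unit circle.\<close>
    define t where "t = \<tau> / real (Suc s)"
    define Z where "Z = cos t *\<^sub>R X + sin t *\<^sub>R Y"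
    have \<tau>: "real (Suc s) * t = \<tau>" by (simp add: t_def)
    let ?x = "dd X (in_chart c g) (snd c q)" and ?y = "dd Y (in_chart c g) (snd c q)"
    have xy: "?x \<bullet> ?y = 0" "?y \<bullet> ?x = 0" "?y \<bullet> ?y = ?x \<bullet> ?x"
      using cstruct_patch[OF X] by (simp_all add: Y_def inner_commute)
    have "dmap c g q Z \<bullet> dmap c g q Z = cos t * cos t * (?x \<bullet> ?x) + sin t * sin t * (?x \<bullet> ?x)"
      unfolding dmap_eq_dd Z_def patch.dd_lin0[OF u] inner_add_left inner_add_right inner_scaleR_left
        inner_scaleR_right xy by simp
    also have "\<dots> = ((cos t)\<^sup>2 + (sin t)\<^sup>2) * (?x \<bullet> ?x)"
      by (simp only: power2_eq_square distrib_right)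
    finally have "norm (dmap c g q Z) = len"
      by (simp add: len_def norm_eq_sqrt_inner dmap_eq_dd)
    then have "norm (dmap c g q (inverse len *\<^sub>R Z)) = 1"
      using len by (simp add: dmap_eq_dd dd_scale_arg[OF patch.diffG[OF u]])
    then have "fund_form A c g q (replicate (s + 1) (inverse len *\<^sub>R Z)) \<in> curv_ellipse A c g s q"
      unfolding curv_ellipse_def by blast
    also have "fund_form A c g q (replicate (s + 1) (inverse len *\<^sub>R Z)) = F (replicate (Suc s) (inverse len *\<^sub>R Z))"
      unfolding F_def by (subst fund_form_eq[OF s]) simp_all
    also have "\<dots> = \<rho> *\<^sub>R F (replicate (Suc s) Z)"
      unfolding \<rho>_def by (rule symmetric_form_scale) (use perm lin in blast)+
    also have "F (replicate (Suc s) Z) = cos (real (Suc s) * t) *\<^sub>R a + sin (real (Suc s) * t) *\<^sub>R b"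
      unfolding Z_def a_def b_def
      by (rule traceless_form_rotation[where F = F]) (use perm lin trace in \<open>blast | simp\<close>)+
    finally show ?thesis unfolding \<tau> by (simp add: scaleR_add_right mult.commute)
  qed
  note cd = circle_conjugate_diameters[OF circ[OF s] mem]
  have ab: "a \<bullet> a = b \<bullet> b" "a \<bullet> b = 0" using cd \<rho> by simp_all
  note o = ons[OF s]
  have fe: "f s \<bullet> e s = 0" using o(3) by (simp add: inner_commute)
  define a1 a2 b1 b2 where "a1 = D (replicate (Suc s) X) \<bullet> e s" and "a2 = D (replicate (Suc s) X) \<bullet> f s"
    and "b1 = D (Y # replicate s X) \<bullet> e s" and "b2 = D (Y # replicate s X) \<bullet> f s"
  have a: "a = a1 *\<^sub>R e s + a2 *\<^sub>R f s" and b: "b = b1 *\<^sub>R e s + b2 *\<^sub>R f s"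
    by (simp_all only: a_def b_def F_def P_def a1_def a2_def b1_def b2_def)
  have sq: "a1 * a1 + a2 * a2 = b1 * b1 + b2 * b2" "a1 * b1 + a2 * b2 = 0"
    using ab unfolding a b
    by (simp_all add: inner_add_left inner_add_right o fe mult.commute[of b1 a1] mult.commute[of b2 a2])
  have fa: "fund_form A c g q (replicate (s + 1) X) = a" "fund_form A c g q (Y # replicate s X) = b"
    unfolding a_def b_def F_def by (subst fund_form_eq[OF s]; simp)+
  have pos: "0 < a1 * b2 - a2 * b1"
    using orient[OF s X, folded Y_def] unfolding fa a b by (simp add: inner_add_left o fe)
  show "D (Y # replicate s X) \<bullet> e s = - (D (replicate (Suc s) X) \<bullet> f s)"
    using quarter_turn_coords(1)[OF sq pos] by (simp only: a2_def b1_def)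
  show "D (Y # replicate s X) \<bullet> f s = D (replicate (Suc s) X) \<bullet> e s"
    using quarter_turn_coords(2)[OF sq pos] by (simp only: a1_def b2_def)
  show "D (replicate (Suc s) X) \<bullet> e s \<noteq> 0 \<or> D (replicate (Suc s) X) \<bullet> f s \<noteq> 0"
    using pos unfolding a1_def[symmetric] a2_def[symmetric] by auto
qed

text \<open>Two independent values of the fundamental form span the plane, and each of them is a partial
  derivative of order \<open>s + 1\<close> up to terms of order \<open>s\<close>.\<close>
lemma plane_in_Osc:
  assumes s: "s \<in> {1..m}"
  shows "e s \<in> Osc (s + 1)" "f s \<in> Osc (s + 1)"
proof -
  \<comment> \<open>One direction determines the plane; its choice is arbitrary.\<close>
  define X where "X = ax1"
  have X: "X \<noteq> 0" by (simp add: X_def axis_eq_0_iff)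
  define a1 a2 where "a1 = D (replicate (Suc s) X) \<bullet> e s" and "a2 = D (replicate (Suc s) X) \<bullet> f s"
  note qt = quarter_turn_forms[OF s X, folded a1_def a2_def]
  have n: "a1 * a1 + a2 * a2 \<noteq> 0" using qt(3) by (simp add: sum_squares_eq_zero_iff)
  have m: "P s (D Xs) \<in> Osc (s + 1)" if l: "length Xs = s + 1" for Xs
  proof -
    have "D Xs - P s (D Xs) \<in> Osc (s + 1)"
      by (rule subsetD[OF Osc_mono D_minus_P[OF s l]]) simp
    then have "D Xs - (D Xs - P s (D Xs)) \<in> Osc (s + 1)"
      by (rule subspace_diff[OF subspace_Osc D_Osc, rotated]) (use l in simp)
    then show ?thesis by simp
  qed
  have 1: "a1 *\<^sub>R e s + a2 *\<^sub>R f s \<in> Osc (s + 1)"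
    using m[of "replicate (Suc s) X"] by (simp add: P_def a1_def a2_def del: replicate_Suc)
  have 2: "(- a2) *\<^sub>R e s + a1 *\<^sub>R f s \<in> Osc (s + 1)"
    using m[of "cstruct c g q X # replicate s X"] by (simp add: P_def qt)
  have "inverse (a1 * a1 + a2 * a2) *\<^sub>R (a1 *\<^sub>R (a1 *\<^sub>R e s + a2 *\<^sub>R f s) + (- a2) *\<^sub>R ((- a2) *\<^sub>R e s + a1 *\<^sub>R f s)) \<in> Osc (s + 1)"
    by (intro subspace_scale[OF subspace_Osc] subspace_add[OF subspace_Osc] 1 2)
  moreover have "a1 *\<^sub>R (a1 *\<^sub>R e s + a2 *\<^sub>R f s) + (- a2) *\<^sub>R ((- a2) *\<^sub>R e s + a1 *\<^sub>R f s) = (a1 * a1 + a2 * a2) *\<^sub>R e s"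
    by (simp add: algebra_simps)
  ultimately show "e s \<in> Osc (s + 1)" using n by simp
  have "inverse (a1 * a1 + a2 * a2) *\<^sub>R (a2 *\<^sub>R (a1 *\<^sub>R e s + a2 *\<^sub>R f s) + a1 *\<^sub>R ((- a2) *\<^sub>R e s + a1 *\<^sub>R f s)) \<in> Osc (s + 1)"
    by (intro subspace_scale[OF subspace_Osc] subspace_add[OF subspace_Osc] 1 2)
  moreover have "a2 *\<^sub>R (a1 *\<^sub>R e s + a2 *\<^sub>R f s) + a1 *\<^sub>R ((- a2) *\<^sub>R e s + a1 *\<^sub>R f s) = (a1 * a1 + a2 * a2) *\<^sub>R f s"
    by (simp add: algebra_simps)
  ultimately show "f s \<in> Osc (s + 1)" using n by simp
qed

text \<open>For \<open>Z = X\<close> this is the circularity of the first ellipse, for \<open>Z = J X\<close> it follows with the vanishing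
  trace.\<close>
lemma second_order_turn:
  assumes "1 \<le> m" and X: "X \<noteq> 0"
  shows "D [cstruct c g q X, Z] \<bullet> e 1 = - (D [X, Z] \<bullet> f 1)"
    "D [cstruct c g q X, Z] \<bullet> f 1 = D [X, Z] \<bullet> e 1"
proof -
  have s: "(1::nat) \<in> {1..m}" using assms(1) by simp
  define Y where "Y = cstruct c g q X"
  obtain \<alpha> \<beta> where Z: "Z = \<alpha> *\<^sub>R X + \<beta> *\<^sub>R Y"
    using cramer[OF cstruct_facts(3)[OF A c immersion q X], folded Y_def] by blast
  have lin: "D [T, Z] = \<alpha> *\<^sub>R D [T, X] + \<beta> *\<^sub>R D [T, Y]" for T
  proof -
    have "D [T, Z] = D [Z, T]" by (rule D_mset) simp
    also have "\<dots> = \<alpha> *\<^sub>R D [X, T] + \<beta> *\<^sub>R D [Y, T]" unfolding Z by (rule D_lin)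
    also have "D [X, T] = D [T, X]" by (rule D_mset) simp
    also have "D [Y, T] = D [T, Y]" by (rule D_mset) simp
    finally show ?thesis .
  qed
  have sy: "D [X, Y] = D [Y, X]" by (rule D_mset) simp
  have q1: "D [Y, X] \<bullet> e 1 = - (D [X, X] \<bullet> f 1)" "D [Y, X] \<bullet> f 1 = D [X, X] \<bullet> e 1"
    using quarter_turn_forms(1,2)[OF s X, folded Y_def] by (simp_all add: numeral_2_eq_2)
  have q2: "D [Y, Y] \<bullet> e 1 = - (D [X, X] \<bullet> e 1)" "D [Y, Y] \<bullet> f 1 = - (D [X, X] \<bullet> f 1)"
    using trace_orth_plane[OF s _ X, of _ "[]", folded Y_def] by (simp_all add: span_base)
  show "D [cstruct c g q X, Z] \<bullet> e 1 = - (D [X, Z] \<bullet> f 1)" "D [cstruct c g q X, Z] \<bullet> f 1 = D [X, Z] \<bullet> e 1"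
    unfolding Y_def[symmetric] lin inner_add_left inner_scaleR_left sy q1 q2 by simp_all
qed

end

context adapted_point
begin

lemma planes_orth:
  assumes s: "s \<in> {1..m}" and t: "t \<in> {1..m}" and st: "s < t"
    and w: "w \<in> span {e t, f t}"
  shows "e s \<bullet> w = 0" "f s \<bullet> w = 0"
  using plane_orth_Osc[OF t w plane_in_Osc(1)[OF s]] plane_orth_Osc[OF t w plane_in_Osc(2)[OF s]] st
  by simp_all

lemma distinct_planes_orth:
  assumes s: "s \<in> {1..m}" and t: "t \<in> {1..m}" and st: "s \<noteq> t"
  shows "e s \<bullet> e t = 0" "e s \<bullet> f t = 0" "f s \<bullet> e t = 0" "f s \<bullet> f t = 0"
proof -
  consider "s < t" | "t < s" using st by linarith
  then have "e s \<bullet> e t = 0 \<and> e s \<bullet> f t = 0 \<and> f s \<bullet> e t = 0 \<and> f s \<bullet> f t = 0"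
  proof cases
    case 1
    then show ?thesis using planes_orth[OF s t 1] by (simp add: span_base)
  next
    case 2
    then show ?thesis using planes_orth[OF t s 2, of "e s"] planes_orth[OF t s 2, of "f s"]
      by (simp add: span_base inner_commute[of "e s"] inner_commute[of "f s"])
  qed
  then show "e s \<bullet> e t = 0" "e s \<bullet> f t = 0" "f s \<bullet> e t = 0" "f s \<bullet> f t = 0" by blast+
qed

end


section \<open>The normal connection commutes with the quarter turn\<close>

text \<open>A section \<open>\<nu>\<close> of the \<open>t\<close>-th normal plane is orthogonal to all derivatives of order at most
  \<open>t\<close>, so the derivative of \<open>\<nu>\<close> is paired with those by the derivatives of order one more. The
  pairing vanishes unless the planes are neighbours, and between neighbouring planes it is the
  fundamental form, which turns with the quarter turn.\<close>
lemma connection_turn_less: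
  fixes g :: "'l::{t2_space,second_countable_topology} \<Rightarrow> 'a::euclidean_space" and E \<Phi> :: "nat \<Rightarrow> real^2 \<Rightarrow> 'a"
  assumes V: "open V" and v: "v \<in> V"
    and ad: "\<And>w. w \<in> V \<Longrightarrow> \<exists>p. w = snd c p \<and> adapted_point A c g p m (\<lambda>s. E s w) (\<lambda>s. \<Phi> s w)"
    and sm: "\<And>s. s \<in> {1..m} \<Longrightarrow> smooth_on (E s) V" "\<And>s. s \<in> {1..m} \<Longrightarrow> smooth_on (\<Phi> s) V"
    and s: "s \<in> {1..m}" and t: "t \<in> {1..m}" and st: "s < t"
  shows "E s v \<bullet> dd Z (E t) v = \<Phi> s v \<bullet> dd Z (\<Phi> t) v \<and> \<Phi> s v \<bullet> dd Z (E t) v = - (E s v \<bullet> dd Z (\<Phi> t) v)"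
proof -
  obtain p where vp: "v = snd c p" and adp: "adapted_point A c g p m (\<lambda>s. E s v) (\<lambda>s. \<Phi> s v)"
    using ad[OF v] by blast
  interpret adapted_point A c g p m "\<lambda>s. E s v" "\<lambda>s. \<Phi> s v" by (rule adp)
  have Gs: "smooth_on (dl Xs (in_chart c g)) (V \<inter> snd c ` (UNIV \<inter> fst c))" for Xs
    by (rule smooth_on_subset[OF patch.smooth_dl]) (use V patch.V in auto)
  have V': "open (V \<inter> snd c ` (UNIV \<inter> fst c))" and v': "v \<in> V \<inter> snd c ` (UNIV \<inter> fst c)"
    using V patch.V v u vp by auto
  have pair: "D Xs \<bullet> dd Z \<nu> v = - (D (Z # Xs) \<bullet> \<nu> v)"
    if \<nu>: "smooth_on \<nu> V" "\<And>w. w \<in> V \<Longrightarrow> \<nu> w \<in> span {E t w, \<Phi> t w}" and l: "length Xs \<le> t" for \<nu> Xs Z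
  proof -
    note dG = smooth_on_differentiable[OF Gs V' v'] and d\<nu> = smooth_on_differentiable[OF \<nu>(1) V v]
    have "dd Z (\<lambda>w. dl Xs (in_chart c g) w \<bullet> \<nu> w) v = dd Z (\<lambda>w. 0) v"
    proof (rule dd_cong[OF V v])
      fix w assume w: "w \<in> V"
      obtain p' where w': "w = snd c p'" and adp': "adapted_point A c g p' m (\<lambda>s. E s w) (\<lambda>s. \<Phi> s w)"
        using ad[OF w] by blast
      show "dl Xs (in_chart c g) w \<bullet> \<nu> w = 0"
        using adapted_point.plane_orth_D[OF adp' t \<nu>(2)[OF w] l] adapted_point.D_def[OF adp', of Xs] w' by simp
    qed
    then have "dl Xs (in_chart c g) v \<bullet> dd Z \<nu> v + dd Z (dl Xs (in_chart c g)) v \<bullet> \<nu> v = 0"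
      using dd_inner[OF dG[of Xs] d\<nu>, of Z] by (simp add: dd_const)
    then show ?thesis unfolding D_def vp[symmetric] by simp
  qed
  have low: "x \<bullet> dd Z \<nu> v = 0"
    if \<nu>: "smooth_on \<nu> V" "\<And>w. w \<in> V \<Longrightarrow> \<nu> w \<in> span {E t w, \<Phi> t w}" and x: "x \<in> Osc k" "k < t" for \<nu> x k Z
    using x(1) unfolding Osc_def
  proof (rule inner_span_zero)
    fix y assume "y \<in> {D Xs |Xs. length Xs \<le> k}"
    then obtain Xs where y: "y = D Xs" "length Xs \<le> k" by blast
    show "y \<bullet> dd Z \<nu> v = 0"
      unfolding y(1) using pair[OF \<nu>, of Xs Z] plane_orth_D[OF t \<nu>(2)[OF v], of "Z # Xs"] y(2) x(2) by simp
  qed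
  have \<nu>E: "smooth_on (E t) V" "\<And>w. w \<in> V \<Longrightarrow> E t w \<in> span {E t w, \<Phi> t w}"
    and \<nu>\<Phi>: "smooth_on (\<Phi> t) V" "\<And>w. w \<in> V \<Longrightarrow> \<Phi> t w \<in> span {E t w, \<Phi> t w}"
    using sm t by (auto intro: span_base)
  show ?thesis
  proof (cases "Suc s = t")
    case False
    then have "s + 1 < t" using st by simp
    then show ?thesis using low[OF \<nu>E] low[OF \<nu>\<Phi>] plane_in_Osc[OF s] by simp
  next
    case True
    define X where "X = ax1"
    define Y where "Y = cstruct c g p X"
    have X: "X \<noteq> 0" by (simp add: X_def axis_eq_0_iff)
    define a1 a2 where "a1 = D (replicate t X) \<bullet> E s v" and "a2 = D (replicate t X) \<bullet> \<Phi> s v"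
    define A1 A2 where "A1 = D (X # replicate t X) \<bullet> E t v" and "A2 = D (X # replicate t X) \<bullet> \<Phi> t v"
    note qs = quarter_turn_forms[OF s X, folded Y_def, unfolded True, folded a1_def a2_def]
    have qt: "D (Y # replicate t X) \<bullet> E t v = - A2" "D (Y # replicate t X) \<bullet> \<Phi> t v = A1"
      using quarter_turn_forms(1,2)[OF t X, folded Y_def] by (simp_all add: A1_def A2_def)
    have XY: "D (X # Y # replicate s X) = D (Y # replicate t X)"
      by (rule D_mset) (simp flip: True)
    have YY: "D (Y # Y # replicate s X) \<bullet> w = - (D (X # replicate t X) \<bullet> w)" if "w \<in> span {E t v, \<Phi> t v}" for w
      using trace_orth_plane[OF t that X, of "replicate s X"] by (simp add: Y_def flip: True)
    define x where "x Z = E s v \<bullet> dd Z (E t) v - \<Phi> s v \<bullet> dd Z (\<Phi> t) v" for Z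
    define y where "y Z = \<Phi> s v \<bullet> dd Z (E t) v + E s v \<bullet> dd Z (\<Phi> t) v" for Z
    have P: "P s w \<bullet> dd Z \<nu> v = (w \<bullet> E s v) * (E s v \<bullet> dd Z \<nu> v) + (w \<bullet> \<Phi> s v) * (\<Phi> s v \<bullet> dd Z \<nu> v)" for w Z \<nu>
      by (simp add: P_def inner_add_left)
    \<comment> \<open>The fundamental form and the partial derivative differ by terms of order \<open>s\<close>, whose pairing with the
      derivative of \<open>\<nu>\<close> vanishes.\<close>
    have main: "(D Xs \<bullet> E s v) * (E s v \<bullet> dd Z \<nu> v) + (D Xs \<bullet> \<Phi> s v) * (\<Phi> s v \<bullet> dd Z \<nu> v) = - (D (Z # Xs) \<bullet> \<nu> v)"
      if \<nu>: "smooth_on \<nu> V" "\<And>w. w \<in> V \<Longrightarrow> \<nu> w \<in> span {E t w, \<Phi> t w}" and l: "length Xs = t" for \<nu> Xs Z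
    proof -
      have lX: "length Xs = s + 1" using l True by simp
      have "(D Xs - P s (D Xs)) \<bullet> dd Z \<nu> v = 0"
        by (rule low[OF \<nu> D_minus_P[OF s lX] st])
      then show ?thesis using pair[OF \<nu>, of Xs Z] l P[of "D Xs" Z \<nu>] by (simp add: inner_diff_left)
    qed
    have l: "length (replicate t X) = t" "length (Y # replicate s X) = t" using True by simp_all
    \<comment> \<open>\<open>x Z\<close> and \<open>y Z\<close> measure how far the connection is from commuting with the quarter turn.\<close>
    have eqs: "a1 * x Z + a2 * y Z = 0" "a1 * y Z = a2 * x Z" if Z: "Z = X \<or> Z = Y" for Z
    proof -
      note m1 = main[OF \<nu>E l(1), of Z, folded a1_def a2_def] main[OF \<nu>\<Phi> l(1), of Z, folded a1_def a2_def]
      note m2 = main[OF \<nu>E l(2), of Z, unfolded qs(1,2)] main[OF \<nu>\<Phi> l(2), of Z, unfolded qs(1,2)]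
      have in_plane: "E t v \<in> span {E t v, \<Phi> t v}" "\<Phi> t v \<in> span {E t v, \<Phi> t v}"
        by (simp_all add: span_base)
      have r: "D (Z # replicate t X) \<bullet> E t v = D (Z # Y # replicate s X) \<bullet> \<Phi> t v \<and>
          D (Z # replicate t X) \<bullet> \<Phi> t v = - (D (Z # Y # replicate s X) \<bullet> E t v)"
        using Z
      proof
        assume "Z = X"
        then show ?thesis using XY qt by (simp add: A1_def A2_def)
      next
        assume "Z = Y"
        then show ?thesis using YY[OF in_plane(1)] YY[OF in_plane(2)] qt by (simp add: A1_def A2_def)
      qed
      show "a1 * x Z + a2 * y Z = 0" "a1 * y Z = a2 * x Z"
        using m1 m2 r unfolding x_def y_def by (simp_all add: algebra_simps)
    qed
    have zero: "x Z = 0 \<and> y Z = 0" if "Z = X \<or> Z = Y" for Z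
      using rotation_kernel[OF eqs[OF that]] qs(3) by blast
    obtain \<alpha> \<beta> where Z: "Z = \<alpha> *\<^sub>R X + \<beta> *\<^sub>R Y"
      using cramer[OF cstruct_facts(3)[OF A c immersion q X], folded Y_def] by blast
    have lin: "dd Z \<nu> v = \<alpha> *\<^sub>R dd X \<nu> v + \<beta> *\<^sub>R dd Y \<nu> v" if "smooth_on \<nu> V" for \<nu> :: "real^2 \<Rightarrow> 'a"
      unfolding Z using smooth_on_differentiable[OF that V v] by (simp add: dd_add_arg dd_scale_arg)
    have "x Z = \<alpha> * x X + \<beta> * x Y" "y Z = \<alpha> * y X + \<beta> * y Y"
      unfolding x_def y_def lin[OF \<nu>E(1)] lin[OF \<nu>\<Phi>(1)] by (simp_all add: inner_add_right algebra_simps)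
    then have "x Z = 0" "y Z = 0" using zero by simp_all
    then show ?thesis by (simp add: x_def y_def)
  qed
qed

lemma inner_const_deriv_skew:
  assumes V: "open V" and v: "v \<in> V" and "smooth_on a V" "smooth_on b V"
    and c: "\<And>w. w \<in> V \<Longrightarrow> a w \<bullet> b w = k"
  shows "a v \<bullet> dd Z b v = - (dd Z a v \<bullet> b v)"
proof -
  have "dd Z (\<lambda>w. a w \<bullet> b w) v = dd Z (\<lambda>w. k) v" by (rule dd_cong[OF V v c])
  then show ?thesis
    using dd_inner[OF smooth_on_differentiable[OF assms(3) V v] smooth_on_differentiable[OF assms(4) V v], of Z]
    by (simp add: dd_const)
qed

text \<open>For \<open>t < s\<close> the statement follows from the case \<open>s < t\<close>, since the connection is metric.\<close>
lemma connection_turn: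
  fixes g :: "'l::{t2_space,second_countable_topology} \<Rightarrow> 'a::euclidean_space" and E \<Phi> :: "nat \<Rightarrow> real^2 \<Rightarrow> 'a"
  assumes V: "open V" and v: "v \<in> V"
    and ad: "\<And>w. w \<in> V \<Longrightarrow> \<exists>p. w = snd c p \<and> adapted_point A c g p m (\<lambda>s. E s w) (\<lambda>s. \<Phi> s w)"
    and sm: "\<And>s. s \<in> {1..m} \<Longrightarrow> smooth_on (E s) V" "\<And>s. s \<in> {1..m} \<Longrightarrow> smooth_on (\<Phi> s) V"
    and s: "s \<in> {1..m}" and t: "t \<in> {1..m}" and st: "s \<noteq> t"
  shows "dd Z (E s) v \<bullet> E t v = dd Z (\<Phi> s) v \<bullet> \<Phi> t v" "dd Z (\<Phi> s) v \<bullet> E t v = - (dd Z (E s) v \<bullet> \<Phi> t v)"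
proof -
  have orth: "E s w \<bullet> E t w = 0 \<and> E s w \<bullet> \<Phi> t w = 0 \<and> \<Phi> s w \<bullet> E t w = 0 \<and> \<Phi> s w \<bullet> \<Phi> t w = 0" 
    if w: "w \<in> V" for w
  proof -
    obtain p where adp: "adapted_point A c g p m (\<lambda>s. E s w) (\<lambda>s. \<Phi> s w)" using ad[OF w] by blast
    show ?thesis using adapted_point.distinct_planes_orth[OF adp s t st] by blast
  qed
  note sk = inner_const_deriv_skew[OF V v, where k = 0]
  have sk4: "E s v \<bullet> dd Z (E t) v = - (dd Z (E s) v \<bullet> E t v)" "E s v \<bullet> dd Z (\<Phi> t) v = - (dd Z (E s) v \<bullet> \<Phi> t v)"
    "\<Phi> s v \<bullet> dd Z (E t) v = - (dd Z (\<Phi> s) v \<bullet> E t v)" "\<Phi> s v \<bullet> dd Z (\<Phi> t) v = - (dd Z (\<Phi> s) v \<bullet> \<Phi> t v)"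
    using orth by (intro sk sm s t; blast)+
  show "dd Z (E s) v \<bullet> E t v = dd Z (\<Phi> s) v \<bullet> \<Phi> t v" "dd Z (\<Phi> s) v \<bullet> E t v = - (dd Z (E s) v \<bullet> \<Phi> t v)"
  proof (atomize(full), cases "s < t")
    case True
    show "dd Z (E s) v \<bullet> E t v = dd Z (\<Phi> s) v \<bullet> \<Phi> t v \<and> dd Z (\<Phi> s) v \<bullet> E t v = - (dd Z (E s) v \<bullet> \<Phi> t v)"
      using connection_turn_less[OF V v ad sm s t True, of Z] sk4 by linarith
  next
    case False
    then have "t < s" using st by simp
    then show "dd Z (E s) v \<bullet> E t v = dd Z (\<Phi> s) v \<bullet> \<Phi> t v \<and> dd Z (\<Phi> s) v \<bullet> E t v = - (dd Z (E s) v \<bullet> \<Phi> t v)"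
      using connection_turn_less[OF V v ad sm t s, of Z] by (simp add: inner_commute)
  qed
qed


section \<open>Rigidity of orthonormal moving frames\<close>

text \<open>This lemma transfers relations from the dense set of regular points to all points.\<close>
lemma continuous_zero_dense:
  fixes F :: "real^2 \<Rightarrow> 'b::real_normed_vector"
  assumes V: "open V" and F: "continuous_on V F" and dense: "V \<subseteq> closure V0"
    and 0: "\<And>w. w \<in> V0 \<Longrightarrow> w \<in> V \<Longrightarrow> F w = 0" and v: "v \<in> V"
  shows "F v = 0"
proof (rule ccontr)
  assume n: "F v \<noteq> 0"
  have "open (F -` (- {0}) \<inter> V)"
    using F V by (subst (asm) continuous_on_open_vimage) auto
  moreover have "v \<in> F -` (- {0}) \<inter> V" using n v by simp
  ultimately obtain w where "w \<in> V0" "w \<in> F -` (- {0}) \<inter> V"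
    using dense v closure_iff_nhds_not_empty[of v V0] by blast
  then show False using 0[of w] by simp
qed

lemma orthonormal_expansion:
  fixes E :: "'i \<Rightarrow> 'a::euclidean_space"
  assumes I: "finite I" "card I = DIM('a)"
    and on: "\<And>i j. i \<in> I \<Longrightarrow> j \<in> I \<Longrightarrow> E i \<bullet> E j = (if i = j then 1 else 0)"
  shows "(\<Sum>i\<in>I. (x \<bullet> E i) *\<^sub>R E i) = x"
proof -
  have inj: "inj_on E I"
  proof (rule inj_onI)
    fix i j assume ij: "i \<in> I" "j \<in> I" "E i = E j"
    then have "E i \<bullet> E j = 1" using on[of i i] by simp
    then show "i = j" using on[OF ij(1,2)] by (simp split: if_splits)
  qed
  have "pairwise orthogonal (E ` I)"
    unfolding pairwise_def orthogonal_def using on by auto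
  moreover have "0 \<notin> E ` I" using on by force
  ultimately have ind: "independent (E ` I)" by (rule pairwise_orthogonal_independent)
  have "dim (E ` I) = DIM('a)"
    using dim_eq_card_independent[OF ind] card_image[OF inj] I by simp
  then have full: "span (E ` I) = UNIV" by (simp add: dim_eq_full)
  define r where "r = x - (\<Sum>i\<in>I. (x \<bullet> E i) *\<^sub>R E i)"
  have "E j \<bullet> r = 0" if j: "j \<in> I" for j
  proof -
    have "(\<Sum>i\<in>I. (x \<bullet> E i) * (E j \<bullet> E i)) = (\<Sum>i\<in>I. if i = j then x \<bullet> E j else 0)"
      by (rule sum.cong) (use on[OF j] in auto)
    also have "\<dots> = x \<bullet> E j" using I(1) j by simp
    finally show ?thesis
      by (simp add: r_def inner_diff_right inner_sum_right inner_commute[of x])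
  qed
  then have "r \<bullet> r = 0" using inner_span_zero[of r "E ` I" r] full by auto
  then show ?thesis by (simp add: r_def)
qed

lemma smooth_on_sum:
  assumes "open V" "finite I" "\<And>i. i \<in> I \<Longrightarrow> smooth_on (F i) V"
  shows "smooth_on (\<lambda>v. \<Sum>i\<in>I. F i v) V"
  using assms(2,3)
proof (induction I rule: finite_induct)
  case empty
  then show ?case by (simp add: smooth_on_const assms(1))
next
  case (insert i I)
  then show ?case using smooth_on_add[OF _ _ assms(1), of "F i"] by simp
qed

lemma dd_sum:
  assumes V: "open V" and v: "v \<in> V" and "finite I" "\<And>i. i \<in> I \<Longrightarrow> smooth_on (F i) V"
  shows "dd Z (\<lambda>v. \<Sum>i\<in>I. F i v) v = (\<Sum>i\<in>I. dd Z (F i) v)"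
  using assms(3,4)
proof (induction I rule: finite_induct)
  case empty
  then show ?case by (simp add: dd_const)
next
  case (insert i I)
  have "dd Z (\<lambda>v. F i v + (\<Sum>i\<in>I. F i v)) v = dd Z (F i) v + dd Z (\<lambda>v. \<Sum>i\<in>I. F i v) v"
    by (rule dd_add[OF smooth_on_differentiable[OF _ V v] smooth_on_differentiable[OF smooth_on_sum V v]])
      (use insert V in auto)
  then show ?case using insert by simp
qed

text \<open>The orthogonal map that carries one frame to the other has the derivative \<open>0\<close> as soon as both
  frames satisfy the same linear system. It is enough to know this on a dense set, because the
  derivative is continuous.\<close>
lemma equal_connection_forms_rigid:
  fixes E E' :: "'i \<Rightarrow> real^2 \<Rightarrow> 'a::euclidean_space"
  assumes V: "open V" and I: "finite I" "card I = DIM('a)"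
    and sm: "\<And>i. i \<in> I \<Longrightarrow> smooth_on (E i) V" "\<And>i. i \<in> I \<Longrightarrow> smooth_on (E' i) V"
    and on: "\<And>i j v. i \<in> I \<Longrightarrow> j \<in> I \<Longrightarrow> v \<in> V \<Longrightarrow> E i v \<bullet> E j v = (if i = j then 1 else 0)"
    and on': "\<And>i j v. i \<in> I \<Longrightarrow> j \<in> I \<Longrightarrow> v \<in> V \<Longrightarrow> E' i v \<bullet> E' j v = (if i = j then 1 else 0)"
    and dense: "V \<subseteq> closure V0"
    and conn: "\<And>i j v Z. i \<in> I \<Longrightarrow> j \<in> I \<Longrightarrow> v \<in> V0 \<Longrightarrow> v \<in> V \<Longrightarrow> dd Z (E i) v \<bullet> E j v = dd Z (E' i) v \<bullet> E' j v"
    and v: "v \<in> V"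
  shows "((\<lambda>v. \<Sum>i\<in>I. (E i v \<bullet> w) *\<^sub>R E' i v) has_derivative (\<lambda>Z. 0)) (at v)"
proof -
  define T where "T v = (\<Sum>i\<in>I. (E i v \<bullet> w) *\<^sub>R E' i v)" for v
  have ew: "smooth_on (\<lambda>v. E i v \<bullet> w) V" if "i \<in> I" for i
    by (rule smooth_on_inner[OF sm(1)[OF that] smooth_on_const[OF V] V])
  have st: "smooth_on (\<lambda>v. (E i v \<bullet> w) *\<^sub>R E' i v) V" if "i \<in> I" for i
    by (rule smooth_on_scaleR[OF ew[OF that] sm(2)[OF that] V])
  have sT: "smooth_on T V" unfolding T_def[abs_def] by (rule smooth_on_sum[OF V I(1) st])
  have z: "dd Z T v = 0" if v: "v \<in> V0" "v \<in> V" for v Z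
  proof -
    have d: "dd Z T v = (\<Sum>i\<in>I. (E i v \<bullet> w) *\<^sub>R dd Z (E' i) v + (dd Z (E i) v \<bullet> w) *\<^sub>R E' i v)"
    proof -
      have "dd Z T v = (\<Sum>i\<in>I. dd Z (\<lambda>v. (E i v \<bullet> w) *\<^sub>R E' i v) v)"
        unfolding T_def[abs_def] by (rule dd_sum[OF V v(2) I(1) st])
      also have "\<dots> = (\<Sum>i\<in>I. (E i v \<bullet> w) *\<^sub>R dd Z (E' i) v + (dd Z (E i) v \<bullet> w) *\<^sub>R E' i v)"
      proof (rule sum.cong)
        fix i assume i: "i \<in> I"
        note dE = smooth_on_differentiable[OF sm(1)[OF i] V v(2)]
        show "dd Z (\<lambda>v. (E i v \<bullet> w) *\<^sub>R E' i v) v = (E i v \<bullet> w) *\<^sub>R dd Z (E' i) v + (dd Z (E i) v \<bullet> w) *\<^sub>R E' i v"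
          unfolding dd_scaleR[OF smooth_on_differentiable[OF ew[OF i] V v(2)] smooth_on_differentiable[OF sm(2)[OF i] V v(2)]]
            dd_inner_const[OF dE] ..
      qed simp
      finally show ?thesis .
    qed
    have "dd Z T v \<bullet> E' k v = 0" if k: "k \<in> I" for k
    proof -
      have skew: "dd Z (E i) v \<bullet> E k v = - (E i v \<bullet> dd Z (E k) v)" if "i \<in> I" for i
        using inner_const_deriv_skew[OF V v(2) sm(1)[OF that] sm(1)[OF k], of "if i = k then 1 else 0" Z] on[OF that k]
        by simp
      have "dd Z T v \<bullet> E' k v = (\<Sum>i\<in>I. (E i v \<bullet> w) * (dd Z (E' i) v \<bullet> E' k v) + (dd Z (E i) v \<bullet> w) * (E' i v \<bullet> E' k v))"
        unfolding d by (simp add: inner_sum_left inner_add_left)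
      also have "\<dots> = (\<Sum>i\<in>I. - (E i v \<bullet> w) * (E i v \<bullet> dd Z (E k) v) + (if i = k then dd Z (E k) v \<bullet> w else 0))"
        by (rule sum.cong) (use on'[OF _ k v(2)] conn[OF _ k v] skew in auto)
      \<comment> \<open>The skew symmetry of the connection form of \<open>E\<close> makes the two contributions cancel.\<close>
      also have "\<dots> = - (\<Sum>i\<in>I. (dd Z (E k) v \<bullet> E i v) * (E i v \<bullet> w)) + dd Z (E k) v \<bullet> w"
        using I(1) k by (simp add: sum.distrib sum_subtractf sum_negf inner_commute mult.commute)
      also have "(\<Sum>i\<in>I. (dd Z (E k) v \<bullet> E i v) * (E i v \<bullet> w)) = (\<Sum>i\<in>I. (dd Z (E k) v \<bullet> E i v) *\<^sub>R E i v) \<bullet> w"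
        by (simp add: inner_sum_left)
      also have "(\<Sum>i\<in>I. (dd Z (E k) v \<bullet> E i v) *\<^sub>R E i v) = dd Z (E k) v"
        by (rule orthonormal_expansion[OF I]) (use on v(2) in blast)
      finally show ?thesis by simp
    qed
    then have "(\<Sum>k\<in>I. (dd Z T v \<bullet> E' k v) *\<^sub>R E' k v) = 0" by simp
    moreover have "(\<Sum>k\<in>I. (dd Z T v \<bullet> E' k v) *\<^sub>R E' k v) = dd Z T v"
      by (rule orthonormal_expansion[OF I]) (use on' v(2) in blast)
    ultimately show ?thesis by simp
  qed
  have "dd Z T v = 0" for Z
    by (rule continuous_zero_dense[OF V smooth_on_continuous[OF smooth_on_dd[OF sT V]] dense z v])
  then show ?thesis
    using has_derivative_dd[OF smooth_on_differentiable[OF sT V v]] by (simp add: T_def[abs_def])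
qed

lemma frame_transport:
  fixes E E' :: "'i \<Rightarrow> 'a::euclidean_space"
  assumes I: "finite I" "card I = DIM('a)"
    and on: "\<And>i j. i \<in> I \<Longrightarrow> j \<in> I \<Longrightarrow> E i \<bullet> E j = (if i = j then 1 else 0)"
    and on': "\<And>i j. i \<in> I \<Longrightarrow> j \<in> I \<Longrightarrow> E' i \<bullet> E' j = (if i = j then 1 else 0)"
  shows "orthogonal_transformation (\<lambda>w. \<Sum>i\<in>I. (E i \<bullet> w) *\<^sub>R E' i)"
    and "j \<in> I \<Longrightarrow> (\<Sum>i\<in>I. (E i \<bullet> E j) *\<^sub>R E' i) = E' j"
proof -
  let ?T = "\<lambda>w. \<Sum>i\<in>I. (E i \<bullet> w) *\<^sub>R E' i"
  have lin: "linear ?T"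
    by (rule linearI) (simp_all add: inner_add_right scaleR_add_left sum.distrib scaleR_sum_right)
  have co: "E' j \<bullet> ?T w = E j \<bullet> w" if j: "j \<in> I" for j w
  proof -
    have "E' j \<bullet> ?T w = (\<Sum>i\<in>I. if i = j then E j \<bullet> w else 0)"
      unfolding inner_sum_right by (rule sum.cong) (use on'[OF j] in auto)
    then show ?thesis using I(1) j by simp
  qed
  have "?T v \<bullet> ?T w = v \<bullet> w" for v w
  proof -
    have "?T v \<bullet> ?T w = (\<Sum>i\<in>I. (E i \<bullet> v) * (E i \<bullet> w))"
      by (subst inner_sum_left) (rule sum.cong, simp_all add: co)
    also have "\<dots> = (\<Sum>i\<in>I. (v \<bullet> E i) *\<^sub>R E i) \<bullet> w"
      by (simp add: inner_sum_left inner_commute[of v])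
    also have "(\<Sum>i\<in>I. (v \<bullet> E i) *\<^sub>R E i) = v" by (rule orthonormal_expansion[OF I on])
    finally show ?thesis .
  qed
  then show "orthogonal_transformation ?T" using lin unfolding orthogonal_transformation_def by blast
  assume j: "j \<in> I"
  have "?T (E j) = (\<Sum>i\<in>I. if i = j then E' j else 0)"
    by (rule sum.cong) (use on[OF _ j] in auto)
  then show "?T (E j) = E' j" using I(1) j by simp
qed


section \<open>Patches with adapted orthonormal frames\<close>

text \<open>Index set of the full frame: \<open>(0, 0), (0, 1), (0, 2)\<close> for position and tangent vectors and
  \<open>(s, 0), (s, 1)\<close> for the \<open>s\<close>-th normal plane.\<close>
definition frame_index :: "nat \<Rightarrow> (nat \<times> nat) set" where
  "frame_index m = {(0, 0), (0, 1), (0, 2)} \<union> {1..m} \<times> {0, 1}"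

lemma frame_index_card: "finite (frame_index m)" "card (frame_index m) = 2 * m + 3"
proof -
  show "finite (frame_index m)" by (simp add: frame_index_def)
  have "card (frame_index m) = card {(0::nat, 0::nat), (0, 1), (0, 2)} + card ({1..m} \<times> {0::nat, 1})"
    unfolding frame_index_def by (rule card_Un_disjoint) auto
  then show "card (frame_index m) = 2 * m + 3" by (simp add: card_cartesian_product)
qed

lemma frame_index_cases:
  assumes "i \<in> frame_index m"
  obtains "i = (0, 0)" | "i = (0, 1)" | "i = (0, 2)" | s where "s \<in> {1..m}" "i = (s, 0)" | s where "s \<in> {1..m}" "i = (s, 1)"
  using assms unfolding frame_index_def by auto

locale normal_frame = sphere_patch V G for V and G :: "real^2 \<Rightarrow> 'a::euclidean_space" +
  fixes m :: nat and E \<Phi> :: "nat \<Rightarrow> real^2 \<Rightarrow> 'a"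
  assumes smE: "\<And>s. s \<in> {1..m} \<Longrightarrow> smooth_on (E s) V" and sm\<Phi>: "\<And>s. s \<in> {1..m} \<Longrightarrow> smooth_on (\<Phi> s) V"
    and norE: "\<And>s v. s \<in> {1..m} \<Longrightarrow> v \<in> V \<Longrightarrow> E s v \<in> normal v"
    and nor\<Phi>: "\<And>s v. s \<in> {1..m} \<Longrightarrow> v \<in> V \<Longrightarrow> \<Phi> s v \<in> normal v"
    and EE: "\<And>s t v. s \<in> {1..m} \<Longrightarrow> t \<in> {1..m} \<Longrightarrow> v \<in> V \<Longrightarrow> E s v \<bullet> E t v = (if s = t then 1 else 0)"
    and \<Phi>\<Phi>: "\<And>s t v. s \<in> {1..m} \<Longrightarrow> t \<in> {1..m} \<Longrightarrow> v \<in> V \<Longrightarrow> \<Phi> s v \<bullet> \<Phi> t v = (if s = t then 1 else 0)"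
    and E\<Phi>: "\<And>s t v. s \<in> {1..m} \<Longrightarrow> t \<in> {1..m} \<Longrightarrow> v \<in> V \<Longrightarrow> E s v \<bullet> \<Phi> t v = 0"
begin

definition Fr :: "nat \<times> nat \<Rightarrow> real^2 \<Rightarrow> 'a" where
  "Fr i = (if fst i = 0 then (if snd i = 0 then G else if snd i = 1 then t1 else t2)
     else if snd i = 0 then E (fst i) else \<Phi> (fst i))"

lemma Fr_simps: "Fr (0, 0) = G" "Fr (0, 1) = t1" "Fr (0, 2) = t2"
  "s \<in> {1..m} \<Longrightarrow> Fr (s, 0) = E s" "s \<in> {1..m} \<Longrightarrow> Fr (s, 1) = \<Phi> s"
  by (simp_all add: Fr_def)

lemma Fr_smooth: "i \<in> frame_index m \<Longrightarrow> smooth_on (Fr i) V"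
  by (erule frame_index_cases) (simp_all only: Fr_simps G smooth_frame smE sm\<Phi>)

lemma normal_zero:
  assumes "w \<in> normal v" "v \<in> V"
  shows "w \<bullet> G v = 0" "w \<bullet> t1 v = 0" "w \<bullet> t2 v = 0" "G v \<bullet> w = 0" "t1 v \<bullet> w = 0" "t2 v \<bullet> w = 0"
    "dd X G v \<bullet> w = 0"
  using assms normal_iff[OF assms(2), of w] by (auto simp: inner_commute normal_def)

lemma Fr_orthonormal:
  assumes v: "v \<in> V" and i: "i \<in> frame_index m" and j: "j \<in> frame_index m"
  shows "Fr i v \<bullet> Fr j v = (if i = j then 1 else 0)"
proof -
  have zE: "E s v \<bullet> G v = 0" "E s v \<bullet> t1 v = 0" "E s v \<bullet> t2 v = 0" "G v \<bullet> E s v = 0" "t1 v \<bullet> E s v = 0" "t2 v \<bullet> E s v = 0"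
    if "s \<in> {1..m}" for s using normal_zero[OF norE[OF that v] v] by simp_all
  have z\<Phi>: "\<Phi> s v \<bullet> G v = 0" "\<Phi> s v \<bullet> t1 v = 0" "\<Phi> s v \<bullet> t2 v = 0" "G v \<bullet> \<Phi> s v = 0" "t1 v \<bullet> \<Phi> s v = 0" "t2 v \<bullet> \<Phi> s v = 0"
    if "s \<in> {1..m}" for s using normal_zero[OF nor\<Phi>[OF that v] v] by simp_all
  have \<Phi>E: "\<Phi> s v \<bullet> E t v = 0" if "s \<in> {1..m}" "t \<in> {1..m}" for s t
    using E\<Phi>[OF that(2,1) v] by (simp add: inner_commute)
  note rules = Fr_simps frame_orthonormal[OF v] unit[OF v] zE z\<Phi> \<Phi>E E\<Phi>[OF _ _ v] EE[OF _ _ v] \<Phi>\<Phi>[OF _ _ v]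
  show ?thesis
    by (rule frame_index_cases[OF i]; rule frame_index_cases[OF j]) (simp_all only: rules, auto)
qed

lemma dd_expansion:
  assumes v: "v \<in> V"
  shows "dd X G v = (dd X G v \<bullet> t1 v) *\<^sub>R t1 v + (dd X G v \<bullet> t2 v) *\<^sub>R t2 v"
  by (rule span_pair_coords[OF frame_orthonormal(1-3)[OF v] dd_in_span_t[OF v]])

text \<open>The coefficients of the tangent frame in terms of the coordinate vector fields. They depend on the
  metric only, so they are the same for isometric patches.\<close>
definition c11 where "c11 v = inverse (sqrt (dd ax1 G v \<bullet> dd ax1 G v))"
definition c22 where "c22 v = gs_norm (dd ax1 G v \<bullet> dd ax1 G v) (dd ax1 G v \<bullet> dd ax2 G v) (dd ax2 G v \<bullet> dd ax2 G v)"
definition c21 where "c21 v = - (c22 v * (dd ax1 G v \<bullet> dd ax2 G v * inverse (dd ax1 G v \<bullet> dd ax1 G v)))"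

lemma t_coeffs: "t1 v = c11 v *\<^sub>R dd ax1 G v" "t2 v = c21 v *\<^sub>R dd ax1 G v + c22 v *\<^sub>R dd ax2 G v"
  by (simp_all add: t1_def gs1_def c11_def t2_def gs2_def c21_def c22_def algebra_simps)

lemma c_smooth: "smooth_on c11 V" "smooth_on c21 V" "smooth_on c22 V"
proof -
  note S = smooth_on_gs[OF V smooth_on_dd[OF G V] smooth_on_dd[OF G V] indep]
  show "smooth_on c11 V" using S(1) by (simp add: c11_def[abs_def])
  show 22: "smooth_on c22 V" using S(2) by (simp add: c22_def[abs_def])
  show "smooth_on c21 V"
    unfolding c21_def[abs_def] by (rule smooth_on_minus[OF smooth_on_mult[OF 22 S(3) V] V])
qed

lemma dd_t1:
  assumes v: "v \<in> V"
  shows "dd Z t1 v = c11 v *\<^sub>R dd Z (dd ax1 G) v + dd Z c11 v *\<^sub>R dd ax1 G v"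
  unfolding t_coeffs(1)[abs_def]
  by (rule dd_scaleR[OF smooth_on_differentiable[OF c_smooth(1) V v] smooth_on_differentiable[OF smooth_on_dd[OF G V] V v]])

lemma dd_t2:
  assumes v: "v \<in> V"
  shows "dd Z t2 v = (c21 v *\<^sub>R dd Z (dd ax1 G) v + dd Z c21 v *\<^sub>R dd ax1 G v)
    + (c22 v *\<^sub>R dd Z (dd ax2 G) v + dd Z c22 v *\<^sub>R dd ax2 G v)"
proof -
  note d = smooth_on_differentiable[OF _ V v]
  note dG = d[OF smooth_on_dd[OF G V]]
  have s: "smooth_on (\<lambda>v. c21 v *\<^sub>R dd ax1 G v) V" "smooth_on (\<lambda>v. c22 v *\<^sub>R dd ax2 G v) V"
    by (intro smooth_on_scaleR c_smooth smooth_on_dd G V)+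
  show ?thesis
    unfolding t_coeffs(2)[abs_def] dd_add[OF d[OF s(1)] d[OF s(2)]]
      dd_scaleR[OF d[OF c_smooth(2)] dG] dd_scaleR[OF d[OF c_smooth(3)] dG] ..
qed

end

text \<open>Koszul's formula: the tangential part of the second derivatives is determined by the metric.\<close>
lemma koszul:
  fixes G H :: "real^2 \<Rightarrow> 'a::euclidean_space"
  assumes V: "open V" and v: "v \<in> V" and G: "smooth_on G V" and H: "smooth_on H V"
    and metric: "\<And>v X Y. v \<in> V \<Longrightarrow> dd X G v \<bullet> dd Y G v = dd X H v \<bullet> dd Y H v"
  shows "dd Z (dd X G) v \<bullet> dd Y G v = dd Z (dd X H) v \<bullet> dd Y H v"
proof -
  have S: "dd Z (dd X G) v \<bullet> dd Y G v + dd Z (dd Y G) v \<bullet> dd X G v =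
      dd Z (dd X H) v \<bullet> dd Y H v + dd Z (dd Y H) v \<bullet> dd X H v" for X Y Z
  proof -
    have "dd Z (\<lambda>v. dd X G v \<bullet> dd Y G v) v = dd Z (\<lambda>v. dd X H v \<bullet> dd Y H v) v"
      by (rule dd_cong[OF V v metric])
    then show ?thesis
      using dd_inner[OF smooth_on_differentiable[OF smooth_on_dd[OF G V] V v] smooth_on_differentiable[OF smooth_on_dd[OF G V] V v], of Z X Y]
        dd_inner[OF smooth_on_differentiable[OF smooth_on_dd[OF H V] V v] smooth_on_differentiable[OF smooth_on_dd[OF H V] V v], of Z X Y]
      by (simp add: inner_commute)
  qed
  have sym: "dd X (dd Y G) v = dd Y (dd X G) v" "dd X (dd Y H) v = dd Y (dd X H) v" for X Y
    by (rule dd_commute[OF V v G], rule dd_commute[OF V v H])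
  show ?thesis
    using S[of Z X Y] S[of X Y Z] S[of Y Z X] sym(1)[of X Z] sym(1)[of Y Z] sym(1)[of X Y]
      sym(2)[of X Z] sym(2)[of Y Z] sym(2)[of X Y] by simp
qed

lemma equal_patches_connection:
  fixes G H :: "real^2 \<Rightarrow> 'a::euclidean_space"
  assumes nfG: "normal_frame V G m E \<Phi>" and nfH: "normal_frame V H m E' \<Phi>'" and v: "v \<in> V"
    and metric: "\<And>v X Y. v \<in> V \<Longrightarrow> dd X G v \<bullet> dd Y G v = dd X H v \<bullet> dd Y H v"
    and sff: "\<And>X Y s. s \<in> {1..m} \<Longrightarrow> dd X (dd Y G) v \<bullet> E s v = dd X (dd Y H) v \<bullet> E' s v"
      "\<And>X Y s. s \<in> {1..m} \<Longrightarrow> dd X (dd Y G) v \<bullet> \<Phi> s v = dd X (dd Y H) v \<bullet> \<Phi>' s v"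
    and conn: "\<And>Z s t. s \<in> {1..m} \<Longrightarrow> t \<in> {1..m} \<Longrightarrow> dd Z (E s) v \<bullet> E t v = dd Z (E' s) v \<bullet> E' t v"
      "\<And>Z s t. s \<in> {1..m} \<Longrightarrow> t \<in> {1..m} \<Longrightarrow> dd Z (E s) v \<bullet> \<Phi> t v = dd Z (E' s) v \<bullet> \<Phi>' t v"
      "\<And>Z s t. s \<in> {1..m} \<Longrightarrow> t \<in> {1..m} \<Longrightarrow> dd Z (\<Phi> s) v \<bullet> E t v = dd Z (\<Phi>' s) v \<bullet> E' t v"
      "\<And>Z s t. s \<in> {1..m} \<Longrightarrow> t \<in> {1..m} \<Longrightarrow> dd Z (\<Phi> s) v \<bullet> \<Phi> t v = dd Z (\<Phi>' s) v \<bullet> \<Phi>' t v"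
    and i: "i \<in> frame_index m" and j: "j \<in> frame_index m"
  shows "dd Z (normal_frame.Fr G E \<Phi> i) v \<bullet> normal_frame.Fr G E \<Phi> j v =
    dd Z (normal_frame.Fr H E' \<Phi>' i) v \<bullet> normal_frame.Fr H E' \<Phi>' j v"
proof -
  interpret g: normal_frame V G m E \<Phi> by (rule nfG)
  interpret h: normal_frame V H m E' \<Phi>' by (rule nfH)
  have c: "g.c11 w = h.c11 w" "g.c22 w = h.c22 w" "g.c21 w = h.c21 w" if "w \<in> V" for w
    unfolding g.c21_def h.c21_def g.c11_def h.c11_def g.c22_def h.c22_def by (simp_all add: metric[OF that])
  have dc: "dd Z g.c11 v = dd Z h.c11 v" "dd Z g.c22 v = dd Z h.c22 v" "dd Z g.c21 v = dd Z h.c21 v" for Z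
    by (rule dd_cong[OF g.V v c(1)] dd_cong[OF g.V v c(2)] dd_cong[OF g.V v c(3)]; assumption)+
  \<comment> \<open>The pair \<open>(a, b)\<close> is tested against first and second derivatives. This is linear in \<open>(a, b)\<close>, so the
    tangent frames may be replaced by coordinate vector fields.\<close>
  define good where "good a b \<longleftrightarrow> (\<forall>X Z. dd Z (dd X G) v \<bullet> a = dd Z (dd X H) v \<bullet> b) \<and> (\<forall>X. dd X G v \<bullet> a = dd X H v \<bullet> b)" for a b
  have good_dd: "good (dd Y G v) (dd Y H v)" for Y
    unfolding good_def using koszul[OF g.V v g.G h.G metric] metric[OF v] by blast
  have good_lin: "good (x *\<^sub>R a + y *\<^sub>R a') (x *\<^sub>R b + y *\<^sub>R b')" if "good a b" "good a' b'" for x y a a' b b'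
    using that unfolding good_def by (simp add: inner_add_right)
  have good_t1: "good (g.t1 v) (h.t1 v)"
    using good_lin[OF good_dd[of ax1] good_dd[of ax1], of "g.c11 v" 0] unfolding g.t_coeffs h.t_coeffs by (simp add: c[OF v])
  have good_t2: "good (g.t2 v) (h.t2 v)"
    using good_lin[OF good_dd[of ax1] good_dd[of ax2], of "g.c21 v" "g.c22 v"] unfolding g.t_coeffs h.t_coeffs by (simp add: c[OF v])
  have good_E: "good (E s v) (E' s v)" "good (\<Phi> s v) (\<Phi>' s v)" if s: "s \<in> {1..m}" for s
    unfolding good_def using sff[OF s] g.normal_zero(7)[OF g.norE[OF s v] v] g.normal_zero(7)[OF g.nor\<Phi>[OF s v] v]
      h.normal_zero(7)[OF h.norE[OF s v] v] h.normal_zero(7)[OF h.nor\<Phi>[OF s v] v] by simp_all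
  have Q_G: "dd Z G v \<bullet> a = dd Z H v \<bullet> b" if "good a b" for a b
    using that unfolding good_def by blast
  have Q_t1: "dd Z g.t1 v \<bullet> a = dd Z h.t1 v \<bullet> b" if "good a b" for a b
    using that unfolding good_def g.dd_t1[OF v] h.dd_t1[OF v] by (simp add: inner_add_left c[OF v] dc)
  have Q_t2: "dd Z g.t2 v \<bullet> a = dd Z h.t2 v \<bullet> b" if "good a b" for a b
    using that unfolding good_def g.dd_t2[OF v] h.dd_t2[OF v] by (simp add: inner_add_left c[OF v] dc)
  have GG: "dd Z G v \<bullet> G v = dd Z H v \<bullet> H v"
    using g.radial_orth[OF v, of Z] h.radial_orth[OF v, of Z] by (simp add: inner_commute)
  define Q where "Q i j \<longleftrightarrow> dd Z (g.Fr i) v \<bullet> g.Fr j v = dd Z (h.Fr i) v \<bullet> h.Fr j v" for i j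
  \<comment> \<open>Connection forms are skew, so it is enough to treat one of \<open>(i, j)\<close> and \<open>(j, i)\<close>.\<close>
  have sym: "Q j i" if Q: "Q i j" and i: "i \<in> frame_index m" and j: "j \<in> frame_index m" for i j
  proof -
    have "g.Fr i v \<bullet> dd Z (g.Fr j) v = - (dd Z (g.Fr i) v \<bullet> g.Fr j v)"
      by (rule inner_const_deriv_skew[OF g.V v g.Fr_smooth[OF i] g.Fr_smooth[OF j] g.Fr_orthonormal[OF _ i j]])
    moreover have "h.Fr i v \<bullet> dd Z (h.Fr j) v = - (dd Z (h.Fr i) v \<bullet> h.Fr j v)"
      by (rule inner_const_deriv_skew[OF h.V v h.Fr_smooth[OF i] h.Fr_smooth[OF j] h.Fr_orthonormal[OF _ i j]])
    ultimately show ?thesis using Q unfolding Q_def by (simp add: inner_commute)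
  qed
  have QG: "Q (0, 0) j" if j: "j \<in> frame_index m" for j
    unfolding Q_def
    by (rule frame_index_cases[OF j]) (simp_all only: g.Fr_simps h.Fr_simps GG Q_G good_t1 good_t2 good_E)
  have t_tang: "Q (0, 1) j \<and> Q (0, 2) j" if j: "j \<in> frame_index m" "j \<noteq> (0, 0)" for j
    unfolding Q_def
    by (rule frame_index_cases[OF j(1)])
      (use j(2) in \<open>simp_all only: g.Fr_simps h.Fr_simps Q_t1 Q_t2 good_t1 good_t2 good_E simp_thms\<close>)
  have mem: "(0, 0) \<in> frame_index m" "(0, 1) \<in> frame_index m" "(0, 2) \<in> frame_index m"
    by (simp_all add: frame_index_def)
  have Qt: "Q (0, 1) j" "Q (0, 2) j" if j: "j \<in> frame_index m" for j
    using t_tang[OF j] sym[OF QG[OF mem(2)] mem(1,2)] sym[OF QG[OF mem(3)] mem(1,3)] by (cases "j = (0, 0)"; blast)+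
  have QE: "Q i j" if i: "i \<in> frame_index m" and s: "fst i \<noteq> 0" and j: "j \<in> frame_index m" for i j
  proof (rule frame_index_cases[OF j])
    assume "j = (0, 0)" then show ?thesis using sym[OF QG[OF i] mem(1) i] by simp
  next
    assume "j = (0, 1)" then show ?thesis using sym[OF Qt(1)[OF i] mem(2) i] by simp
  next
    assume "j = (0, 2)" then show ?thesis using sym[OF Qt(2)[OF i] mem(3) i] by simp
  next
    fix t assume t: "t \<in> {1..m}" "j = (t, 0)"
    show ?thesis
      unfolding Q_def t(2)
      by (rule frame_index_cases[OF i]) (use s in \<open>simp_all only: g.Fr_simps h.Fr_simps t(1) conn fst_conv simp_thms\<close>)
  next
    fix t assume t: "t \<in> {1..m}" "j = (t, 1)"
    show ?thesis
      unfolding Q_def t(2)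
      by (rule frame_index_cases[OF i]) (use s in \<open>simp_all only: g.Fr_simps h.Fr_simps t(1) conn fst_conv simp_thms\<close>)
  qed
  have "Q i j"
  proof (cases "fst i = 0")
    case True
    then show ?thesis using QG[OF j] Qt[OF j] by (cases rule: frame_index_cases[OF i]) auto
  next
    case False
    then show ?thesis using QE[OF i _ j] by blast
  qed
  then show ?thesis unfolding Q_def .
qed

lemma patches_congruent:
  fixes G H :: "real^2 \<Rightarrow> 'a::euclidean_space"
  assumes nfG: "normal_frame V G m E \<Phi>" and nfH: "normal_frame V H m E' \<Phi>'" and dim: "DIM('a) = 2 * m + 3"
    and metric: "\<And>v X Y. v \<in> V \<Longrightarrow> dd X G v \<bullet> dd Y G v = dd X H v \<bullet> dd Y H v"
    and dense: "V \<subseteq> closure V0"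
    and sff: "\<And>v X Y s. v \<in> V0 \<Longrightarrow> v \<in> V \<Longrightarrow> s \<in> {1..m} \<Longrightarrow> dd X (dd Y G) v \<bullet> E s v = dd X (dd Y H) v \<bullet> E' s v"
      "\<And>v X Y s. v \<in> V0 \<Longrightarrow> v \<in> V \<Longrightarrow> s \<in> {1..m} \<Longrightarrow> dd X (dd Y G) v \<bullet> \<Phi> s v = dd X (dd Y H) v \<bullet> \<Phi>' s v"
    and conn: "\<And>v Z s t. v \<in> V0 \<Longrightarrow> v \<in> V \<Longrightarrow> s \<in> {1..m} \<Longrightarrow> t \<in> {1..m} \<Longrightarrow> dd Z (E s) v \<bullet> E t v = dd Z (E' s) v \<bullet> E' t v"
      "\<And>v Z s t. v \<in> V0 \<Longrightarrow> v \<in> V \<Longrightarrow> s \<in> {1..m} \<Longrightarrow> t \<in> {1..m} \<Longrightarrow> dd Z (E s) v \<bullet> \<Phi> t v = dd Z (E' s) v \<bullet> \<Phi>' t v"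
      "\<And>v Z s t. v \<in> V0 \<Longrightarrow> v \<in> V \<Longrightarrow> s \<in> {1..m} \<Longrightarrow> t \<in> {1..m} \<Longrightarrow> dd Z (\<Phi> s) v \<bullet> E t v = dd Z (\<Phi>' s) v \<bullet> E' t v"
      "\<And>v Z s t. v \<in> V0 \<Longrightarrow> v \<in> V \<Longrightarrow> s \<in> {1..m} \<Longrightarrow> t \<in> {1..m} \<Longrightarrow> dd Z (\<Phi> s) v \<bullet> \<Phi> t v = dd Z (\<Phi>' s) v \<bullet> \<Phi>' t v"
    and ball: "u \<in> B" "convex B" "B \<subseteq> V"
  obtains T where "orthogonal_transformation T" "\<And>v. v \<in> B \<Longrightarrow> T (G v) = H v"
    "\<And>v X. v \<in> B \<Longrightarrow> T (dd X G v) = dd X H v"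
    "\<And>v s. v \<in> B \<Longrightarrow> s \<in> {1..m} \<Longrightarrow> T (E s v) = E' s v" "\<And>v s. v \<in> B \<Longrightarrow> s \<in> {1..m} \<Longrightarrow> T (\<Phi> s v) = \<Phi>' s v"
proof -
  interpret g: normal_frame V G m E \<Phi> by (rule nfG)
  interpret h: normal_frame V H m E' \<Phi>' by (rule nfH)
  define I where "I = frame_index m"
  have I: "finite I" "card I = DIM('a)" using frame_index_card[of m] dim by (simp_all add: I_def)
  have on: "g.Fr i v \<bullet> g.Fr j v = (if i = j then 1 else 0)" "h.Fr i v \<bullet> h.Fr j v = (if i = j then 1 else 0)"
    if "i \<in> I" "j \<in> I" "v \<in> V" for i j v
    using that g.Fr_orthonormal h.Fr_orthonormal by (simp_all add: I_def)
  define T where "T v w = (\<Sum>i\<in>I. (g.Fr i v \<bullet> w) *\<^sub>R h.Fr i v)" for v w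
  have zero: "((\<lambda>v. T v w) has_derivative (\<lambda>Z. 0)) (at v)" if v: "v \<in> V" for v w
    unfolding T_def
  proof (rule equal_connection_forms_rigid[where E = g.Fr and E' = h.Fr, OF g.V I _ _ on dense _ v])
    show "smooth_on (g.Fr i) V" "smooth_on (h.Fr i) V" if "i \<in> I" for i
      using that g.Fr_smooth h.Fr_smooth by (simp_all add: I_def)
    show "dd Z (g.Fr i) v \<bullet> g.Fr j v = dd Z (h.Fr i) v \<bullet> h.Fr j v"
      if ij: "i \<in> I" "j \<in> I" and v: "v \<in> V0" "v \<in> V" for i j v Z
      by (rule equal_patches_connection[OF nfG nfH v(2) metric sff[OF v] conn[OF v] ij[unfolded I_def]])
  qed
  \<comment> \<open>A map with vanishing derivative is constant on the convex set \<open>B\<close>.\<close>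
  have const: "T v w = T u w" if v: "v \<in> B" for v w
  proof (rule has_derivative_zero_unique[where f = "\<lambda>v. T v w", OF ball(2) _ v ball(1)])
    show "((\<lambda>v. T v w) has_derivative (\<lambda>h. 0)) (at x within B)" if "x \<in> B" for x
      by (rule has_derivative_at_withinI[OF zero[OF subsetD[OF ball(3) that]]])
  qed
  have uV: "u \<in> V" by (rule subsetD[OF ball(3,1)])
  have Tfr: "T u (g.Fr i v) = h.Fr i v" if "i \<in> I" "v \<in> B" for i v
  proof -
    have v: "v \<in> V" by (rule subsetD[OF ball(3) that(2)])
    have "T v (g.Fr i v) = h.Fr i v"
      unfolding T_def by (rule frame_transport(2)[OF I on(1)[OF _ _ v] on(2)[OF _ _ v] that(1)])
    then show ?thesis using const[OF that(2)] by simp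
  qed
  have memI: "(0, 0) \<in> I" "(0, 1) \<in> I" "(0, 2) \<in> I" "s \<in> {1..m} \<Longrightarrow> (s, 0) \<in> I" "s \<in> {1..m} \<Longrightarrow> (s, 1) \<in> I" for s
    by (auto simp: I_def frame_index_def)
  have orth: "orthogonal_transformation (T u)"
    unfolding T_def[abs_def] by (rule frame_transport(1)[OF I on(1)[OF _ _ uV] on(2)[OF _ _ uV]])
  then have lin: "linear (T u)" unfolding orthogonal_transformation_def by blast
  show ?thesis
  proof (rule that[OF orth])
    fix v assume v: "v \<in> B"
    then have vV: "v \<in> V" by (rule subsetD[OF ball(3)])
    show "T u (G v) = H v" using Tfr[OF memI(1) v] by (simp only: g.Fr_simps h.Fr_simps)
    show "T u (E s v) = E' s v" if "s \<in> {1..m}" for s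
      using Tfr[OF memI(4)[OF that] v] by (simp only: g.Fr_simps h.Fr_simps that)
    show "T u (\<Phi> s v) = \<Phi>' s v" if "s \<in> {1..m}" for s
      using Tfr[OF memI(5)[OF that] v] by (simp only: g.Fr_simps h.Fr_simps that)
    have t: "T u (g.t1 v) = h.t1 v" "T u (g.t2 v) = h.t2 v"
      using Tfr[OF memI(2) v] Tfr[OF memI(3) v] by (simp_all only: g.Fr_simps h.Fr_simps)
    show "T u (dd X G v) = dd X H v" for X
    proof -
      have c: "g.c11 v = h.c11 v" "g.c22 v = h.c22 v" "g.c21 v = h.c21 v"
        unfolding g.c21_def h.c21_def g.c11_def h.c11_def g.c22_def h.c22_def by (simp_all add: metric[OF vV])
      have "dd X G v \<bullet> g.t1 v = dd X H v \<bullet> h.t1 v" "dd X G v \<bullet> g.t2 v = dd X H v \<bullet> h.t2 v"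
        unfolding g.t_coeffs h.t_coeffs c by (simp_all add: inner_add_right metric[OF vV])
      then have "T u (dd X G v) = (dd X H v \<bullet> h.t1 v) *\<^sub>R h.t1 v + (dd X H v \<bullet> h.t2 v) *\<^sub>R h.t2 v"
        by (subst g.dd_expansion[OF vV]) (simp only: linear_add[OF lin] linear_scale[OF lin] t)
      then show ?thesis using h.dd_expansion[OF vV] by simp
    qed
  qed
qed

section \<open>Oriented orthonormal frames of the normal planes\<close>

text \<open>The second part says that \<open>pos\<close> is the orientation of \<open>V\<close> given by the basis \<open>e, f\<close>.\<close>
definition oriented_onb :: "'a::euclidean_space set \<Rightarrow> ('a \<Rightarrow> 'a \<Rightarrow> bool) \<Rightarrow> 'a \<Rightarrow> 'a \<Rightarrow> bool" where
  "oriented_onb V pos e f \<longleftrightarrow> V = span {e, f} \<and> e \<bullet> e = 1 \<and> f \<bullet> f = 1 \<and> e \<bullet> f = 0 \<and>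
     (\<forall>v w. pos v w \<longleftrightarrow> v \<in> V \<and> w \<in> V \<and> 0 < (v \<bullet> e) * (w \<bullet> f) - (v \<bullet> f) * (w \<bullet> e))"

lemma indep2_if_dim_2:
  fixes a b :: "'a::euclidean_space"
  assumes "dim (span {a, b}) = 2"
  shows "indep2 a b"
  unfolding indep2_def
proof (rule ccontr)
  assume "\<not> (\<forall>x y. x *\<^sub>R a + y *\<^sub>R b = 0 \<longrightarrow> x = 0 \<and> y = 0)"
  then obtain x y where xy: "x *\<^sub>R a + y *\<^sub>R b = 0" "x \<noteq> 0 \<or> y \<noteq> 0" by blast
  have small: "dim (span {a, b}) \<le> 1" if "{a, b} \<subseteq> span {c}" for c
  proof -
    have "dim (span {a, b}) \<le> dim (span {c})" using that by (intro dim_subset span_minimal) simp_all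
    also have "\<dots> \<le> card {c}" unfolding dim_span by (rule dim_le_card') simp
    finally show ?thesis by simp
  qed
  have "\<exists>c. {a, b} \<subseteq> span {c}"
  proof (cases "x = 0")
    case True
    then have "b = 0" using xy by simp
    then show ?thesis by (intro exI[of _ a]) (simp add: span_base span_0)
  next
    case False
    have "x *\<^sub>R a = (- y) *\<^sub>R b" using xy(1) by (simp add: eq_neg_iff_add_eq_0)
    then have "inverse x *\<^sub>R (x *\<^sub>R a) = inverse x *\<^sub>R ((- y) *\<^sub>R b)" by simp
    then have "a = (inverse x * (- y)) *\<^sub>R b" using False by simp
    then have "a \<in> span {b}" by (metis span_base span_scale singletonI)
    then show ?thesis by (intro exI[of _ b]) (simp add: span_base)
  qed
  then show False using small assms by force
qed

lemma quarter_turn_onb: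
  fixes e f :: "'a::euclidean_space"
  assumes onb: "oriented_onb V pos e f" and v: "v \<in> V"
  shows "quarter_turn V pos v = (v \<bullet> e) *\<^sub>R f - (v \<bullet> f) *\<^sub>R e"
  unfolding quarter_turn_def
proof (rule the_equality)
  note o = onb[unfolded oriented_onb_def]
  have on: "e \<bullet> e = 1" "f \<bullet> f = 1" "e \<bullet> f = 0" "f \<bullet> e = 0" using o by (simp_all add: inner_commute)
  have coords: "w = (w \<bullet> e) *\<^sub>R e + (w \<bullet> f) *\<^sub>R f" if "w \<in> V" for w
    using span_pair_coords[OF on(1-3)] that o by simp
  have ip: "w \<bullet> w' = (w \<bullet> e) * (w' \<bullet> e) + (w \<bullet> f) * (w' \<bullet> f)" if "w \<in> V" for w w'
    using arg_cong[OF coords[OF that], of "\<lambda>x. x \<bullet> w'"]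
    by (simp only: inner_add_left inner_scaleR_left inner_commute[of e w'] inner_commute[of f w'])
  let ?w = "(v \<bullet> e) *\<^sub>R f - (v \<bullet> f) *\<^sub>R e"
  have "?w \<in> span {e, f}" by (intro span_diff span_scale span_base; simp)
  then have wV: "?w \<in> V" using o by (simp only:)
  have wc: "?w \<bullet> e = - (v \<bullet> f)" "?w \<bullet> f = v \<bullet> e" by (simp_all add: inner_diff_left on)
  show "?w \<in> V \<and> v \<bullet> ?w = 0 \<and> norm ?w = norm v \<and> (v \<noteq> 0 \<longrightarrow> pos v ?w)"
  proof (intro conjI impI wV)
    show "v \<bullet> ?w = 0" using ip[OF v, of ?w] unfolding wc by simp
    show "norm ?w = norm v" using ip[OF v, of v] ip[OF wV, of ?w] unfolding norm_eq wc by simp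
    assume "v \<noteq> 0"
    then have "0 < v \<bullet> v" by simp
    then have "0 < (v \<bullet> e) * (v \<bullet> e) + (v \<bullet> f) * (v \<bullet> f)" using ip[OF v, of v] by linarith
    then show "pos v ?w" using o v wV wc by simp
  qed
  fix w assume w: "w \<in> V \<and> v \<bullet> w = 0 \<and> norm w = norm v \<and> (v \<noteq> 0 \<longrightarrow> pos v w)"
  show "w = ?w"
  proof (cases "v = 0")
    case True
    then show ?thesis using w by simp
  next
    case False
    have wV': "w \<in> V" using w by blast
    have "w \<bullet> e = - (v \<bullet> f) \<and> w \<bullet> f = v \<bullet> e"
    proof -
      have 1: "(v \<bullet> e) * (v \<bullet> e) + (v \<bullet> f) * (v \<bullet> f) = (w \<bullet> e) * (w \<bullet> e) + (w \<bullet> f) * (w \<bullet> f)"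
        using ip[OF v, of v] ip[OF wV', of w] w[unfolded norm_eq] by linarith
      have 2: "(v \<bullet> e) * (w \<bullet> e) + (v \<bullet> f) * (w \<bullet> f) = 0" using w ip[OF v, of w] by linarith
      have 3: "0 < (v \<bullet> e) * (w \<bullet> f) - (v \<bullet> f) * (w \<bullet> e)" using w False o by blast
      show ?thesis using quarter_turn_coords[OF 1 2 3] by blast
    qed
    then show ?thesis using coords[OF wV'] by simp
  qed
qed

lemma smooth_map_comb:
  assumes A: "oriented_surface A" and W: "open W" and "smooth_map A W e" "smooth_map A W f"
  shows "smooth_map A W (\<lambda>q. a *\<^sub>R e q + b *\<^sub>R f q)"
  unfolding smooth_map_def
proof
  fix c assume c: "c \<in> A"
  have "smooth_on (\<lambda>u. a *\<^sub>R in_chart c e u + b *\<^sub>R in_chart c f u) (snd c ` (W \<inter> fst c))"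
    using assms(3,4) c open_chart_image[OF A c W] unfolding smooth_map_def
    by (intro smooth_on_add smooth_on_scaleR smooth_on_const) auto
  then show "smooth_on (in_chart c (\<lambda>q. a *\<^sub>R e q + b *\<^sub>R f q)) (snd c ` (W \<inter> fst c))"
    by (simp add: in_chart_def o_def)
qed

lemma smooth_map_gs:
  fixes e f :: "'l::{t2_space,second_countable_topology} \<Rightarrow> 'a::euclidean_space"
  assumes A: "oriented_surface A" and W: "open W" and e: "smooth_map A W e" and f: "smooth_map A W f"
    and ind: "\<And>q. q \<in> W \<Longrightarrow> indep2 (e q) (f q)"
  shows "smooth_map A W (\<lambda>q. gs1 (e q) (f q))" "smooth_map A W (\<lambda>q. gs2 (e q) (f q))"
proof -
  have "smooth_on (in_chart c (\<lambda>q. gs1 (e q) (f q))) (snd c ` (W \<inter> fst c)) \<and>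
    smooth_on (in_chart c (\<lambda>q. gs2 (e q) (f q))) (snd c ` (W \<inter> fst c))" if c: "c \<in> A" for c
  proof -
    let ?V = "snd c ` (W \<inter> fst c)"
    have V: "open ?V" by (rule open_chart_image[OF A c W])
    have s: "smooth_on (in_chart c e) ?V" "smooth_on (in_chart c f) ?V"
      using e f c unfolding smooth_map_def by blast+
    have i: "indep2 (in_chart c e u) (in_chart c f u)" if u: "u \<in> ?V" for u
      using ind chart_inv(3)[OF A c Int_lower2 u] by (simp add: in_chart_def)
    show ?thesis using smooth_on_gs(4,5)[OF V s i] by (simp add: in_chart_def o_def)
  qed
  then show "smooth_map A W (\<lambda>q. gs1 (e q) (f q))" "smooth_map A W (\<lambda>q. gs2 (e q) (f q))"
    unfolding smooth_map_def by blast+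
qed

lemma smooth_map_subset:
  assumes A: "oriented_surface A" and W: "open W'" "W' \<subseteq> W" and f: "smooth_map A W f"
  shows "smooth_map A W' f"
  unfolding smooth_map_def
proof
  fix c assume c: "c \<in> A"
  have "smooth_on (in_chart c f) (snd c ` (W \<inter> fst c))" using f c unfolding smooth_map_def by blast
  then show "smooth_on (in_chart c f) (snd c ` (W' \<inter> fst c))"
    by (rule smooth_on_subset[OF _ open_chart_image[OF A c W(1)]]) (use W(2) in auto)
qed

text \<open>Gram--Schmidt applied to the local frames from the definition of an oriented plane bundle.\<close>
lemma plane_bundle_onb_frame:
  fixes V :: "'l::{t2_space,second_countable_topology} \<Rightarrow> 'a::euclidean_space set"
  assumes A: "oriented_surface A" and B: "oriented_plane_bundle A V pos"
  shows "\<exists>U e f. open U \<and> p \<in> U \<and> smooth_map A U e \<and> smooth_map A U f \<and>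
    (\<forall>q\<in>U. oriented_onb (V q) (pos q) (e q) (f q))"
proof -
  obtain U e f where U: "open U" "p \<in> U" "smooth_map A U e" "smooth_map A U f" and
    fr: "\<And>q. q \<in> U \<Longrightarrow> V q = span {e q, f q} \<and> dim (V q) = 2 \<and>
           (\<forall>v w. pos q v w \<longleftrightarrow> v \<in> V q \<and> w \<in> V q \<and>
              0 < (v \<bullet> e q) * (w \<bullet> f q) - (v \<bullet> f q) * (w \<bullet> e q))"
    using B[unfolded oriented_plane_bundle_def, rule_format, of p] by blast
  have ind: "indep2 (e q) (f q)" if "q \<in> U" for q
  proof (rule indep2_if_dim_2)
    have "V q = span {e q, f q}" "dim (V q) = 2" using fr[OF that] by blast+
    then show "dim (span {e q, f q}) = 2" by (simp only:)
  qed
  have "oriented_onb (V q) (pos q) (gs1 (e q) (f q)) (gs2 (e q) (f q))" if q: "q \<in> U" for q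
    unfolding oriented_onb_def using gs_orthonormal[OF ind[OF q]] gs_span[OF ind[OF q]] gs_area[OF ind[OF q]] fr[OF q]
    by simp
  then show ?thesis
    using smooth_map_gs[OF A U(1,3,4) ind] U(1,2)
    by (intro exI[of _ U] exI[of _ "\<lambda>q. gs1 (e q) (f q)"] exI[of _ "\<lambda>q. gs2 (e q) (f q)"]) simp
qed

section \<open>The associated family of a pseudoholomorphic surface\<close>

text \<open>For even codimension \<open>n = 2 m\<close> of the surface the ambient dimension \<open>n + 3\<close> is \<open>2 m + 3\<close>.\<close>
locale associated_pair =
  fixes A :: "('l::{t2_space,second_countable_topology}) chart set" and m :: nat
    and g h :: "'l \<Rightarrow> 'a::euclidean_space"
    and N :: "nat \<Rightarrow> 'l \<Rightarrow> 'a set" and pos :: "nat \<Rightarrow> 'l \<Rightarrow> 'a \<Rightarrow> 'a \<Rightarrow> bool"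
    and \<phi> :: "'l \<Rightarrow> 'a \<Rightarrow> 'a" and \<theta> :: real
  assumes A: "oriented_surface A" and dim: "DIM('a) = 2 * m + 3" and m: "1 \<le> m"
    and min: "minimal_surface A g"
    and circ: "\<And>c p s. c \<in> A \<Longrightarrow> p \<in> fst c \<Longrightarrow> s \<in> {1..m} \<Longrightarrow> is_circle (curv_ellipse A c g s p)"
    and split: "oriented_splitting A m g N pos"
    and assoc: "associated_member A m g \<theta> h \<phi>"
begin

lemma imm_g: "sphere_immersion A g" and imm_h: "sphere_immersion A h"
  using min assoc unfolding minimal_surface_def associated_member_def by blast+

lemma metric: "c \<in> A \<Longrightarrow> p \<in> fst c \<Longrightarrow> dmap c g p X \<bullet> dmap c g p Y = dmap c h p X \<bullet> dmap c h p Y"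
  using assoc unfolding associated_member_def isometric_def by simp

lemma \<phi>_facts:
  shows \<phi>_image: "\<phi> p ` normal_space A g p = normal_space A h p"
    and \<phi>_add: "v \<in> normal_space A g p \<Longrightarrow> w \<in> normal_space A g p \<Longrightarrow> \<phi> p (v + w) = \<phi> p v + \<phi> p w"
    and \<phi>_scale: "v \<in> normal_space A g p \<Longrightarrow> \<phi> p (r *\<^sub>R v) = r *\<^sub>R \<phi> p v"
    and \<phi>_inner: "v \<in> normal_space A g p \<Longrightarrow> w \<in> normal_space A g p \<Longrightarrow> \<phi> p v \<bullet> \<phi> p w = v \<bullet> w"
  using assoc unfolding associated_member_def parallel_bundle_isometry_def by blast+

lemma \<phi>_parallel:
  assumes "open U" "smooth_map A U \<xi>" "\<And>q. q \<in> U \<Longrightarrow> \<xi> q \<in> normal_space A g q"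
  shows "smooth_map A U (\<lambda>q. \<phi> q (\<xi> q))"
    and "c \<in> A \<Longrightarrow> p \<in> U \<Longrightarrow> p \<in> fst c \<Longrightarrow> normal_conn A c h X (\<lambda>q. \<phi> q (\<xi> q)) p = \<phi> p (normal_conn A c g X \<xi> p)"
proof -
  have "parallel_bundle_isometry A g h \<phi>" using assoc unfolding associated_member_def by blast
  note * = this[unfolded parallel_bundle_isometry_def, THEN conjunct2, rule_format, of U \<xi>, OF assms]
  show "smooth_map A U (\<lambda>q. \<phi> q (\<xi> q))" using * by blast
  show "c \<in> A \<Longrightarrow> p \<in> U \<Longrightarrow> p \<in> fst c \<Longrightarrow> normal_conn A c h X (\<lambda>q. \<phi> q (\<xi> q)) p = \<phi> p (normal_conn A c g X \<xi> p)"
    using * by blast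
qed

lemma subspace_normal_space: "subspace (normal_space A g p)"
  unfolding normal_space_def subspace_def by (simp add: inner_add_left)

lemma local_frames:
  obtains U e f where "open U" "p \<in> U"
    "\<And>s. s \<in> {1..m} \<Longrightarrow> smooth_map A U (e s)" "\<And>s. s \<in> {1..m} \<Longrightarrow> smooth_map A U (f s)"
    "\<And>q s. q \<in> U \<Longrightarrow> s \<in> {1..m} \<Longrightarrow> oriented_onb (N s q) (pos s q) (e s q) (f s q)"
proof -
  have "\<forall>s\<in>{1..m}. \<exists>U e f. open U \<and> p \<in> U \<and> smooth_map A U e \<and> smooth_map A U f \<and>
    (\<forall>q\<in>U. oriented_onb (N s q) (pos s q) (e q) (f q))"
  proof
    fix s assume "s \<in> {1..m}"
    then have "oriented_plane_bundle A (N s) (pos s)" using split unfolding oriented_splitting_def by blast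
    then show "\<exists>U e f. open U \<and> p \<in> U \<and> smooth_map A U e \<and> smooth_map A U f \<and>
      (\<forall>q\<in>U. oriented_onb (N s q) (pos s q) (e q) (f q))" by (rule plane_bundle_onb_frame[OF A])
  qed
  then obtain U e f where U: "\<And>s. s \<in> {1..m} \<Longrightarrow> open (U s) \<and> p \<in> U s \<and> smooth_map A (U s) (e s) \<and> smooth_map A (U s) (f s) \<and>
    (\<forall>q\<in>U s. oriented_onb (N s q) (pos s q) (e s q) (f s q))"
    by metis
  define U' where "U' = (\<Inter>s\<in>{1..m}. U s)"
  have o: "open U'" unfolding U'_def using U by (intro open_INT) auto
  have sub: "U' \<subseteq> U s" if "s \<in> {1..m}" for s using that unfolding U'_def by blast
  show ?thesis
  proof (rule that[OF o])
    show "p \<in> U'" using U unfolding U'_def by blast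
    fix s assume s: "s \<in> {1..m}"
    show "smooth_map A U' (e s)" "smooth_map A U' (f s)"
      using smooth_map_subset[OF A o sub[OF s]] U[OF s] by blast+
    show "oriented_onb (N s q) (pos s q) (e s q) (f s q)" if "q \<in> U'" for q
      using U[OF s] sub[OF s] that by blast
  qed
qed

text \<open>The value at \<open>q\<close> of the transformation that is to be shown constant. It is described without
  reference to charts and frames, so that the local constructions fit together.\<close>
definition transports :: "'l \<Rightarrow> ('a \<Rightarrow> 'a) \<Rightarrow> bool" where
  "transports q T \<longleftrightarrow> orthogonal_transformation T \<and> T (g q) = h q \<and>
     (\<forall>c\<in>A. q \<in> fst c \<longrightarrow> (\<forall>X. T (dmap c g q X) = dmap c h q X)) \<and>
     (\<forall>s\<in>{1..m}. \<forall>v\<in>N s q. T v = \<phi> q (cos \<theta> *\<^sub>R v + sin \<theta> *\<^sub>R quarter_turn (N s q) (pos s q) v))"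

end

text \<open>\<open>W\<close> is the dense set of regular points, \<open>U\<close> the domain of the frames of the normal planes and \<open>c\<close> the
  chart for the computations.\<close>
locale local_frame = associated_pair +
  fixes W U :: "'a set" and e f :: "nat \<Rightarrow> 'a \<Rightarrow> 'b" and c
  assumes W: "open W" "closure W = UNIV"
    and Wc: "\<And>c p. c \<in> A \<Longrightarrow> p \<in> W \<inter> fst c \<Longrightarrow>
           normal_space A g p = span (\<Union>s\<in>{1..m}. N s p) \<and>
           (\<forall>s\<in>{1..m}. N s p = curv_space A c g s p \<and>
              (\<forall>X. X \<noteq> 0 \<longrightarrow> pos s p (fund_form A c g p (replicate (s + 1) X))
                 (fund_form A c g p (cstruct c g p X # replicate s X))))"
    and U: "open U" and sme: "\<And>s. s \<in> {1..m} \<Longrightarrow> smooth_map A U (e s)"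
    and smf: "\<And>s. s \<in> {1..m} \<Longrightarrow> smooth_map A U (f s)"
    and onb: "\<And>q s. q \<in> U \<Longrightarrow> s \<in> {1..m} \<Longrightarrow> oriented_onb (N s q) (pos s q) (e s q) (f s q)"
    and c: "c \<in> A"
begin

definition V where "V = snd c ` (U \<inter> fst c)"
definition V0 where "V0 = snd c ` (W \<inter> U \<inter> fst c)"
definition E where "E s = in_chart c (e s)"
definition \<Phi> where "\<Phi> s = in_chart c (f s)"

lemma at: "p \<in> fst c \<Longrightarrow> in_chart c F (snd c p) = F p"
  by (rule in_chart_at[OF A c])

lemma V0_V: "V0 \<subseteq> V" by (auto simp: V_def V0_def)

lemma open_V: "open V" "open V0"
  unfolding V_def V0_def using open_chart_image[OF A c U] open_chart_image[OF A c open_Int[OF W(1) U]] by simp_all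

lemma dense: "V \<subseteq> closure V0"
proof
  fix v assume v: "v \<in> V"
  have "S \<inter> V0 \<noteq> {}" if S: "open S" "v \<in> S" for S
  proof -
    let ?i = "inv_into (fst c) (snd c)"
    have "open (?i ` (S \<inter> V))"
      by (rule open_chart_preimage[OF A c]) (use S open_V in \<open>auto simp: V_def\<close>)
    moreover have "?i v \<in> ?i ` (S \<inter> V)" using v S by blast
    ultimately have "W \<inter> ?i ` (S \<inter> V) \<noteq> {}"
      using W(2) closure_iff_nhds_not_empty[of "?i v" W] by blast
    then obtain w where w: "w \<in> S" "w \<in> V" "?i w \<in> W" by blast
    have "?i w \<in> U \<inter> fst c" "snd c (?i w) = w"
      using chart_inv(2,3)[OF A c, of "U \<inter> fst c" w] w(2) unfolding V_def by auto
    then have "w \<in> V0" unfolding V0_def using w(3) by (metis IntE IntI imageI)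
    then show ?thesis using w(1) by blast
  qed
  then show "v \<in> closure V0" using closure_iff_nhds_not_empty[of v V0] by blast
qed

sublocale g: sphere_patch V "in_chart c g"
  unfolding V_def by (rule sphere_patch_chart[OF A c imm_g U])

sublocale h: sphere_patch V "in_chart c h"
  unfolding V_def by (rule sphere_patch_chart[OF A c imm_h U])

lemma normal_g: "p \<in> U \<inter> fst c \<Longrightarrow> normal_space A g p = g.normal (snd c p)"
  by (rule normal_space_chart[OF A c imm_g U])

lemma normal_h: "p \<in> U \<inter> fst c \<Longrightarrow> normal_space A h p = h.normal (snd c p)"
  by (rule normal_space_chart[OF A c imm_h U])

lemma smooth_EF:
  assumes s: "s \<in> {1..m}"
  shows "smooth_on (E s) V" "smooth_on (\<Phi> s) V"
  using sme[OF s] smf[OF s] c unfolding smooth_map_def E_def \<Phi>_def V_def by blast+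

lemma adapted:
  assumes p: "p \<in> W" "p \<in> U" "p \<in> fst c"
  shows "adapted_point A c g p m (\<lambda>s. E s (snd c p)) (\<lambda>s. \<Phi> s (snd c p))"
proof -
  have EF: "E s (snd c p) = e s p" "\<Phi> s (snd c p) = f s p" for s
    unfolding E_def \<Phi>_def by (rule at[OF p(3)])+
  have Wp: "normal_space A g p = span (\<Union>s\<in>{1..m}. N s p)" "\<And>s. s \<in> {1..m} \<Longrightarrow> N s p = curv_space A c g s p"
    "\<And>s X. s \<in> {1..m} \<Longrightarrow> X \<noteq> 0 \<Longrightarrow> pos s p (fund_form A c g p (replicate (s + 1) X))
                 (fund_form A c g p (cstruct c g p X # replicate s X))"
    using Wc[OF c, of p] p by blast+
  have o: "N s p = span {e s p, f s p}" "e s p \<bullet> e s p = 1" "f s p \<bullet> f s p = 1" "e s p \<bullet> f s p = 0"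
    "\<And>v w. pos s p v w \<longleftrightarrow> v \<in> N s p \<and> w \<in> N s p \<and> 0 < (v \<bullet> e s p) * (w \<bullet> f s p) - (v \<bullet> f s p) * (w \<bullet> e s p)"
    if "s \<in> {1..m}" for s
    using onb[OF p(2) that] unfolding oriented_onb_def by blast+
  have inN: "e s p \<in> N s p" "f s p \<in> N s p" if "s \<in> {1..m}" for s
    unfolding o(1)[OF that] by (simp_all add: span_base)
  have nor: "N s p \<subseteq> normal_space A g p" if "s \<in> {1..m}" for s
    unfolding Wp(1) using that by (meson UN_upper span_superset subset_trans)
  show ?thesis
    unfolding EF
  proof (unfold_locales)
    show "oriented_surface A" "c \<in> A" "p \<in> fst c" "minimal_surface A g" using A c p min by blast+
    fix s assume s: "s \<in> {1..m}"
    show "curv_space A c g s p = span {e s p, f s p}" using Wp(2)[OF s] o(1)[OF s] by simp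
    show "e s p \<bullet> e s p = 1" "f s p \<bullet> f s p = 1" "e s p \<bullet> f s p = 0" by (rule o[OF s])+
    show "e s p \<in> normal_space A g p" "f s p \<in> normal_space A g p" using inN[OF s] nor[OF s] by blast+
    show "is_circle (curv_ellipse A c g s p)" by (rule circ[OF c p(3) s])
    fix X :: "real^2" assume "X \<noteq> 0"
    then show "0 < (fund_form A c g p (replicate (s + 1) X) \<bullet> e s p) * (fund_form A c g p (cstruct c g p X # replicate s X) \<bullet> f s p)
        - (fund_form A c g p (replicate (s + 1) X) \<bullet> f s p) * (fund_form A c g p (cstruct c g p X # replicate s X) \<bullet> e s p)"
      using Wp(3)[OF s] o(5)[OF s] by blast
  qed
qed

lemma adapted_V0:
  assumes "v \<in> V0"
  shows "\<exists>p. v = snd c p \<and> adapted_point A c g p m (\<lambda>s. E s v) (\<lambda>s. \<Phi> s v)"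
  using assms adapted unfolding V0_def by blast

lemma zero_on_V:
  assumes "smooth_on a V" "smooth_on b V" "\<And>v. v \<in> V0 \<Longrightarrow> a v \<bullet> b v = 0" "v \<in> V"
  shows "a v \<bullet> b v = 0"
  using continuous_zero_dense[OF open_V(1) smooth_on_continuous[OF smooth_on_inner[OF assms(1,2) open_V(1)]] dense assms(3) assms(4)] .

text \<open>The orthogonality relations hold on the dense set where the planes come from the fundamental
  forms; by continuity they hold everywhere.\<close>
sublocale G: normal_frame V "in_chart c g" m E \<Phi>
proof
  fix s assume s: "s \<in> {1..m}"
  show "smooth_on (E s) V" "smooth_on (\<Phi> s) V" by (rule smooth_EF[OF s])+
  have n0: "E s v \<in> g.normal v" "\<Phi> s v \<in> g.normal v" if v: "v \<in> V0" for v
  proof -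
    obtain p where p: "p \<in> W" "p \<in> U" "p \<in> fst c" "v = snd c p" using v unfolding V0_def by blast
    show "E s v \<in> g.normal v" "\<Phi> s v \<in> g.normal v"
      using adapted_point.nrm[OF adapted[OF p(1-3)] s] normal_g[of p] p by auto
  qed
  fix v assume v: "v \<in> V"
  show "E s v \<in> g.normal v" "\<Phi> s v \<in> g.normal v"
    unfolding g.normal_def mem_Collect_eq
    by (intro conjI allI zero_on_V[OF smooth_EF(1)[OF s] _ _ v] zero_on_V[OF smooth_EF(2)[OF s] _ _ v] g.G smooth_on_dd[OF g.G g.V];
        use n0 in \<open>simp add: g.normal_def\<close>)+
  fix t assume t: "t \<in> {1..m}"
  obtain p where p: "p \<in> U" "p \<in> fst c" "v = snd c p" using v unfolding V_def by blast
  have EF: "E s v = e s p" "\<Phi> s v = f s p" for s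
    unfolding E_def \<Phi>_def p(3) by (rule at[OF p(2)])+
  have same: "e s p \<bullet> e s p = 1 \<and> f s p \<bullet> f s p = 1 \<and> e s p \<bullet> f s p = 0"
    using onb[OF p(1) s] unfolding oriented_onb_def by blast
  have diff: "E s v \<bullet> E t v = 0 \<and> \<Phi> s v \<bullet> \<Phi> t v = 0 \<and> E s v \<bullet> \<Phi> t v = 0" if st: "s \<noteq> t"
  proof -
    have d0: "E s v \<bullet> E t v = 0 \<and> \<Phi> s v \<bullet> \<Phi> t v = 0 \<and> E s v \<bullet> \<Phi> t v = 0" if v: "v \<in> V0" for v
    proof -
      obtain p where ad: "adapted_point A c g p m (\<lambda>s. E s v) (\<lambda>s. \<Phi> s v)" using adapted_V0[OF v] by blast
      show ?thesis using adapted_point.distinct_planes_orth[OF ad s t st] by blast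
    qed
    show ?thesis
      using zero_on_V[OF smooth_EF(1)[OF s] smooth_EF(1)[OF t] _ v] zero_on_V[OF smooth_EF(2)[OF s] smooth_EF(2)[OF t] _ v]
        zero_on_V[OF smooth_EF(1)[OF s] smooth_EF(2)[OF t] _ v] d0 by blast
  qed
  show "E s v \<bullet> E t v = (if s = t then 1 else 0)" "\<Phi> s v \<bullet> \<Phi> t v = (if s = t then 1 else 0)" "E s v \<bullet> \<Phi> t v = 0"
    using same diff EF by (cases "s = t"; simp)+
qed

lemma frame_normal:
  assumes "p \<in> U" "p \<in> fst c" "s \<in> {1..m}"
  shows "e s p \<in> normal_space A g p" "f s p \<in> normal_space A g p"
proof -
  have v: "snd c p \<in> V" using assms unfolding V_def by blast
  show "e s p \<in> normal_space A g p" "f s p \<in> normal_space A g p"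
    using G.norE[OF assms(3) v] G.nor\<Phi>[OF assms(3) v] normal_g[of p] assms by (simp_all add: E_def \<Phi>_def at)
qed

end

section \<open>Comparison of the two surfaces\<close>

lemma cos_sin_collapse: "cos \<theta> * (cos \<theta> * x) + sin \<theta> * (sin \<theta> * x) = (x::real)"
proof -
  have "cos \<theta> * (cos \<theta> * x) + sin \<theta> * (sin \<theta> * x) = ((cos \<theta>)\<^sup>2 + (sin \<theta>)\<^sup>2) * x"
    by (simp only: power2_eq_square distrib_right mult.assoc)
  then show ?thesis by simp
qed

context local_frame
begin

text \<open>The frame of the normal planes turned by \<open>\<theta>\<close>, and its image under \<open>\<phi>\<close> in coordinates.\<close>
definition \<xi> where "\<xi> s q = cos \<theta> *\<^sub>R e s q + sin \<theta> *\<^sub>R f s q"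
definition \<eta> where "\<eta> s q = cos \<theta> *\<^sub>R f s q + (- sin \<theta>) *\<^sub>R e s q"
definition E' where "E' s = in_chart c (\<lambda>q. \<phi> q (\<xi> s q))"
definition \<Phi>' where "\<Phi>' s = in_chart c (\<lambda>q. \<phi> q (\<eta> s q))"

text \<open>Normality does not refer to the chart, so it may be checked in any chart around \<open>q\<close>.\<close>
lemma frame_normal_U:
  assumes "q \<in> U" "s \<in> {1..m}"
  shows "e s q \<in> normal_space A g q" "f s q \<in> normal_space A g q"
proof -
  obtain c' where c': "c' \<in> A" "q \<in> fst c'" using A unfolding oriented_surface_def by blast
  interpret c': local_frame A m g h N pos \<phi> \<theta> W U e f c'
    by unfold_locales (rule W Wc U sme smf onb c'; assumption?)+
  show "e s q \<in> normal_space A g q" "f s q \<in> normal_space A g q"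
    using c'.frame_normal[OF assms(1) c'(2) assms(2)] by simp_all
qed

lemma turned_normal:
  assumes "q \<in> U" "s \<in> {1..m}"
  shows "\<xi> s q \<in> normal_space A g q" "\<eta> s q \<in> normal_space A g q"
  unfolding \<xi>_def \<eta>_def using frame_normal_U[OF assms]
  by (intro subspace_add subspace_scale subspace_normal_space; simp)+

lemma turned_smooth:
  assumes "s \<in> {1..m}"
  shows "smooth_map A U (\<xi> s)" "smooth_map A U (\<eta> s)"
  unfolding \<xi>_def[abs_def] \<eta>_def[abs_def] by (intro smooth_map_comb A U sme smf assms)+

text \<open>The derivative and its normal component have the same product with a normal vector, and \<open>\<phi>\<close> is a
  parallel isometry.\<close>
lemma conn_transfer:
  assumes a: "smooth_map A U a" "\<And>q. q \<in> U \<Longrightarrow> a q \<in> normal_space A g q"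
    and b: "b \<in> normal_space A g p" and p: "p \<in> U" "p \<in> fst c"
  shows "dd Z (in_chart c (\<lambda>q. \<phi> q (a q))) (snd c p) \<bullet> \<phi> p b = dd Z (in_chart c a) (snd c p) \<bullet> b"
proof -
  have pU: "p \<in> U \<inter> fst c" using p by simp
  have v: "snd c p \<in> V" using p unfolding V_def by blast
  have bn: "b \<in> g.normal (snd c p)" using b normal_g[OF pU] by simp
  have \<phi>b: "\<phi> p b \<in> h.normal (snd c p)" using b \<phi>_image[of p] normal_h[OF pU] by blast
  have nn: "g.nproj (snd c p) (dd Z (in_chart c a) (snd c p)) \<in> normal_space A g p"
    using g.nproj_normal[OF v] normal_g[OF pU] by simp
  have "dd Z (in_chart c (\<lambda>q. \<phi> q (a q))) (snd c p) \<bullet> \<phi> p b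
      = h.nproj (snd c p) (dd Z (in_chart c (\<lambda>q. \<phi> q (a q))) (snd c p)) \<bullet> \<phi> p b"
    using h.nproj_inner[OF v \<phi>b] by simp
  also have "\<dots> = normal_conn A c h Z (\<lambda>q. \<phi> q (a q)) p \<bullet> \<phi> p b"
    by (simp add: normal_conn_chart[OF A c imm_h U pU])
  also have "\<dots> = \<phi> p (g.nproj (snd c p) (dd Z (in_chart c a) (snd c p))) \<bullet> \<phi> p b"
    by (simp add: \<phi>_parallel(2)[OF U a c p] normal_conn_chart[OF A c imm_g U pU])
  also have "\<dots> = dd Z (in_chart c a) (snd c p) \<bullet> b"
    by (simp add: \<phi>_inner[OF nn b] g.nproj_inner[OF v bn])
  finally show ?thesis .
qed

lemma sff_transfer:
  assumes w: "w \<in> normal_space A g p" and p: "p \<in> U" "p \<in> fst c"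
  shows "dd X (dd Y (in_chart c h)) (snd c p) \<bullet> \<phi> p w =
    dd (J_rot c g \<theta> p X) (dd Y (in_chart c g)) (snd c p) \<bullet> w"
proof -
  have pU: "p \<in> U \<inter> fst c" using p by simp
  have v: "snd c p \<in> V" using p unfolding V_def by blast
  have wn: "w \<in> g.normal (snd c p)" using w normal_g[OF pU] by simp
  have \<phi>w: "\<phi> p w \<in> h.normal (snd c p)" using w \<phi>_image[of p] normal_h[OF pU] by blast
  have sg: "second_ff A c g p P Q = g.nproj (snd c p) (dd P (dd Q (in_chart c g)) (snd c p))" for P Q
    using second_ff_chart[OF A c imm_g p(2), of P Q] by simp
  have nn: "second_ff A c g p P Q \<in> normal_space A g p" for P Q
    using g.nproj_normal[OF v] normal_g[OF pU] unfolding sg by simp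
  have "dd X (dd Y (in_chart c h)) (snd c p) \<bullet> \<phi> p w = second_ff A c h p X Y \<bullet> \<phi> p w"
    using h.nproj_inner[OF v \<phi>w] second_ff_chart[OF A c imm_h p(2), of X Y] by simp
  also have "second_ff A c h p X Y = \<phi> p (second_ff A c g p (J_rot c g \<theta> p X) Y)"
    using assoc c p(2) unfolding associated_member_def by blast
  also have "\<dots> \<bullet> \<phi> p w = second_ff A c g p (J_rot c g \<theta> p X) Y \<bullet> w" by (rule \<phi>_inner[OF nn w])
  also have "\<dots> = dd (J_rot c g \<theta> p X) (dd Y (in_chart c g)) (snd c p) \<bullet> w"
    unfolding sg by (rule g.nproj_inner[OF v wn])
  finally show ?thesis .
qed

lemma chart_values:
  assumes "p \<in> fst c"
  shows "E s (snd c p) = e s p" "\<Phi> s (snd c p) = f s p"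
    "E' s (snd c p) = \<phi> p (\<xi> s p)" "\<Phi>' s (snd c p) = \<phi> p (\<eta> s p)"
  unfolding E_def \<Phi>_def E'_def \<Phi>'_def by (rule at[OF assms])+

lemma V_point:
  assumes "v \<in> V"
  obtains p where "p \<in> U" "p \<in> fst c" "v = snd c p"
  using assms unfolding V_def by blast

lemma turned_gram:
  assumes v: "v \<in> V" and s: "s \<in> {1..m}" and t: "t \<in> {1..m}"
  shows "E' s v \<bullet> E' t v = (if s = t then 1 else 0)" "\<Phi>' s v \<bullet> \<Phi>' t v = (if s = t then 1 else 0)"
    "E' s v \<bullet> \<Phi>' t v = 0"
proof -
  obtain p where p: "p \<in> U" "p \<in> fst c" "v = snd c p" using V_point[OF v] .
  note n = turned_normal[OF p(1) s] turned_normal[OF p(1) t]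
  note cv = chart_values[OF p(2)]
  have EF: "e s p \<bullet> e t p = (if s = t then 1 else 0)" "f s p \<bullet> f t p = (if s = t then 1 else 0)"
    "e s p \<bullet> f t p = 0" "f s p \<bullet> e t p = 0"
    using G.EE[OF s t v] G.\<Phi>\<Phi>[OF s t v] G.E\<Phi>[OF s t v] G.E\<Phi>[OF t s v] unfolding p(3) cv by (simp_all add: inner_commute)
  have cs: "cos \<theta> * cos \<theta> + sin \<theta> * sin \<theta> = 1" by (metis sin_cos_squared_add3)
  show "E' s v \<bullet> E' t v = (if s = t then 1 else 0)"
    unfolding p(3) cv \<phi>_inner[OF n(1,3)] unfolding \<xi>_def using cs by (simp add: inner_add_left inner_add_right EF)
  show "\<Phi>' s v \<bullet> \<Phi>' t v = (if s = t then 1 else 0)"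
    unfolding p(3) cv \<phi>_inner[OF n(2,4)] unfolding \<eta>_def using cs by (simp add: inner_add_left inner_add_right inner_diff_left inner_diff_right EF)
  show "E' s v \<bullet> \<Phi>' t v = 0"
    unfolding p(3) cv \<phi>_inner[OF n(1,4)] unfolding \<xi>_def \<eta>_def by (simp add: inner_add_left inner_add_right inner_diff_right EF)
qed

lemma turned_frame: "normal_frame V (in_chart c h) m E' \<Phi>'"
proof
  fix s assume s: "s \<in> {1..m}"
  show "smooth_on (E' s) V" "smooth_on (\<Phi>' s) V"
    using \<phi>_parallel(1)[OF U turned_smooth(1)[OF s] turned_normal(1)[OF _ s]]
      \<phi>_parallel(1)[OF U turned_smooth(2)[OF s] turned_normal(2)[OF _ s]] c
    unfolding smooth_map_def E'_def \<Phi>'_def V_def by blast+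
  fix v assume v: "v \<in> V"
  obtain p where p: "p \<in> U" "p \<in> fst c" "v = snd c p" using V_point[OF v] .
  show "E' s v \<in> h.normal v" "\<Phi>' s v \<in> h.normal v"
    using turned_normal[OF p(1) s] \<phi>_image[of p] normal_h[of p] p unfolding p(3) chart_values[OF p(2)] by blast+
  fix t assume t: "t \<in> {1..m}"
  show "E' s v \<bullet> E' t v = (if s = t then 1 else 0)" "\<Phi>' s v \<bullet> \<Phi>' t v = (if s = t then 1 else 0)"
    "E' s v \<bullet> \<Phi>' t v = 0" by (rule turned_gram[OF v s t])+
qed

lemma patch_metric:
  assumes "v \<in> V"
  shows "dd X (in_chart c g) v \<bullet> dd Y (in_chart c g) v = dd X (in_chart c h) v \<bullet> dd Y (in_chart c h) v"
proof -
  obtain p where p: "p \<in> U" "p \<in> fst c" "v = snd c p" using V_point[OF assms] .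
  show ?thesis using metric[OF c p(2), of X Y] unfolding p(3) dmap_eq_dd .
qed

text \<open>The complex structure acts on the second fundamental form as the quarter turn of the first plane.
  So rotating the argument by \<open>\<theta>\<close> and the frame by \<open>\<theta>\<close> cancel; the other planes do not meet the second
  fundamental form.\<close>
lemma sff_equal:
  assumes v: "v \<in> V0" and s: "s \<in> {1..m}"
  shows "dd X (dd Y (in_chart c g)) v \<bullet> E s v = dd X (dd Y (in_chart c h)) v \<bullet> E' s v"
    "dd X (dd Y (in_chart c g)) v \<bullet> \<Phi> s v = dd X (dd Y (in_chart c h)) v \<bullet> \<Phi>' s v"
proof -
  obtain p where p: "p \<in> W" "p \<in> U" "p \<in> fst c" "v = snd c p" using v unfolding V0_def by blast
  have vV: "v \<in> V" using v V0_V by blast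
  note cv = chart_values[OF p(3)]
  interpret ad: adapted_point A c g p m "\<lambda>s. E s (snd c p)" "\<lambda>s. \<Phi> s (snd c p)" by (rule adapted[OF p(1-3)])
  note n = turned_normal[OF p(2) s]
  have D: "dd P (dd Q (in_chart c g)) (snd c p) = ad.D [P, Q]" for P Q by (simp add: ad.D_def)
  have rhs: "dd X (dd Y (in_chart c h)) (snd c p) \<bullet> E' s (snd c p) = ad.D [J_rot c g \<theta> p X, Y] \<bullet> \<xi> s p"
    "dd X (dd Y (in_chart c h)) (snd c p) \<bullet> \<Phi>' s (snd c p) = ad.D [J_rot c g \<theta> p X, Y] \<bullet> \<eta> s p"
    unfolding cv sff_transfer[OF n(1) p(2,3)] sff_transfer[OF n(2) p(2,3)] D by simp_all
  have "ad.D [X, Y] \<bullet> e s p = ad.D [J_rot c g \<theta> p X, Y] \<bullet> \<xi> s p \<and> ad.D [X, Y] \<bullet> f s p = ad.D [J_rot c g \<theta> p X, Y] \<bullet> \<eta> s p"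
  proof (cases "X = 0")
    case True
    have "dd 0 (dd Y (in_chart c F)) (snd c p) = 0" if "smooth_on (in_chart c F) V" for F :: "'a \<Rightarrow> 'b"
      using linear_0[OF linear_dd[OF smooth_on_differentiable[OF smooth_on_dd[OF that open_V(1)] open_V(1) vV]]] p(4) by simp
    then have "ad.D [X, Y] = 0" "dd X (dd Y (in_chart c h)) (snd c p) = 0"
      using g.G h.G unfolding True by (simp_all add: ad.D_def)
    then show ?thesis using rhs by simp
  next
    case False
    define Z where "Z = cstruct c g p X"
    have J: "ad.D [J_rot c g \<theta> p X, Y] = cos \<theta> *\<^sub>R ad.D [X, Y] + sin \<theta> *\<^sub>R ad.D [Z, Y]"
      unfolding J_rot_def Z_def by (rule ad.D_lin)
    show ?thesis
    proof (cases "s = 1")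
      case True
      have t: "ad.D [Z, Y] \<bullet> e 1 p = - (ad.D [X, Y] \<bullet> f 1 p)" "ad.D [Z, Y] \<bullet> f 1 p = ad.D [X, Y] \<bullet> e 1 p"
        using ad.second_order_turn[OF m False, of Y] unfolding cv Z_def by simp_all
      show ?thesis
        unfolding True J \<xi>_def \<eta>_def inner_add_left inner_add_right inner_scaleR_left inner_scaleR_right t
        using cos_sin_collapse[of \<theta> "ad.D [X, Y] \<bullet> e 1 p"] cos_sin_collapse[of \<theta> "ad.D [X, Y] \<bullet> f 1 p"] by (simp add: algebra_simps)
    next
      case False
      then have "2 \<le> s" using s by simp
      then have "ad.D [P, Y] \<bullet> e s p = 0" "ad.D [P, Y] \<bullet> f s p = 0" for P
        using ad.plane_orth_D[OF s, of "E s (snd c p)" "[P, Y]"] ad.plane_orth_D[OF s, of "\<Phi> s (snd c p)" "[P, Y]"]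
        unfolding cv by (simp_all add: span_base)
      then show ?thesis by (simp add: \<xi>_def \<eta>_def inner_add_right inner_diff_right)
    qed
  qed
  then show "dd X (dd Y (in_chart c g)) v \<bullet> E s v = dd X (dd Y (in_chart c h)) v \<bullet> E' s v"
    "dd X (dd Y (in_chart c g)) v \<bullet> \<Phi> s v = dd X (dd Y (in_chart c h)) v \<bullet> \<Phi>' s v"
    unfolding p(4) rhs D cv(1,2) by blast+
qed

text \<open>A connection that commutes with the quarter turn has the same components in the turned frame. For
  \<open>s = t\<close> the commutation comes from the skew symmetry, for \<open>s \<noteq> t\<close> from the circular ellipses.\<close>
lemma conn_equal:
  assumes v: "v \<in> V0" and s: "s \<in> {1..m}" and t: "t \<in> {1..m}"
  shows "dd Z (E s) v \<bullet> E t v = dd Z (E' s) v \<bullet> E' t v" "dd Z (E s) v \<bullet> \<Phi> t v = dd Z (E' s) v \<bullet> \<Phi>' t v"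
    "dd Z (\<Phi> s) v \<bullet> E t v = dd Z (\<Phi>' s) v \<bullet> E' t v" "dd Z (\<Phi> s) v \<bullet> \<Phi> t v = dd Z (\<Phi>' s) v \<bullet> \<Phi>' t v"
proof -
  have vV: "v \<in> V" using v V0_V by blast
  obtain p where p: "p \<in> U" "p \<in> fst c" "v = snd c p" using V_point[OF vV] .
  note cv = chart_values[OF p(2)]
  note d = smooth_on_differentiable[OF _ open_V(1) vV]
  have inner_part: "dd Z (\<lambda>w. x *\<^sub>R E s w + y *\<^sub>R \<Phi> s w) v = x *\<^sub>R dd Z (E s) v + y *\<^sub>R dd Z (\<Phi> s) v" for x y
  proof -
    have c: "smooth_on (\<lambda>w. x) V" "smooth_on (\<lambda>w. y) V" for x y :: real by (rule smooth_on_const[OF open_V(1)])+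
    note xE = smooth_on_scaleR[OF c(1) G.smE[OF s] open_V(1), of x]
    note yF = smooth_on_scaleR[OF c(1) G.sm\<Phi>[OF s] open_V(1), of y]
    show ?thesis
      unfolding dd_add[OF d[OF xE] d[OF yF]] dd_scaleR[OF d[OF c(1)] d[OF G.smE[OF s]]]
        dd_scaleR[OF d[OF c(1)] d[OF G.sm\<Phi>[OF s]]] dd_const by simp
  qed
  have \<xi>c: "in_chart c (\<xi> s) = (\<lambda>w. cos \<theta> *\<^sub>R E s w + sin \<theta> *\<^sub>R \<Phi> s w)"
    by (simp add: \<xi>_def E_def \<Phi>_def in_chart_def fun_eq_iff)
  have \<eta>c: "in_chart c (\<eta> s) = (\<lambda>w. (- sin \<theta>) *\<^sub>R E s w + cos \<theta> *\<^sub>R \<Phi> s w)"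
    by (simp add: \<eta>_def E_def \<Phi>_def in_chart_def fun_eq_iff)
  have tr: "dd Z (E' s) v \<bullet> \<phi> p b = dd Z (in_chart c (\<xi> s)) v \<bullet> b"
    "dd Z (\<Phi>' s) v \<bullet> \<phi> p b = dd Z (in_chart c (\<eta> s)) v \<bullet> b" if b: "b \<in> normal_space A g p" for b
    unfolding p(3) E'_def \<Phi>'_def
    by (rule conn_transfer[OF turned_smooth(1)[OF s] turned_normal(1)[OF _ s] b p(1,2)],
        assumption, rule conn_transfer[OF turned_smooth(2)[OF s] turned_normal(2)[OF _ s] b p(1,2)])
  note n = turned_normal[OF p(1) t]
  have R: "dd Z (E' s) v \<bullet> E' t v = (cos \<theta> *\<^sub>R dd Z (E s) v + sin \<theta> *\<^sub>R dd Z (\<Phi> s) v) \<bullet> (cos \<theta> *\<^sub>R E t v + sin \<theta> *\<^sub>R \<Phi> t v)"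
    "dd Z (E' s) v \<bullet> \<Phi>' t v = (cos \<theta> *\<^sub>R dd Z (E s) v + sin \<theta> *\<^sub>R dd Z (\<Phi> s) v) \<bullet> (cos \<theta> *\<^sub>R \<Phi> t v + (- sin \<theta>) *\<^sub>R E t v)"
    "dd Z (\<Phi>' s) v \<bullet> E' t v = ((- sin \<theta>) *\<^sub>R dd Z (E s) v + cos \<theta> *\<^sub>R dd Z (\<Phi> s) v) \<bullet> (cos \<theta> *\<^sub>R E t v + sin \<theta> *\<^sub>R \<Phi> t v)"
    "dd Z (\<Phi>' s) v \<bullet> \<Phi>' t v = ((- sin \<theta>) *\<^sub>R dd Z (E s) v + cos \<theta> *\<^sub>R dd Z (\<Phi> s) v) \<bullet> (cos \<theta> *\<^sub>R \<Phi> t v + (- sin \<theta>) *\<^sub>R E t v)"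
    using tr(1)[OF n(1)] tr(1)[OF n(2)] tr(2)[OF n(1)] tr(2)[OF n(2)]
    unfolding \<xi>c \<eta>c inner_part unfolding p(3) cv \<xi>_def[of t] \<eta>_def[of t] by blast+
  have skew: "dd Z a v \<bullet> b v = - (dd Z b v \<bullet> a v)" if "smooth_on a V" "smooth_on b V" "\<And>w. w \<in> V \<Longrightarrow> a w \<bullet> b w = k" for a b k
    using inner_const_deriv_skew[OF open_V(1) vV that, of Z] by (simp add: inner_commute)
  have main: "dd Z (\<Phi> s) v \<bullet> \<Phi> t v = dd Z (E s) v \<bullet> E t v \<and> dd Z (\<Phi> s) v \<bullet> E t v = - (dd Z (E s) v \<bullet> \<Phi> t v)"
  proof (cases "s = t")
    case True
    have "dd Z (E s) v \<bullet> E s v = 0" "dd Z (\<Phi> s) v \<bullet> \<Phi> s v = 0"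
      using skew[OF G.smE[OF s] G.smE[OF s] G.EE[OF s s]] skew[OF G.sm\<Phi>[OF s] G.sm\<Phi>[OF s] G.\<Phi>\<Phi>[OF s s]] by simp_all
    moreover have "dd Z (\<Phi> s) v \<bullet> E s v = - (dd Z (E s) v \<bullet> \<Phi> s v)"
      using skew[OF G.smE[OF s] G.sm\<Phi>[OF s] G.E\<Phi>[OF s s]] by simp
    ultimately show ?thesis using True by simp
  next
    case False
    have sm0: "smooth_on (E s) V0" "smooth_on (\<Phi> s) V0" if "s \<in> {1..m}" for s
      using smooth_on_subset[OF _ open_V(2) V0_V] smooth_EF[OF that] by blast+
    show ?thesis using connection_turn[OF open_V(2) v adapted_V0 sm0 s t False, of Z] by simp
  qed
  define a b where "a = dd Z (E s) v \<bullet> E t v" and "b = dd Z (E s) v \<bullet> \<Phi> t v"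
  have ab: "dd Z (\<Phi> s) v \<bullet> \<Phi> t v = a" "dd Z (\<Phi> s) v \<bullet> E t v = - b" using main by (simp_all add: a_def b_def)
  show "dd Z (E s) v \<bullet> E t v = dd Z (E' s) v \<bullet> E' t v" "dd Z (E s) v \<bullet> \<Phi> t v = dd Z (E' s) v \<bullet> \<Phi>' t v"
    "dd Z (\<Phi> s) v \<bullet> E t v = dd Z (\<Phi>' s) v \<bullet> E' t v" "dd Z (\<Phi> s) v \<bullet> \<Phi> t v = dd Z (\<Phi>' s) v \<bullet> \<Phi>' t v"
    unfolding R inner_add_left inner_add_right inner_scaleR_left inner_scaleR_right a_def[symmetric] b_def[symmetric] ab
    using cos_sin_collapse[of \<theta> a] cos_sin_collapse[of \<theta> b] by (simp_all add: algebra_simps)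
qed

text \<open>The two frames are congruent over a ball in the chart. The quarter turn extends the statement
  from the frame vectors to all vectors of the normal planes.\<close>
lemma local_transport:
  assumes p0: "p0 \<in> U" "p0 \<in> fst c"
  shows "\<exists>S T. open S \<and> p0 \<in> S \<and> (\<forall>q\<in>S. transports q T)"
proof -
  have v0: "snd c p0 \<in> V" using p0 unfolding V_def by blast
  obtain r where r: "r > 0" "ball (snd c p0) r \<subseteq> V" using open_V(1) v0 open_contains_ball by blast
  define B where "B = ball (snd c p0) r"
  have BV: "B \<subseteq> V" using r by (simp add: B_def)
  have convB: "convex B" by (simp add: B_def)
  have vB: "snd c p0 \<in> B" using r by (simp add: B_def)
  show ?thesis
  proof (rule patches_congruent[OF G.normal_frame_axioms turned_frame dim patch_metric dense sff_equal
          conn_equal vB convB BV])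
    fix T assume T: "orthogonal_transformation T" "\<And>v. v \<in> B \<Longrightarrow> T (in_chart c g v) = in_chart c h v"
    "\<And>v X. v \<in> B \<Longrightarrow> T (dd X (in_chart c g) v) = dd X (in_chart c h) v"
    "\<And>v s. v \<in> B \<Longrightarrow> s \<in> {1..m} \<Longrightarrow> T (E s v) = E' s v"
    "\<And>v s. v \<in> B \<Longrightarrow> s \<in> {1..m} \<Longrightarrow> T (\<Phi> s v) = \<Phi>' s v"
    have lin: "linear T" using T(1) unfolding orthogonal_transformation_def by blast
    define S where "S = inv_into (fst c) (snd c) ` B"
    have "open S"
      unfolding S_def by (rule open_chart_preimage[OF A c]) (use BV in \<open>auto simp: B_def V_def\<close>)
    moreover have "p0 \<in> S"
      unfolding S_def using vB chart_inv(1)[OF A c p0(2)] by (metis imageI)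
    moreover have "transports q T" if q: "q \<in> S" for q
    proof -
      obtain v where v: "v \<in> B" "q = inv_into (fst c) (snd c) v" using q unfolding S_def by blast
      have vV: "v \<in> V" using v BV by blast
      have q: "q \<in> U" "q \<in> fst c" "snd c q = v"
        using chart_inv(2,3)[OF A c, of "U \<inter> fst c" v] vV unfolding V_def v(2) by auto
      note cv = chart_values[OF q(2), unfolded q(3)]
      have Tg: "T (g q) = h q" using T(2)[OF v(1)] at[OF q(2), of g] at[OF q(2), of h] unfolding q(3) by simp
      have Td: "T (dmap c' g q X) = dmap c' h q X" if c': "c' \<in> A" "q \<in> fst c'" for c' X
      proof -
        obtain Y where Y: "\<And>F :: 'a \<Rightarrow> 'b. smooth_map A UNIV F \<Longrightarrow> dmap c' F q X = dmap c F q Y"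
          using dmap_chart_change[OF A c q(2) c', of X] by blast
        have "dmap c' g q X = dmap c g q Y" "dmap c' h q X = dmap c h q Y"
          using Y imm_g imm_h unfolding sphere_immersion_def by blast+
        then show ?thesis using T(3)[OF v(1), of Y] by (simp add: dmap_eq_dd q(3))
      qed
      have Tn: "T x = \<phi> q (cos \<theta> *\<^sub>R x + sin \<theta> *\<^sub>R quarter_turn (N s q) (pos s q) x)"
        if s: "s \<in> {1..m}" and x: "x \<in> N s q" for s x
      proof -
        have o: "oriented_onb (N s q) (pos s q) (e s q) (f s q)" by (rule onb[OF q(1) s])
        define a b where "a = x \<bullet> e s q" and "b = x \<bullet> f s q"
        have xe: "x = a *\<^sub>R e s q + b *\<^sub>R f s q"
          unfolding a_def b_def using span_pair_coords[of "e s q" "f s q" x] o x unfolding oriented_onb_def by blast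
        have qt: "quarter_turn (N s q) (pos s q) x = a *\<^sub>R f s q - b *\<^sub>R e s q"
          unfolding a_def b_def by (rule quarter_turn_onb[OF o x])
        note n = turned_normal[OF q(1) s]
        have "T x = a *\<^sub>R \<phi> q (\<xi> s q) + b *\<^sub>R \<phi> q (\<eta> s q)"
          using T(4,5)[OF v(1) s] unfolding cv by (subst xe) (simp add: linear_add[OF lin] linear_scale[OF lin])
        also have "\<dots> = \<phi> q (a *\<^sub>R \<xi> s q + b *\<^sub>R \<eta> s q)"
          using n subspace_scale[OF subspace_normal_space] by (simp add: \<phi>_add \<phi>_scale)
        also have "a *\<^sub>R \<xi> s q + b *\<^sub>R \<eta> s q = cos \<theta> *\<^sub>R (a *\<^sub>R e s q + b *\<^sub>R f s q) + sin \<theta> *\<^sub>R (a *\<^sub>R f s q - b *\<^sub>R e s q)"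
          unfolding \<xi>_def \<eta>_def by (simp add: algebra_simps)
        finally show ?thesis unfolding qt xe[symmetric] .
      qed
      show ?thesis unfolding transports_def using T(1) Tg Td Tn by blast
    qed
    ultimately show ?thesis by blast
  qed
qed

text \<open>The full frame has as many members as the ambient dimension. So the remainder, being orthogonal to
  all of them, vanishes.\<close>
lemma normal_expansion:
  assumes q: "q \<in> U" "q \<in> fst c" and x: "x \<in> normal_space A g q"
  shows "x = (\<Sum>s\<in>{1..m}. (x \<bullet> e s q) *\<^sub>R e s q + (x \<bullet> f s q) *\<^sub>R f s q)"
proof -
  define v where "v = snd c q"
  have v: "v \<in> V" using q unfolding V_def v_def by blast
  note cv = chart_values(1,2)[OF q(2), folded v_def]
  have I: "finite (frame_index m)" "card (frame_index m) = DIM('b)" using frame_index_card[of m] dim by simp_all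
  define r where "r = x - (\<Sum>s\<in>{1..m}. (x \<bullet> E s v) *\<^sub>R E s v + (x \<bullet> \<Phi> s v) *\<^sub>R \<Phi> s v)"
  have xn: "x \<in> g.normal v" using x normal_g[of q] q by (simp add: v_def)
  have sn: "(\<Sum>s\<in>{1..m}. (x \<bullet> E s v) *\<^sub>R E s v + (x \<bullet> \<Phi> s v) *\<^sub>R \<Phi> s v) \<in> g.normal v"
    by (intro subspace_sum subspace_add subspace_scale g.subspace_normal G.norE G.nor\<Phi> v)
  have rn: "r \<in> g.normal v" unfolding r_def by (rule subspace_diff[OF g.subspace_normal xn sn])
  have rE: "r \<bullet> E t v = 0" if t: "t \<in> {1..m}" for t
  proof -
    have "(\<Sum>s\<in>{1..m}. (x \<bullet> E s v) *\<^sub>R E s v + (x \<bullet> \<Phi> s v) *\<^sub>R \<Phi> s v) \<bullet> E t v = (\<Sum>s\<in>{1..m}. if s = t then x \<bullet> E t v else 0)"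
      unfolding inner_sum_left
      by (rule sum.cong) (use G.EE[OF _ t v] G.E\<Phi>[OF t _ v] in \<open>auto simp: inner_add_left inner_commute[of "\<Phi> _ v"]\<close>)
    then show ?thesis using t by (simp add: r_def inner_diff_left)
  qed
  have rF: "r \<bullet> \<Phi> t v = 0" if t: "t \<in> {1..m}" for t
  proof -
    have "(\<Sum>s\<in>{1..m}. (x \<bullet> E s v) *\<^sub>R E s v + (x \<bullet> \<Phi> s v) *\<^sub>R \<Phi> s v) \<bullet> \<Phi> t v = (\<Sum>s\<in>{1..m}. if s = t then x \<bullet> \<Phi> t v else 0)"
      unfolding inner_sum_left
      by (rule sum.cong) (use G.\<Phi>\<Phi>[OF _ t v] G.E\<Phi>[OF _ t v] in \<open>auto simp: inner_add_left\<close>)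
    then show ?thesis using t by (simp add: r_def inner_diff_left)
  qed
  have "r \<bullet> G.Fr i v = 0" if i: "i \<in> frame_index m" for i
    by (rule frame_index_cases[OF i]) (simp_all only: G.Fr_simps G.normal_zero[OF rn v] rE rF)
  then have "(\<Sum>i\<in>frame_index m. (r \<bullet> G.Fr i v) *\<^sub>R G.Fr i v) = 0" by simp
  moreover have "(\<Sum>i\<in>frame_index m. (r \<bullet> G.Fr i v) *\<^sub>R G.Fr i v) = r"
    by (rule orthonormal_expansion[OF I G.Fr_orthonormal[OF v]])
  ultimately have "r = 0" by simp
  then show ?thesis unfolding r_def cv by simp
qed

lemma transports_unique_at:
  assumes q: "q \<in> U" "q \<in> fst c" and T: "transports q T" and T': "transports q T'"
  shows "T = T'"
proof
  fix x
  define v where "v = snd c q"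
  have v: "v \<in> V" using q unfolding V_def v_def by blast
  note cv = chart_values(1,2)[OF q(2), folded v_def]
  have I: "finite (frame_index m)" "card (frame_index m) = DIM('b)" using frame_index_card[of m] dim by simp_all
  have lin: "linear T" "linear T'" using T T' unfolding transports_def orthogonal_transformation_def by blast+
  have pos0: "T (in_chart c g v) = T' (in_chart c g v)"
    using T T' unfolding transports_def v_def at[OF q(2)] by simp
  have tan: "T (dd X (in_chart c g) v) = T' (dd X (in_chart c g) v)" for X
    using T T' c q(2) unfolding transports_def v_def dmap_eq_dd by simp
  have tt: "T (g.t1 v) = T' (g.t1 v)" "T (g.t2 v) = T' (g.t2 v)"
    using g.t_in_range[OF v] tan by auto
  have EF: "T (E s v) = T' (E s v)" "T (\<Phi> s v) = T' (\<Phi> s v)" if s: "s \<in> {1..m}" for s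
  proof -
    have "e s q \<in> N s q" "f s q \<in> N s q"
      using onb[OF q(1) s] unfolding oriented_onb_def by (auto intro: span_base)
    then show "T (E s v) = T' (E s v)" "T (\<Phi> s v) = T' (\<Phi> s v)"
      using T T' s unfolding transports_def cv by simp_all
  qed
  have fr: "T (G.Fr i v) = T' (G.Fr i v)" if i: "i \<in> frame_index m" for i
    by (rule frame_index_cases[OF i]) (simp_all only: G.Fr_simps pos0 tt EF)
  have x: "x = (\<Sum>i\<in>frame_index m. (x \<bullet> G.Fr i v) *\<^sub>R G.Fr i v)"
    by (rule orthonormal_expansion[OF I G.Fr_orthonormal[OF v], symmetric])
  have "T (\<Sum>i\<in>frame_index m. (x \<bullet> G.Fr i v) *\<^sub>R G.Fr i v) = T' (\<Sum>i\<in>frame_index m. (x \<bullet> G.Fr i v) *\<^sub>R G.Fr i v)"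
    unfolding linear_sum[OF lin(1)] linear_sum[OF lin(2)] linear_scale[OF lin(1)] linear_scale[OF lin(2)]
    by (rule sum.cong) (simp_all add: fr)
  then show "T x = T' x" using x by simp
qed

text \<open>The rotations by \<open>- \<theta>\<close> and \<open>\<theta>\<close> cancel in each plane and leave \<open>\<phi>\<close>. The vectors of \<open>\<Lambda>\<close> have no
  component in the first plane, which \<open>Lam_rot\<close> leaves out.\<close>
lemma transports_Lam:
  assumes q: "q \<in> U" "q \<in> fst c" and T: "transports q T" and x: "x \<in> Lam A g (N 1) q"
  shows "T (Lam_rot N pos m (- \<theta>) q x) = \<phi> q x"
proof -
  have lin: "linear T" using T unfolding transports_def orthogonal_transformation_def by blast
  have xn: "x \<in> normal_space A g q" and x1: "\<And>w. w \<in> N 1 q \<Longrightarrow> x \<bullet> w = 0"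
    using x unfolding Lam_def by auto
  note o = onb[OF q(1)]
  have inN: "e s q \<in> N s q" "f s q \<in> N s q" if "s \<in> {1..m}" for s
    using o[OF that] unfolding oriented_onb_def by (auto intro: span_base)
  define w where "w s = (x \<bullet> e s q) *\<^sub>R e s q + (x \<bullet> f s q) *\<^sub>R f s q" for s
  have wo: "oproj (N s q) x = w s" if "s \<in> {1..m}" for s
    using o[OF that] oproj_span_pair[of "e s q" "f s q" x] unfolding oriented_onb_def w_def by simp
  have subN: "subspace (N s q)" if "s \<in> {1..m}" for s
    using o[OF that] unfolding oriented_onb_def by simp
  have wN: "w s \<in> N s q" if "s \<in> {1..m}" for s
    unfolding w_def by (intro subspace_add subspace_scale subN that inN)
  have wn: "w s \<in> normal_space A g q" if "s \<in> {1..m}" for s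
    unfolding w_def by (intro subspace_add subspace_scale subspace_normal_space frame_normal_U q that)
  have one: "1 \<in> {1..m}" using m by simp
  have "x = (\<Sum>s\<in>{1..m}. w s)" unfolding w_def by (rule normal_expansion[OF q xn])
  also have "\<dots> = w 1 + (\<Sum>s\<in>{2..m}. w s)" using m by (simp add: sum.atLeast_Suc_atMost numeral_2_eq_2)
  also have "w 1 = 0" using x1[OF inN(1)[OF one]] x1[OF inN(2)[OF one]] by (simp add: w_def)
  finally have xs: "x = (\<Sum>s\<in>{2..m}. w s)" by simp
  have turn: "T (cos (- \<theta>) *\<^sub>R w s + sin (- \<theta>) *\<^sub>R quarter_turn (N s q) (pos s q) (w s)) = \<phi> q (w s)"
    if s: "s \<in> {1..m}" for s
  proof -
    let ?J = "quarter_turn (N s q) (pos s q)"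
    have J: "?J y = (y \<bullet> e s q) *\<^sub>R f s q - (y \<bullet> f s q) *\<^sub>R e s q" if "y \<in> N s q" for y
      by (rule quarter_turn_onb[OF o[OF s] that])
    define y where "y = cos (- \<theta>) *\<^sub>R w s + sin (- \<theta>) *\<^sub>R ?J (w s)"
    define a b where "a = x \<bullet> e s q" and "b = x \<bullet> f s q"
    have on: "e s q \<bullet> e s q = 1" "f s q \<bullet> f s q = 1" "e s q \<bullet> f s q = 0" "f s q \<bullet> e s q = 0"
      using o[OF s] unfolding oriented_onb_def by (simp_all add: inner_commute)
    have w: "w s = a *\<^sub>R e s q + b *\<^sub>R f s q" by (simp add: w_def a_def b_def)
    have Jw: "?J (w s) = a *\<^sub>R f s q - b *\<^sub>R e s q"
      unfolding J[OF wN[OF s]] by (simp add: w inner_add_left on)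
    have y: "y = (cos \<theta> * a + sin \<theta> * b) *\<^sub>R e s q + (cos \<theta> * b - sin \<theta> * a) *\<^sub>R f s q"
      unfolding y_def Jw unfolding w by (simp add: algebra_simps)
    have yN: "y \<in> N s q" unfolding y by (intro subspace_add subspace_scale subN s inN)
    have Jy: "?J y = (cos \<theta> * a + sin \<theta> * b) *\<^sub>R f s q - (cos \<theta> * b - sin \<theta> * a) *\<^sub>R e s q"
      unfolding J[OF yN] unfolding y by (simp add: inner_add_left on)
    have "cos \<theta> *\<^sub>R y + sin \<theta> *\<^sub>R ?J y =
      (cos \<theta> * (cos \<theta> * a + sin \<theta> * b) - sin \<theta> * (cos \<theta> * b - sin \<theta> * a)) *\<^sub>R e s q
      + (cos \<theta> * (cos \<theta> * b - sin \<theta> * a) + sin \<theta> * (cos \<theta> * a + sin \<theta> * b)) *\<^sub>R f s q"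
      unfolding Jy unfolding y by (simp add: algebra_simps)
    also have "cos \<theta> * (cos \<theta> * a + sin \<theta> * b) - sin \<theta> * (cos \<theta> * b - sin \<theta> * a) = a"
      using cos_sin_collapse[of \<theta> a] by (simp add: algebra_simps)
    also have "cos \<theta> * (cos \<theta> * b - sin \<theta> * a) + sin \<theta> * (cos \<theta> * a + sin \<theta> * b) = b"
      using cos_sin_collapse[of \<theta> b] by (simp add: algebra_simps)
    finally have "cos \<theta> *\<^sub>R y + sin \<theta> *\<^sub>R ?J y = w s" unfolding w .
    then show ?thesis using T s yN unfolding transports_def y_def[symmetric] by simp
  qed
  have \<phi>0: "\<phi> q 0 = 0" using \<phi>_scale[of 0 q 0] subspace_0[OF subspace_normal_space] by simp
  have \<phi>sum: "\<phi> q (\<Sum>s\<in>I. w s) = (\<Sum>s\<in>I. \<phi> q (w s))" if "finite I" "I \<subseteq> {1..m}" for I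
    using that
  proof (induction I rule: finite_induct)
    case empty
    then show ?case by (simp add: \<phi>0)
  next
    case (insert s I)
    have "(\<Sum>s\<in>I. w s) \<in> normal_space A g q"
      using insert by (intro subspace_sum[OF subspace_normal_space] wn) auto
    then show ?case using insert wn by (simp add: \<phi>_add)
  qed
  have "T (Lam_rot N pos m (- \<theta>) q x) =
      (\<Sum>s\<in>{2..m}. T (let w = oproj (N s q) x in cos (- \<theta>) *\<^sub>R w + sin (- \<theta>) *\<^sub>R quarter_turn (N s q) (pos s q) w))"
    unfolding Lam_rot_def by (rule linear_sum[OF lin])
  also have "\<dots> = (\<Sum>s\<in>{2..m}. \<phi> q (w s))"
  proof (rule sum.cong)
    fix s assume "s \<in> {2..m}"
    then have s: "s \<in> {1..m}" by simp
    show "T (let w = oproj (N s q) x in cos (- \<theta>) *\<^sub>R w + sin (- \<theta>) *\<^sub>R quarter_turn (N s q) (pos s q) w) = \<phi> q (w s)"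
      unfolding Let_def wo[OF s] by (rule turn[OF s])
  qed simp
  also have "\<dots> = \<phi> q (\<Sum>s\<in>{2..m}. w s)" by (rule \<phi>sum[symmetric]) auto
  also have "\<dots> = \<phi> q x" using xs by simp
  finally show ?thesis .
qed

end

section \<open>Congruence of the hypersurfaces\<close>

context associated_pair
begin

lemma local_frame_at:
  obtains W U e f c where "local_frame A m g h N pos \<phi> \<theta> W U e f c" "p \<in> U" "p \<in> fst c"
proof -
  obtain W where W: "open W" "closure W = UNIV" and
    Wc: "\<forall>c\<in>A. \<forall>p\<in>W \<inter> fst c.
           normal_space A g p = span (\<Union>s\<in>{1..m}. N s p) \<and>
           (\<forall>s\<in>{1..m}. N s p = curv_space A c g s p \<and>
              (\<forall>X. X \<noteq> 0 \<longrightarrow> pos s p (fund_form A c g p (replicate (s + 1) X))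
                 (fund_form A c g p (cstruct c g p X # replicate s X))))"
    using split unfolding oriented_splitting_def by blast
  obtain U e f where U: "open U" "p \<in> U"
    and sm: "\<And>s. s \<in> {1..m} \<Longrightarrow> smooth_map A U (e s)" "\<And>s. s \<in> {1..m} \<Longrightarrow> smooth_map A U (f s)"
    and o: "\<And>q s. q \<in> U \<Longrightarrow> s \<in> {1..m} \<Longrightarrow> oriented_onb (N s q) (pos s q) (e s q) (f s q)"
    using local_frames[of p thesis] by blast
  obtain c where c: "c \<in> A" "p \<in> fst c" using A unfolding oriented_surface_def by blast
  have "local_frame A m g h N pos \<phi> \<theta> W U e f c"
    by (unfold_locales; (rule W U sm o c Wc[rule_format])?; assumption?)
  then show ?thesis using U(2) c(2) by (rule that)
qed

text \<open>The transformation is unique at each point and locally constant, and the surface is connected.\<close>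
lemma global_transport: "\<exists>T. \<forall>p. transports p T"
proof -
  have ex: "\<exists>S T. open S \<and> p \<in> S \<and> (\<forall>q\<in>S. transports q T)" for p
  proof -
    obtain W U e f c where lf: "local_frame A m g h N pos \<phi> \<theta> W U e f c" and p: "p \<in> U" "p \<in> fst c"
      by (rule local_frame_at)
    show ?thesis by (rule local_frame.local_transport[OF lf p])
  qed
  have unique: "T = T'" if "transports p T" "transports p T'" for p T T'
  proof -
    obtain W U e f c where lf: "local_frame A m g h N pos \<phi> \<theta> W U e f c" and p: "p \<in> U" "p \<in> fst c"
      by (rule local_frame_at)
    show ?thesis by (rule local_frame.transports_unique_at[OF lf p that])
  qed
  define \<tau> where "\<tau> p = (SOME T. transports p T)" for p
  have \<tau>: "\<tau> p = T" if "transports p T" for p T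
    unfolding \<tau>_def by (rule some_equality[where P = "transports p", OF that unique[OF _ that]])
  have conn: "connected (UNIV :: 'l set)" using A unfolding oriented_surface_def by blast
  have "\<tau> constant_on UNIV"
  proof (rule locally_constant_imp_constant[OF conn])
    fix p
    obtain S T where S: "open S" "p \<in> S" and T: "\<forall>q\<in>S. transports q T" using ex[of p] by blast
    have const: "\<tau> q = \<tau> p" if "q \<in> S" for q
      unfolding \<tau>[OF T[rule_format, OF that]] \<tau>[OF T[rule_format, OF S(2)]] ..
    show "\<exists>S. openin (top_of_set UNIV) S \<and> p \<in> S \<and> (\<forall>q\<in>S. \<tau> q = \<tau> p)"
    proof (intro exI conjI ballI)
      show "openin (top_of_set UNIV) S" using S(1) by simp
    qed (rule S(2), rule const)
  qed
  then obtain T where T: "\<And>p. \<tau> p = T" unfolding constant_on_def by blast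
  have "transports p T" for p
  proof -
    obtain T' where T': "transports p T'" using ex[of p] by blast
    show ?thesis using T' \<tau>[OF T'] T[of p] by simp
  qed
  then show ?thesis by blast
qed

lemma hypersurfaces_congruent:
  "congruent_on (M_set A g (N 1)) (F_map g \<circ> S_rot N pos m (- \<theta>)) (F_assoc h \<phi>)"
proof -
  obtain T where T: "\<And>p. transports p T" using global_transport by blast
  have ort: "orthogonal_transformation T" and Tg: "\<And>p. T (g p) = h p"
    using T unfolding transports_def by blast+
  have lin: "linear T" using ort unfolding orthogonal_transformation_def by blast
  have "F_assoc h \<phi> (s, p, v) = T ((F_map g \<circ> S_rot N pos m (- \<theta>)) (s, p, v))"
    if v: "v \<in> Lam A g (N 1) p" for s p v
  proof -
    obtain W U e f c where lf: "local_frame A m g h N pos \<phi> \<theta> W U e f c" and p: "p \<in> U" "p \<in> fst c"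
      by (rule local_frame_at)
    have "T (Lam_rot N pos m (- \<theta>) p v) = \<phi> p v"
      by (rule local_frame.transports_Lam[OF lf p T v])
    then show ?thesis
      by (simp add: F_assoc_def F_map_def S_rot_def linear_add[OF lin] linear_scale[OF lin] Tg)
  qed
  then show ?thesis unfolding congruent_on_def using ort by (intro exI[of _ T]) (auto simp: M_set_def)
qed

end

theorem theorem4:
  fixes A :: "('l::{t2_space,second_countable_topology}) chart set"
    and n m :: nat
    and g h :: "'l \<Rightarrow> 'a::euclidean_space"
    and N :: "nat \<Rightarrow> 'l \<Rightarrow> 'a set"
    and pos :: "nat \<Rightarrow> 'l \<Rightarrow> 'a \<Rightarrow> 'a \<Rightarrow> bool"
    and \<phi> :: "'l \<Rightarrow> 'a \<Rightarrow> 'a"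
    and \<theta> :: real
  assumes "n \<ge> 3" and "DIM('a) = n + 3" and "m = (n + 1) div 2"
    and "oriented_surface A" and "simply_connected (UNIV :: 'l set)"
    and "pseudoholomorphic A n g"
    and "oriented_splitting A m g N pos"
    and "\<theta> \<in> {0..<pi}"
    and "associated_member A m g \<theta> h \<phi>"
  shows "congruent_on (M_set A g (N 1)) (F_map g \<circ> S_rot N pos m (- \<theta>)) (F_assoc h \<phi>)"
proof -
  have n: "even n" and min: "minimal_surface A g"
    and circ: "\<And>c p s. c \<in> A \<Longrightarrow> p \<in> fst c \<Longrightarrow> s \<in> {1..m} \<Longrightarrow> is_circle (curv_ellipse A c g s p)"
    using assms(6) unfolding pseudoholomorphic_def assms(3) by blast+
  have dim: "DIM('a) = 2 * m + 3" and m: "1 \<le> m"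
    using n assms(1-3) by (auto elim!: evenE)
  interpret associated_pair A m g h N pos \<phi> \<theta>
    using assms(4) dim m min circ assms(7,9) by unfold_locales
  show ?thesis by (rule hypersurfaces_congruent)
qed

end
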